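(* Let $(M,g)$ be a pseudo-Riemannian manifold which admits a free $\mathbb{R}_{>0}$-action and let $f: M \rightarrow \mathbb{R}_{>0}$ be a smooth function. Suppose that $(g,f)$ is a homogeneous pair of degree $\alpha \in \mathbb{R}-\{0\}$. Then: (i) for any $l>0$, $M_l = \{x \in M \mid f(x)=l\}$ is a submanifold of $M$, and the pullback $g_l$ of $g$ to $M_l$ is a pseudo-Riemannian metric on $M_l$; (ii) for any $l>0$ and any smooth function $v:\mathbb{R}_{>0}\rightarrow\mathbb{R}_{>0}$, there is an isometry between $$\left(\mathbb{R}_{>0}\times M_l,\ v(r)\left(\frac{1}{\alpha r}\,dr^2+\frac{r}{l}\,g_l\right)\right)\quad\text{and}\quad (M,(v\circ f)g),$$ where $r$ is the coordinate on $\mathbb{R}_{>0}$.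
   Context: For a (smooth) free $\mathbb{R}_{>0}$-action $m:\mathbb{R}_{>0}\times M\to M$ write $m_\lambda=m(\lambda,\cdot)$, and let $P\in\mathfrak{X}(M)$ be the vector field generated by the action, $P_x=\frac{d}{dt}m(e^t,x)|_{t=0}$. For a pseudo-Riemannian metric $g$ on $M$, a smooth function $f:M\to\mathbb{R}_{>0}$ and $\alpha\in\mathbb{R}-\{0\}$, the pair $(g,f)$ is called a homogeneous pair of degree $\alpha$ if $m_\lambda^*g=\lambda^\alpha g$, $m_\lambda^*f=\lambda^\alpha f$ for all $\lambda>0$, and $g(P,\cdot)=df$. *)

theory Defs
  imports "HOL-Analysis.Analysis"
begin

section \<open>Smooth maps between subsets of Euclidean spaces\<close>

fun Ck_on :: "nat \<Rightarrow> 'e::euclidean_space set \<Rightarrow> ('e \<Rightarrow> 'f::euclidean_space) \<Rightarrow> bool" where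
  "Ck_on 0 U h \<longleftrightarrow> continuous_on U h"
| "Ck_on (Suc k) U h \<longleftrightarrow>
     (\<forall>y\<in>U. h differentiable (at y)) \<and> (\<forall>w. Ck_on k U (\<lambda>y. frechet_derivative h (at y) w))"

text \<open>
  On an arbitrary set \<open>S\<close>, smoothness means that the map extends locally to a \<open>C\<^sup>\<infinity>\<close> map on an
  open set. It is used below for sets that are relatively open in a linear subspace, where it
  agrees with the usual notion on open subsets of \<open>\<real>\<^sup>n\<close>.
\<close>

definition smooth_on :: "'e::euclidean_space set \<Rightarrow> ('e \<Rightarrow> 'f::euclidean_space) \<Rightarrow> bool" where
  "smooth_on S h \<longleftrightarrow>
     (\<forall>y\<in>S. \<exists>U h'. open U \<and> y \<in> U \<and> (\<forall>k. Ck_on k U h') \<and> (\<forall>z\<in>S \<inter> U. h' z = h z))"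

definition dir_deriv :: "('e::euclidean_space \<Rightarrow> 'f::euclidean_space) \<Rightarrow> 'e \<Rightarrow> 'e \<Rightarrow> 'f" where
  "dir_deriv h y w = vector_derivative (\<lambda>t. h (y + t *\<^sub>R w)) (at 0)"


section \<open>Smooth manifolds\<close>

text \<open>
  A chart is a pair \<open>(U, \<phi>)\<close>; only the values of \<open>\<phi>\<close> on \<open>U\<close> matter. Coordinates take values in a
  Euclidean space \<open>'e\<close>, and the image \<open>\<phi> ` U\<close> is an open subset of a linear subspace of \<open>'e\<close>, which
  plays the role of \<open>\<real>\<^sup>n\<close>. Since \<open>\<phi> ` U\<close> is nonempty, this subspace is \<open>span (\<phi> ` U)\<close>. Working with
  subspaces allows one type \<open>'e\<close> to carry manifolds of different dimensions (0 included), such as a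
  manifold and its submanifolds.
\<close>

type_synonym ('a, 'e) chart = "'a set \<times> ('a \<Rightarrow> 'e)"

record ('a, 'e) mfd =
  topo :: "'a topology"
  atlas :: "('a, 'e) chart set"

abbreviation points :: "('a, 'e) mfd \<Rightarrow> 'a set" where
  "points M \<equiv> topspace (topo M)"

definition chart_inv :: "('a, 'e) chart \<Rightarrow> 'e \<Rightarrow> 'a" where
  "chart_inv c = inv_into (fst c) (snd c)"

definition model_space :: "('a, 'e::euclidean_space) chart \<Rightarrow> 'e set" where
  "model_space c = span (snd c ` fst c)"

definition is_chart :: "'a topology \<Rightarrow> ('a, 'e::euclidean_space) chart \<Rightarrow> bool" where
  "is_chart T c \<longleftrightarrow>
     fst c \<noteq> {} \<and> openin T (fst c) \<and>
     openin (top_of_set (model_space c)) (snd c ` fst c) \<and>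
     homeomorphic_map (subtopology T (fst c)) (top_of_set (snd c ` fst c)) (snd c)"

definition compatible :: "('a, 'e::euclidean_space) chart \<Rightarrow> ('a, 'e) chart \<Rightarrow> bool" where
  "compatible c d \<longleftrightarrow>
     smooth_on (snd c ` (fst c \<inter> fst d)) (snd d \<circ> chart_inv c) \<and>
     smooth_on (snd d ` (fst c \<inter> fst d)) (snd c \<circ> chart_inv d)"

definition smooth_manifold :: "('a, 'e::euclidean_space) mfd \<Rightarrow> bool" where
  "smooth_manifold M \<longleftrightarrow>
     Hausdorff_space (topo M) \<and> second_countable (topo M) \<and>
     (\<forall>c\<in>atlas M. is_chart (topo M) c) \<and>
     (\<forall>c\<in>atlas M. \<forall>d\<in>atlas M. compatible c d) \<and>
     (\<Union>c\<in>atlas M. fst c) = points M \<and>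
     (\<exists>n. \<forall>c\<in>atlas M. dim (model_space c) = n)"

text \<open>The atlas of a manifold need not be maximal; this is the maximal atlas it generates.\<close>

definition maximal_atlas :: "('a, 'e::euclidean_space) mfd \<Rightarrow> ('a, 'e) chart set" where
  "maximal_atlas M = {c. is_chart (topo M) c \<and> (\<forall>d\<in>atlas M. compatible c d)}"

definition smooth_map ::
  "('a, 'e::euclidean_space) mfd \<Rightarrow> ('b, 'f::euclidean_space) mfd \<Rightarrow> ('a \<Rightarrow> 'b) \<Rightarrow> bool" where
  "smooth_map M N F \<longleftrightarrow>
     continuous_map (topo M) (topo N) F \<and>
     (\<forall>c\<in>atlas M. \<forall>d\<in>atlas N.
        smooth_on (snd c ` (fst c \<inter> F -` fst d)) (snd d \<circ> F \<circ> chart_inv c))"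

definition diffeomorphism ::
  "('a, 'e::euclidean_space) mfd \<Rightarrow> ('b, 'f::euclidean_space) mfd \<Rightarrow> ('a \<Rightarrow> 'b) \<Rightarrow> bool" where
  "diffeomorphism M N F \<longleftrightarrow>
     smooth_map M N F \<and>
     (\<exists>G. smooth_map N M G \<and> (\<forall>x\<in>points M. G (F x) = x) \<and> (\<forall>y\<in>points N. F (G y) = y))"

definition pos_reals :: "(real, real) mfd" where
  "pos_reals = \<lparr> topo = top_of_set {0<..}, atlas = {({0<..}, \<lambda>r. r)} \<rparr>"

definition prod_mfd ::
  "('a, 'e::euclidean_space) mfd \<Rightarrow> ('b, 'f::euclidean_space) mfd \<Rightarrow> ('a \<times> 'b, 'e \<times> 'f) mfd" where
  "prod_mfd M N = \<lparr> topo = prod_topology (topo M) (topo N),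
     atlas = {(fst c \<times> fst d, map_prod (snd c) (snd d)) |c d. c \<in> atlas M \<and> d \<in> atlas N} \<rparr>"


section \<open>Embedded submanifolds\<close>

text \<open>
  Slice charts for \<open>S\<close>: coordinates in which \<open>S\<close> becomes a linear subspace \<open>K\<close>.
\<close>

definition slice_chart ::
  "('a, 'e::euclidean_space) mfd \<Rightarrow> 'a set \<Rightarrow> 'e set \<Rightarrow> ('a, 'e) chart \<Rightarrow> bool" where
  "slice_chart M S K c \<longleftrightarrow>
     c \<in> maximal_atlas M \<and> subspace K \<and> K \<subseteq> model_space c \<and>
     snd c ` (fst c \<inter> S) = snd c ` fst c \<inter> K"

definition submanifold :: "('a, 'e::euclidean_space) mfd \<Rightarrow> 'a set \<Rightarrow> bool" where
  "submanifold M S \<longleftrightarrow>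
     S \<subseteq> points M \<and>
     (\<exists>k. \<forall>x\<in>S. \<exists>K c. slice_chart M S K c \<and> dim K = k \<and> x \<in> fst c)"

text \<open>The induced smooth structure: restrictions of slice charts.\<close>

definition sub_mfd :: "('a, 'e::euclidean_space) mfd \<Rightarrow> 'a set \<Rightarrow> ('a, 'e) mfd" where
  "sub_mfd M S = \<lparr> topo = subtopology (topo M) S,
     atlas = {(fst c \<inter> S, snd c) |c K. slice_chart M S K c \<and> fst c \<inter> S \<noteq> {}} \<rparr>"


section \<open>Tangent vectors and differentials\<close>

text \<open>
  A tangent vector at \<open>x\<close> is the family of its coordinate representations in the charts around
  \<open>x\<close>, related by the differentials of the transition maps (and padded by \<open>0\<close> outside the
  charts around \<open>x\<close>). Linear operations are pointwise.
\<close>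

type_synonym ('a, 'e) tvec = "('a, 'e) chart \<Rightarrow> 'e"

definition charts_at :: "('a, 'e) mfd \<Rightarrow> 'a \<Rightarrow> ('a, 'e) chart set" where
  "charts_at M x = {c \<in> atlas M. x \<in> fst c}"

definition tangent_space :: "('a, 'e::euclidean_space) mfd \<Rightarrow> 'a \<Rightarrow> ('a, 'e) tvec set" where
  "tangent_space M x =
     {X. (\<forall>c. c \<notin> charts_at M x \<longrightarrow> X c = 0) \<and>
         (\<forall>c\<in>charts_at M x. X c \<in> model_space c) \<and>
         (\<forall>c\<in>charts_at M x. \<forall>d\<in>charts_at M x.
            X d = dir_deriv (snd d \<circ> chart_inv c) (snd c x) (X c))}"

text \<open>The tangent vector at \<open>x\<close> whose representation in the chart \<open>c\<close> is \<open>w\<close>.\<close>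

definition coord_vec ::
  "('a, 'e::euclidean_space) mfd \<Rightarrow> ('a, 'e) chart \<Rightarrow> 'a \<Rightarrow> 'e \<Rightarrow> ('a, 'e) tvec" where
  "coord_vec M c x w =
     (\<lambda>d. if d \<in> charts_at M x then dir_deriv (snd d \<circ> chart_inv c) (snd c x) w else 0)"

definition velocity ::
  "('a, 'e::euclidean_space) mfd \<Rightarrow> (real \<Rightarrow> 'a) \<Rightarrow> real \<Rightarrow> ('a, 'e) tvec" where
  "velocity M \<gamma> s =
     (\<lambda>c. if c \<in> charts_at M (\<gamma> s) then vector_derivative (\<lambda>t. snd c (\<gamma> t)) (at s) else 0)"

text \<open>
  The differentials of a map between manifolds and of a real-valued function; for smooth arguments
  and tangent vectors the choice of the chart \<open>c\<close> is immaterial by the chain rule.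
\<close>

definition tangent_map ::
  "('a, 'e::euclidean_space) mfd \<Rightarrow> ('b, 'f::euclidean_space) mfd \<Rightarrow> ('a \<Rightarrow> 'b) \<Rightarrow>
   'a \<Rightarrow> ('a, 'e) tvec \<Rightarrow> ('b, 'f) tvec" where
  "tangent_map M N F x X =
     (let c = (SOME c. c \<in> charts_at M x) in
      (\<lambda>d. if d \<in> charts_at N (F x)
           then dir_deriv (snd d \<circ> F \<circ> chart_inv c) (snd c x) (X c) else 0))"

definition differential ::
  "('a, 'e::euclidean_space) mfd \<Rightarrow> ('a \<Rightarrow> real) \<Rightarrow> 'a \<Rightarrow> ('a, 'e) tvec \<Rightarrow> real" where
  "differential M f x X =
     (let c = (SOME c. c \<in> charts_at M x) in dir_deriv (f \<circ> chart_inv c) (snd c x) (X c))"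


section \<open>Pseudo-Riemannian metrics\<close>

type_synonym ('a, 'e) tensor2 = "'a \<Rightarrow> ('a, 'e) tvec \<Rightarrow> ('a, 'e) tvec \<Rightarrow> real"

definition symmetric_bilinear :: "('a, 'e::euclidean_space) mfd \<Rightarrow> ('a, 'e) tensor2 \<Rightarrow> bool" where
  "symmetric_bilinear M g \<longleftrightarrow>
     (\<forall>x\<in>points M. \<forall>X\<in>tangent_space M x. \<forall>Y\<in>tangent_space M x.
        g x X Y = g x Y X \<and>
        (\<forall>Z\<in>tangent_space M x. \<forall>a b.
           g x (\<lambda>c. a *\<^sub>R X c + b *\<^sub>R Y c) Z = a * g x X Z + b * g x Y Z))"

definition smooth_tensor :: "('a, 'e::euclidean_space) mfd \<Rightarrow> ('a, 'e) tensor2 \<Rightarrow> bool" where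
  "smooth_tensor M g \<longleftrightarrow>
     (\<forall>c\<in>atlas M. \<forall>w\<in>model_space c. \<forall>w'\<in>model_space c.
        smooth_on (snd c ` fst c)
          (\<lambda>y. let x = chart_inv c y in g x (coord_vec M c x w) (coord_vec M c x w')))"

definition nondegenerate :: "('a, 'e::euclidean_space) mfd \<Rightarrow> ('a, 'e) tensor2 \<Rightarrow> bool" where
  "nondegenerate M g \<longleftrightarrow>
     (\<forall>x\<in>points M. \<forall>X\<in>tangent_space M x.
        (\<forall>Y\<in>tangent_space M x. g x X Y = 0) \<longrightarrow> X = (\<lambda>_. 0))"

text \<open>
  The index of \<open>g\<close> at \<open>x\<close>: the largest dimension of a subspace of the tangent space on which \<open>g\<close>
  is negative definite. Subspaces of the tangent space are given in coordinates of a chart \<open>c\<close>.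
\<close>

definition index :: "('a, 'e::euclidean_space) mfd \<Rightarrow> ('a, 'e) tensor2 \<Rightarrow> ('a, 'e) chart \<Rightarrow> 'a \<Rightarrow> nat"
  where
  "index M g c x =
     Max {dim S |S. subspace S \<and> S \<subseteq> model_space c \<and>
                    (\<forall>w\<in>S - {0}. g x (coord_vec M c x w) (coord_vec M c x w) < 0)}"

text \<open>As usual for pseudo-Riemannian metrics, the signature is required to be constant.\<close>

definition pseudo_riemannian_metric ::
  "('a, 'e::euclidean_space) mfd \<Rightarrow> ('a, 'e) tensor2 \<Rightarrow> bool" where
  "pseudo_riemannian_metric M g \<longleftrightarrow>
     symmetric_bilinear M g \<and> smooth_tensor M g \<and> nondegenerate M g \<and>
     (\<exists>\<nu>. \<forall>c\<in>atlas M. \<forall>x\<in>fst c. index M g c x = \<nu>)"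

definition pseudo_riemannian_manifold ::
  "('a, 'e::euclidean_space) mfd \<Rightarrow> ('a, 'e) tensor2 \<Rightarrow> bool" where
  "pseudo_riemannian_manifold M g \<longleftrightarrow> smooth_manifold M \<and> pseudo_riemannian_metric M g"

definition pullback ::
  "('a, 'e::euclidean_space) mfd \<Rightarrow> ('b, 'f::euclidean_space) mfd \<Rightarrow> ('a \<Rightarrow> 'b) \<Rightarrow>
   ('b, 'f) tensor2 \<Rightarrow> ('a, 'e) tensor2" where
  "pullback M N F h = (\<lambda>x X Y. h (F x) (tangent_map M N F x X) (tangent_map M N F x Y))"

definition isometry ::
  "('a, 'e::euclidean_space) mfd \<Rightarrow> ('a, 'e) tensor2 \<Rightarrow>
   ('b, 'f::euclidean_space) mfd \<Rightarrow> ('b, 'f) tensor2 \<Rightarrow> ('a \<Rightarrow> 'b) \<Rightarrow> bool" where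
  "isometry M g N h F \<longleftrightarrow>
     pseudo_riemannian_manifold M g \<and> pseudo_riemannian_manifold N h \<and>
     diffeomorphism M N F \<and>
     (\<forall>x\<in>points M. \<forall>X\<in>tangent_space M x. \<forall>Y\<in>tangent_space M x. pullback M N F h x X Y = g x X Y)"


section \<open>Homogeneous pairs\<close>

definition free_smooth_action :: "('a, 'e::euclidean_space) mfd \<Rightarrow> (real \<Rightarrow> 'a \<Rightarrow> 'a) \<Rightarrow> bool" where
  "free_smooth_action M m \<longleftrightarrow>
     smooth_map (prod_mfd pos_reals M) M (\<lambda>(a, x). m a x) \<and>
     (\<forall>x\<in>points M. m 1 x = x) \<and>
     (\<forall>a>0. \<forall>b>0. \<forall>x\<in>points M. m (a * b) x = m a (m b x)) \<and>
     (\<forall>a>0. \<forall>x\<in>points M. m a x = x \<longrightarrow> a = 1)"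

definition generator ::
  "('a, 'e::euclidean_space) mfd \<Rightarrow> (real \<Rightarrow> 'a \<Rightarrow> 'a) \<Rightarrow> 'a \<Rightarrow> ('a, 'e) tvec" where
  "generator M m x = velocity M (\<lambda>t. m (exp t) x) 0"

definition homogeneous_pair ::
  "('a, 'e::euclidean_space) mfd \<Rightarrow> (real \<Rightarrow> 'a \<Rightarrow> 'a) \<Rightarrow> real \<Rightarrow>
   ('a, 'e) tensor2 \<Rightarrow> ('a \<Rightarrow> real) \<Rightarrow> bool" where
  "homogeneous_pair M m \<alpha> g f \<longleftrightarrow>
     (\<forall>a>0. \<forall>x\<in>points M. \<forall>X\<in>tangent_space M x. \<forall>Y\<in>tangent_space M x.
        pullback M M (m a) g x X Y = a powr \<alpha> * g x X Y) \<and>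
     (\<forall>a>0. \<forall>x\<in>points M. f (m a x) = a powr \<alpha> * f x) \<and>
     (\<forall>x\<in>points M. \<forall>X\<in>tangent_space M x. g x (generator M m x) X = differential M f x X)"

definition level_set :: "('a, 'e) mfd \<Rightarrow> ('a \<Rightarrow> real) \<Rightarrow> real \<Rightarrow> 'a set" where
  "level_set M f l = {x \<in> points M. f x = l}"

definition level_metric ::
  "('a, 'e::euclidean_space) mfd \<Rightarrow> ('a, 'e) tensor2 \<Rightarrow> ('a \<Rightarrow> real) \<Rightarrow> real \<Rightarrow> ('a, 'e) tensor2" where
  "level_metric M g f l = pullback (sub_mfd M (level_set M f l)) M (\<lambda>x. x) g"

text \<open>
  On \<open>\<real>\<^sub>>\<^sub>0 \<times> L\<close>, the tensor \<open>v(r) (1/(\<alpha> r) dr\<^sup>2 + (r/l) h)\<close> for a tensor \<open>h\<close> on \<open>L\<close>.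
\<close>

definition warped_metric ::
  "('a, 'e::euclidean_space) mfd \<Rightarrow> ('a, 'e) tensor2 \<Rightarrow> real \<Rightarrow> real \<Rightarrow> (real \<Rightarrow> real) \<Rightarrow>
   (real \<times> 'a, real \<times> 'e) tensor2" where
  "warped_metric L h \<alpha> l v = (\<lambda>p X Y.
     let N = prod_mfd pos_reals L; r = fst p; dr = differential N fst p in
     v r * (1 / (\<alpha> * r) * (dr X * dr Y) + r / l * pullback N L snd h p X Y))"

end

theory Submission
  imports Defs
begin

text \<open>
  Write \<open>P\<close> for the generator of the action. Homogeneity of \<open>f\<close> gives \<open>df (P) = \<alpha> f\<close>, which has no zeros.
  So every value of \<open>f\<close> is regular, and each level set \<open>M\<^sub>l\<close> is a hypersurface transverse to \<open>P\<close>.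
  Moreover \<open>g (P, -) = df\<close> says that \<open>P\<close> is orthogonal to all level sets and that \<open>g (P, P) = \<alpha> f\<close>. Hence along
  \<open>M\<^sub>l\<close> the tangent space of \<open>M\<close> is the orthogonal sum of the line of \<open>P\<close>, on which \<open>g\<close> is definite with the sign
  of \<open>\<alpha>\<close>, and the tangent space of \<open>M\<^sub>l\<close>. This makes the restriction of \<open>g\<close> nondegenerate, and
  it determines its index from the index of \<open>g\<close>.

  Each orbit meets \<open>M\<^sub>l\<close> exactly once, since \<open>f\<close> grows along it like a power of the group parameter. Flowing from
  \<open>M\<^sub>l\<close> to the level \<open>r\<close> gives the diffeomorphism \<open>\<Phi> (r, x) = m ((r / l) powr (1 / \<alpha>)) x\<close>, with \<open>f (\<Phi> (r, x)) = r\<close>.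
  It maps \<open>\<partial>\<close>/\<open>\<partial>r\<close> to \<open>P / (\<alpha> r)\<close>, of square length \<open>1 / (\<alpha> r)\<close>, and acts on \<open>M\<^sub>l\<close> by an element of the group that
  scales \<open>g\<close> by \<open>r / l\<close>; there are no mixed terms by orthogonality. Multiplication by
  \<open>v (r) = v (f (\<Phi> (r, x)))\<close> gives the asserted isometry.

  The two computations are \<open>tangent_\<Phi>\<close> and \<open>pullback_\<Phi>\<close>, and \<open>level_metric_pseudo_riemannian\<close> treats the metric on
  the level set. They rest on three bodies of theory. The first is calculus in charts, arranged so that
  \<open>tangent_map\<close> is a functor on smooth maps between manifolds, submanifolds and products; differentials of functions and
  the generator are then instances of it. The second is the regular value theorem
  \<open>submanifold_regular_level_set\<close>, deduced from the inverse function theorem. The third is the behaviour of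
  the index of a symmetric form when an orthogonal line is split off (\<open>neg_index_split_pos\<close> and \<open>neg_index_split_neg\<close>).

  The splitting of the tangent space is read off from the differential of \<open>\<Phi>\<close> at \<open>(l, x)\<close>, so that no dimension has to be
  counted: \<open>\<Phi>\<close> is known to be a diffeomorphism as soon as \<open>M\<^sub>l\<close> is known to be a submanifold.
\<close>

section \<open>Calculus of \<open>C\<^sup>k\<close> maps\<close>

lemma Ck_on_cong:
  assumes "open U" "\<And>y. y \<in> U \<Longrightarrow> h y = h' y"
  shows "Ck_on k U h = Ck_on k U h'"
  using assms(2)
proof (induction k arbitrary: h h')
  case 0
  then show ?case by (simp cong: continuous_on_cong)
next
  case (Suc k)
  have eq: "frechet_derivative h (at y) = frechet_derivative h' (at y)" "h differentiable (at y) \<longleftrightarrow> h' differentiable (at y)"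
    if "y \<in> U" for y
  proof -
    have *: "(h has_derivative D) (at y) \<longleftrightarrow> (h' has_derivative D) (at y)" for D
      using has_derivative_transform_within_open[OF _ \<open>open U\<close> that, of h D UNIV h']
        has_derivative_transform_within_open[OF _ \<open>open U\<close> that, of h' D UNIV h] Suc.prems by auto
    show "frechet_derivative h (at y) = frechet_derivative h' (at y)"
      unfolding frechet_derivative_def * ..
    show "h differentiable (at y) \<longleftrightarrow> h' differentiable (at y)"
      unfolding differentiable_def * ..
  qed
  have "Ck_on k U (\<lambda>y. frechet_derivative h (at y) w) = Ck_on k U (\<lambda>y. frechet_derivative h' (at y) w)" for w
    by (rule Suc.IH) (simp add: eq)
  then show ?case using eq by simp
qed

lemma Ck_on_SucI:
  assumes "\<And>y. y \<in> U \<Longrightarrow> (h has_derivative D y) (at y)"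
    and "\<And>w. Ck_on k U (\<lambda>y. D y w)" and "open U"
  shows "Ck_on (Suc k) U h"
proof -
  have eq: "frechet_derivative h (at y) w = D y w" if "y \<in> U" for y w
    using frechet_derivative_at[OF assms(1)[OF that]] by metis
  have "Ck_on k U (\<lambda>y. frechet_derivative h (at y) w)" for w
    using assms(2)[of w] by (subst Ck_on_cong[OF \<open>open U\<close>, where h' = "\<lambda>y. D y w"]) (auto simp: eq)
  then show ?thesis
    using assms(1) by (auto simp: differentiable_def)
qed

lemma Ck_on_Suc_has_derivative:
  assumes "Ck_on (Suc k) U h" "y \<in> U"
  shows "(h has_derivative frechet_derivative h (at y)) (at y)"
  using assms by (simp add: frechet_derivative_works)

lemma Ck_on_subset: "Ck_on k U h \<Longrightarrow> V \<subseteq> U \<Longrightarrow> Ck_on k V h"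
proof (induction k arbitrary: h)
  case 0
  then show ?case using continuous_on_subset by auto
next
  case (Suc k)
  then show ?case by auto
qed

lemma Ck_on_SucD: "Ck_on (Suc k) U h \<Longrightarrow> Ck_on k U h"
proof (induction k arbitrary: h)
  case 0
  then show ?case
    by (auto intro!: continuous_at_imp_continuous_on differentiable_imp_continuous_within)
next
  case (Suc k)
  then have "Ck_on k U (\<lambda>y. frechet_derivative h (at y) w)" for w
    by (metis Ck_on.simps(2))
  with Suc.prems show ?case by simp
qed

lemma Ck_on_const: "Ck_on k U (\<lambda>_. c)"
  by (induction k arbitrary: c) auto

lemma Ck_on_bounded_linear:
  assumes "bounded_linear h"
  shows "Ck_on k U h"
proof (cases k)
  case 0
  then show ?thesis using assms linear_continuous_on by auto
next
  case (Suc j)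
  have d: "(h has_derivative h) (at y)" for y
    using assms bounded_linear_imp_has_derivative by blast
  then have "frechet_derivative h (at y) = h" for y
    using frechet_derivative_at by metis
  then show ?thesis using Suc d by (auto simp: Ck_on_const differentiable_def)
qed

lemma Ck_on_add:
  assumes "open U" "Ck_on k U f" "Ck_on k U g"
  shows "Ck_on k U (\<lambda>y. f y + g y)"
  using assms(2,3)
proof (induction k arbitrary: f g)
  case 0
  then show ?case by (auto intro: continuous_intros)
next
  case (Suc k)
  show ?case
  proof (rule Ck_on_SucI[OF _ _ \<open>open U\<close>])
    show "((\<lambda>y. f y + g y) has_derivative
        (\<lambda>w. frechet_derivative f (at y) w + frechet_derivative g (at y) w)) (at y)" if "y \<in> U" for y
      using Suc.prems that by (intro has_derivative_add Ck_on_Suc_has_derivative)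
    show "Ck_on k U (\<lambda>y. frechet_derivative f (at y) w + frechet_derivative g (at y) w)" for w
      using Suc by auto
  qed
qed

lemma Ck_on_sum:
  assumes "open U" "\<And>i. i \<in> I \<Longrightarrow> Ck_on k U (f i)"
  shows "Ck_on k U (\<lambda>y. \<Sum>i\<in>I. f i y)"
  using assms(2)
  by (induction I rule: infinite_finite_induct) (auto intro: Ck_on_const Ck_on_add[OF \<open>open U\<close>])

lemma Ck_on_scaleR:
  fixes a :: "'e::euclidean_space \<Rightarrow> real"
  assumes "open U" "Ck_on k U a" "Ck_on k U f"
  shows "Ck_on k U (\<lambda>y. a y *\<^sub>R f y)"
  using assms(2,3)
proof (induction k arbitrary: a f)
  case 0
  then show ?case by (auto intro: continuous_intros)
next
  case (Suc k)
  show ?case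
  proof (rule Ck_on_SucI[OF _ _ \<open>open U\<close>])
    show "((\<lambda>y. a y *\<^sub>R f y) has_derivative
        (\<lambda>w. a y *\<^sub>R frechet_derivative f (at y) w + frechet_derivative a (at y) w *\<^sub>R f y)) (at y)"
      if "y \<in> U" for y
      using Suc.prems that by (intro has_derivative_scaleR Ck_on_Suc_has_derivative)
    have "Ck_on k U a" "Ck_on k U f"
      using Suc.prems Ck_on_SucD by blast+
    then show "Ck_on k U (\<lambda>y. a y *\<^sub>R frechet_derivative f (at y) w + frechet_derivative a (at y) w *\<^sub>R f y)" for w
      using Suc.prems by (intro Ck_on_add[OF \<open>open U\<close>] Suc.IH) auto
  qed
qed

text \<open>
  The derivative of a composite is \<open>D f (g y) (D g y w)\<close>, in which the direction varies with \<open>y\<close>.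
  Expanding this direction in a basis turns it into a sum of products of \<open>C\<^sup>k\<close> functions with
  composites \<open>D f (g y) b\<close>, to which the induction hypothesis applies.
\<close>

lemma Ck_on_compose:
  fixes g :: "'e::euclidean_space \<Rightarrow> 'f::euclidean_space" and f :: "'f \<Rightarrow> 'g::euclidean_space"
  assumes "open U" "Ck_on k V f" "Ck_on k U g" "\<And>y. y \<in> U \<Longrightarrow> g y \<in> V"
  shows "Ck_on k U (\<lambda>y. f (g y))"
  using assms(2,3)
proof (induction k arbitrary: f)
  case 0
  then show ?case using assms(4) by (auto intro!: continuous_on_compose2[of V f U g])
next
  case (Suc k)
  have Df: "(f has_derivative frechet_derivative f (at (g y))) (at (g y))" if "y \<in> U" for y
    using Suc.prems(1) assms(4)[OF that] by (rule Ck_on_Suc_has_derivative)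
  have Dg: "(g has_derivative frechet_derivative g (at y)) (at y)" if "y \<in> U" for y
    using Suc.prems(2) that by (rule Ck_on_Suc_has_derivative)
  have expand: "frechet_derivative f (at (g y)) u =
      (\<Sum>b\<in>Basis. (u \<bullet> b) *\<^sub>R frechet_derivative f (at (g y)) b)" if "y \<in> U" for y u
  proof -
    have "linear (frechet_derivative f (at (g y)))"
      using Df[OF that] by (simp add: has_derivative_linear)
    then have "frechet_derivative f (at (g y)) (\<Sum>b\<in>Basis. (u \<bullet> b) *\<^sub>R b) =
      (\<Sum>b\<in>Basis. (u \<bullet> b) *\<^sub>R frechet_derivative f (at (g y)) b)"
      by (simp add: linear_sum linear_cmul)
    then show ?thesis by (simp add: euclidean_representation)
  qed
  show ?case
  proof (rule Ck_on_SucI[OF _ _ \<open>open U\<close>])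
    show "((\<lambda>y. f (g y)) has_derivative
        (\<lambda>w. \<Sum>b\<in>Basis. (frechet_derivative g (at y) w \<bullet> b) *\<^sub>R frechet_derivative f (at (g y)) b)) (at y)"
      if "y \<in> U" for y
      by (rule has_derivative_eq_rhs[OF has_derivative_compose[OF Dg[OF that] Df[OF that]]])
        (rule ext, rule expand[OF that])
    have g: "Ck_on k U g" using Suc.prems(2) by (rule Ck_on_SucD)
    have "Ck_on k U (\<lambda>y. frechet_derivative f (at (g y)) b)" for b
      using Suc.IH[of "\<lambda>z. frechet_derivative f (at z) b"] Suc.prems(1) g by simp
    moreover have "Ck_on k U (\<lambda>y. frechet_derivative g (at y) w \<bullet> b)" for w b
    proof -
      \<comment> \<open>A fixed linear map commutes with differentiation, so here the induction is on the inner function alone.\<close>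
      have lin: "Ck_on j U (\<lambda>y. u y \<bullet> b)" if "Ck_on j U u" for j and u :: "'e \<Rightarrow> 'f"
        using that
      proof (induction j arbitrary: u)
        case 0
        then show ?case by (auto intro: continuous_intros)
      next
        case (Suc j)
        show ?case
        proof (rule Ck_on_SucI[OF _ _ \<open>open U\<close>])
          show "((\<lambda>y. u y \<bullet> b) has_derivative (\<lambda>w. frechet_derivative u (at y) w \<bullet> b)) (at y)"
            if "y \<in> U" for y
            using Ck_on_Suc_has_derivative[OF Suc.prems that] by (auto intro!: derivative_eq_intros)
          show "Ck_on j U (\<lambda>y. frechet_derivative u (at y) w \<bullet> b)" for w
            using Suc.prems by (intro Suc.IH) auto
        qed
      qed
      show ?thesis using Suc.prems(2) by (intro lin) auto
    qed
    ultimately show "Ck_on k U (\<lambda>y. \<Sum>b\<in>Basis. (frechet_derivative g (at y) w \<bullet> b) *\<^sub>R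
        frechet_derivative f (at (g y)) b)" for w
      by (intro Ck_on_sum Ck_on_scaleR \<open>open U\<close>)
  qed
qed

lemma Ck_on_Pair:
  fixes f :: "'e::euclidean_space \<Rightarrow> 'f::euclidean_space" and g :: "'e \<Rightarrow> 'g::euclidean_space"
  assumes "open U" "Ck_on k U f" "Ck_on k U g"
  shows "Ck_on k U (\<lambda>y. (f y, g y))"
proof -
  have "Ck_on k U (\<lambda>y. (f y, 0::'g))"
    by (rule Ck_on_compose[OF \<open>open U\<close> Ck_on_bounded_linear[of "\<lambda>u. (u, 0)"] assms(2)])
      (auto intro!: bounded_linear_intros)
  moreover have "Ck_on k U (\<lambda>y. (0::'f, g y))"
    by (rule Ck_on_compose[OF \<open>open U\<close> Ck_on_bounded_linear[of "\<lambda>u. (0, u)"] assms(3)])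
      (auto intro!: bounded_linear_intros)
  ultimately have "Ck_on k U (\<lambda>y. (f y, 0) + (0, g y))"
    by (rule Ck_on_add[OF \<open>open U\<close>])
  then show ?thesis by simp
qed

text \<open>
  Differentiation changes both the factor and the exponent, so the induction is over all of them.
\<close>

lemma Ck_on_powr: "Ck_on k {0<..} (\<lambda>x::real. c * x powr b)"
proof (induction k arbitrary: b c)
  case 0
  then show ?case by (auto intro!: continuous_intros)
next
  case (Suc k)
  show ?case
  proof (rule Ck_on_SucI)
    show "((\<lambda>x. c * x powr b) has_derivative (\<lambda>w. (w * c * b) * x powr (b - 1))) (at x)"
      if "x \<in> {0<..}" for x :: real
    proof -
      have "((\<lambda>x. c * x powr b) has_real_derivative c * (b * x powr (b - 1))) (at x)"
        using that by (intro DERIV_cmult has_real_derivative_powr) auto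
      then show ?thesis
        by (rule has_derivative_eq_rhs[OF has_field_derivative_imp_has_derivative]) (auto simp: mult_ac)
    qed
    show "Ck_on k {0<..} (\<lambda>x::real. w * c * b * x powr (b - 1))" for w
      by (rule Suc.IH)
  qed auto
qed

section \<open>Smooth maps on relatively open subsets of a subspace\<close>

lemma smooth_onE:
  assumes "smooth_on S h" "y \<in> S"
  obtains U h' where "open U" "y \<in> U" "\<And>k. Ck_on k U h'" "\<And>z. z \<in> S \<Longrightarrow> z \<in> U \<Longrightarrow> h' z = h z"
proof -
  obtain U h' where "open U \<and> y \<in> U \<and> (\<forall>k. Ck_on k U h') \<and> (\<forall>z\<in>S \<inter> U. h' z = h z)"
    using assms unfolding smooth_on_def by meson
  then show ?thesis by (intro that[of U h']) auto
qed

lemma smooth_onI_local: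
  assumes "\<And>y. y \<in> S \<Longrightarrow> \<exists>U. open U \<and> y \<in> U \<and> smooth_on (S \<inter> U) h"
  shows "smooth_on S h"
  unfolding smooth_on_def
proof
  fix y assume y: "y \<in> S"
  then obtain U where U: "open U" "y \<in> U" "smooth_on (S \<inter> U) h" using assms by blast
  then obtain U' h' where "open U'" "y \<in> U'" "\<And>k. Ck_on k U' h'"
      "\<And>z. z \<in> S \<inter> U \<Longrightarrow> z \<in> U' \<Longrightarrow> h' z = h z"
    using smooth_onE[of "S \<inter> U" h y] y by blast
  with U show "\<exists>U h'. open U \<and> y \<in> U \<and> (\<forall>k. Ck_on k U h') \<and> (\<forall>z\<in>S \<inter> U. h' z = h z)"
    by (intro exI[of _ "U \<inter> U'"] exI[of _ h']) (auto intro: Ck_on_subset)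
qed

lemma smooth_on_openI: "open U \<Longrightarrow> (\<And>k. Ck_on k U h) \<Longrightarrow> smooth_on U h"
  unfolding smooth_on_def by blast

lemma smooth_on_subset_eq:
  assumes "smooth_on S h" "T \<subseteq> S" "\<And>y. y \<in> T \<Longrightarrow> h y = h' y"
  shows "smooth_on T h'"
  unfolding smooth_on_def
proof
  fix y assume "y \<in> T"
  then obtain U k where U: "open U" "y \<in> U" "\<And>j. Ck_on j U k" "\<And>z. z \<in> S \<Longrightarrow> z \<in> U \<Longrightarrow> k z = h z"
    using smooth_onE[OF assms(1), of y] assms(2) by blast
  then show "\<exists>U k. open U \<and> y \<in> U \<and> (\<forall>j. Ck_on j U k) \<and> (\<forall>z\<in>T \<inter> U. k z = h' z)"
    using assms(2,3) by (intro exI[of _ U] exI[of _ k]) auto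
qed

lemmas smooth_on_subset = smooth_on_subset_eq[OF _ _ refl]
  and smooth_on_eq = smooth_on_subset_eq[OF _ subset_refl]

lemma smooth_on_const: "smooth_on S (\<lambda>_. c)"
  by (rule smooth_on_subset[OF smooth_on_openI[of UNIV]]) (auto simp: Ck_on_const)

lemma smooth_on_bounded_linear: "bounded_linear h \<Longrightarrow> smooth_on S h"
  by (rule smooth_on_subset[OF smooth_on_openI[of UNIV]]) (auto simp: Ck_on_bounded_linear)

lemma smooth_on_ident: "smooth_on S (\<lambda>y. y)"
  by (rule smooth_on_bounded_linear) (rule bounded_linear_ident)

lemma smooth_on_powr: "smooth_on {0<..} (\<lambda>x::real. c * x powr b)"
  by (rule smooth_on_openI) (auto simp: Ck_on_powr)

lemma smooth_on_compose:
  assumes h2: "smooth_on T h2" and h: "smooth_on S h" and sub: "h ` S \<subseteq> T"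
  shows "smooth_on S (h2 \<circ> h)"
  unfolding smooth_on_def
proof
  fix y assume y: "y \<in> S"
  obtain U h' where U: "open U" "y \<in> U" "\<And>k. Ck_on k U h'" "\<And>z. z \<in> S \<Longrightarrow> z \<in> U \<Longrightarrow> h' z = h z"
    using smooth_onE[OF h y] by blast
  obtain V h2' where V: "open V" "h y \<in> V" "\<And>k. Ck_on k V h2'" "\<And>z. z \<in> T \<Longrightarrow> z \<in> V \<Longrightarrow> h2' z = h2 z"
    using smooth_onE[OF h2, of "h y"] sub y by blast
  define W where "W = U \<inter> h' -` V"
  have "continuous_on U h'" using U(3)[of 0] by simp
  then have W: "open W" unfolding W_def using U(1) V(1)
    by (metis continuous_open_preimage)
  have "Ck_on k W (\<lambda>z. h2' (h' z))" for k
    by (rule Ck_on_compose[OF W V(3)]) (auto simp: W_def intro: Ck_on_subset[OF U(3)])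
  then show "\<exists>U h'. open U \<and> y \<in> U \<and> (\<forall>k. Ck_on k U h') \<and> (\<forall>z\<in>S \<inter> U. h' z = (h2 \<circ> h) z)"
    using W U V sub y
    by (intro exI[of _ W] exI[of _ "\<lambda>z. h2' (h' z)"]) (auto simp: W_def image_subset_iff)
qed

lemma smooth_on_binop:
  fixes f :: "'e::euclidean_space \<Rightarrow> 'f::euclidean_space" and g :: "'e \<Rightarrow> 'g::euclidean_space"
    and op :: "'f \<Rightarrow> 'g \<Rightarrow> 'h::euclidean_space"
  assumes "smooth_on S f" "smooth_on S g"
    and op: "\<And>k (U::'e set) f g. open U \<Longrightarrow> Ck_on k U f \<Longrightarrow> Ck_on k U g \<Longrightarrow> Ck_on k U (\<lambda>y. op (f y) (g y))"
  shows "smooth_on S (\<lambda>y. op (f y) (g y))"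
  unfolding smooth_on_def
proof
  fix y assume y: "y \<in> S"
  obtain U f' where U: "open U" "y \<in> U" "\<And>k. Ck_on k U f'" "\<And>z. z \<in> S \<Longrightarrow> z \<in> U \<Longrightarrow> f' z = f z"
    using smooth_onE[OF assms(1) y] by blast
  obtain V g' where V: "open V" "y \<in> V" "\<And>k. Ck_on k V g'" "\<And>z. z \<in> S \<Longrightarrow> z \<in> V \<Longrightarrow> g' z = g z"
    using smooth_onE[OF assms(2) y] by blast
  have "Ck_on k (U \<inter> V) (\<lambda>z. op (f' z) (g' z))" for k
    by (intro op Ck_on_subset[OF U(3)] Ck_on_subset[OF V(3)]) (use U V in auto)
  then show "\<exists>U h'. open U \<and> y \<in> U \<and> (\<forall>k. Ck_on k U h') \<and> (\<forall>z\<in>S \<inter> U. h' z = op (f z) (g z))"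
    using U V by (intro exI[of _ "U \<inter> V"] exI[of _ "\<lambda>z. op (f' z) (g' z)"]) auto
qed

lemma smooth_on_Pair: "smooth_on S f \<Longrightarrow> smooth_on S g \<Longrightarrow> smooth_on S (\<lambda>y. (f y, g y))"
  by (rule smooth_on_binop) (auto intro: Ck_on_Pair)

lemma smooth_on_scaleR:
  fixes a :: "'e::euclidean_space \<Rightarrow> real"
  shows "smooth_on S a \<Longrightarrow> smooth_on S f \<Longrightarrow> smooth_on S (\<lambda>y. a y *\<^sub>R f y)"
  by (rule smooth_on_binop) (auto intro: Ck_on_scaleR)

lemma smooth_on_mult:
  fixes a :: "'e::euclidean_space \<Rightarrow> real"
  shows "smooth_on S a \<Longrightarrow> smooth_on S f \<Longrightarrow> smooth_on S (\<lambda>y. a y * f y)"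
  using smooth_on_scaleR[of S a f] by simp

lemma smooth_on_add: "smooth_on S f \<Longrightarrow> smooth_on S g \<Longrightarrow> smooth_on S (\<lambda>y. f y + g y)"
  by (rule smooth_on_binop) (auto intro: Ck_on_add)

lemma smooth_on_sum: "(\<And>i. i \<in> I \<Longrightarrow> smooth_on S (f i)) \<Longrightarrow> smooth_on S (\<lambda>y. \<Sum>i\<in>I. f i y)"
  by (induction I rule: infinite_finite_induct) (auto intro: smooth_on_const smooth_on_add)

lemma has_derivative_within_eq_on_open:
  assumes "(h' has_derivative D) (at y within S)" "open U" "y \<in> U" "y \<in> S"
    and "\<And>z. z \<in> S \<Longrightarrow> z \<in> U \<Longrightarrow> h' z = h z"
  shows "(h has_derivative D) (at y within S)"
proof -
  obtain d where "d > 0" "ball y d \<subseteq> U"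
    using assms(2,3) by (auto simp: open_contains_ball)
  then show ?thesis
    by (intro has_derivative_transform_within[OF assms(1) _ assms(4)] assms(5)) (auto simp: dist_commute)
qed

text \<open>
  The derivative of any local extension is a derivative within \<open>S\<close>. If \<open>S\<close> is relatively open in a
  subspace \<open>V\<close>, then a derivative within \<open>S\<close> determines all directional derivatives along \<open>V\<close> (see
  \<open>dir_deriv_eq\<close>), although its values off \<open>V\<close> depend on the extension. Passing through derivatives
  within \<open>S\<close> therefore gives the rules of calculus for \<open>dir_deriv\<close> without reference to extensions.
\<close>

lemma smooth_on_has_derivative:
  assumes "smooth_on S h" "y \<in> S"
  obtains D where "(h has_derivative D) (at y within S)"
proof -
  obtain U h' where U: "open U" "y \<in> U" "\<And>k. Ck_on k U h'" "\<And>z. z \<in> S \<Longrightarrow> z \<in> U \<Longrightarrow> h' z = h z"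
    using smooth_onE[OF assms] by blast
  have "(h' has_derivative frechet_derivative h' (at y)) (at y within S)"
    using Ck_on_Suc_has_derivative[OF U(3) U(2)] by (rule has_derivative_at_withinI)
  then have "(h has_derivative frechet_derivative h' (at y)) (at y within S)"
    by (rule has_derivative_within_eq_on_open) (use U assms(2) in auto)
  then show ?thesis ..
qed

lemma eventually_line_in_openin:
  fixes y :: "'e::real_normed_vector"
  assumes "subspace V" "openin (top_of_set V) S" "y \<in> S" "w \<in> V"
  shows "\<forall>\<^sub>F t in at (0::real). y + t *\<^sub>R w \<in> S"
proof -
  obtain U where U: "open U" "S = V \<inter> U" using assms(2) by (auto simp: openin_open)
  have "((\<lambda>t. y + t *\<^sub>R w) \<longlongrightarrow> y) (at (0::real))"
    by (auto intro!: tendsto_eq_intros)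
  then have "\<forall>\<^sub>F t in at (0::real). y + t *\<^sub>R w \<in> U"
    using U assms(3) by (intro topological_tendstoD) auto
  moreover have "y + t *\<^sub>R w \<in> V" for t
    using assms U by (auto intro: subspace_add subspace_scale)
  ultimately show ?thesis using U(2) by (auto elim: eventually_mono)
qed

lemma has_vector_derivative_along_line:
  assumes V: "subspace V" "openin (top_of_set V) S" "y \<in> S" "w \<in> V"
    and D: "(h has_derivative D) (at y within S)"
  shows "((\<lambda>t. h (y + t *\<^sub>R w)) has_vector_derivative D w) (at 0)"
proof -
  obtain d where d: "d > 0" "\<And>t. t \<noteq> 0 \<Longrightarrow> dist t 0 < d \<Longrightarrow> y + t *\<^sub>R w \<in> S"
    using eventually_line_in_openin[OF V] by (auto simp: eventually_at)
  then have d': "y + t *\<^sub>R w \<in> S" if "t \<in> ball 0 d" for t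
    using V(3) that by (cases "t = 0") (auto simp: dist_commute)
  define l where "l = (\<lambda>t::real. y + t *\<^sub>R w)"
  have l: "(l has_derivative (\<lambda>t. t *\<^sub>R w)) (at 0 within ball 0 d)"
    unfolding l_def by (auto intro!: derivative_eq_intros)
  have D0: "(h has_derivative D) (at (l 0) within l ` ball 0 d)"
    using has_derivative_subset[OF D, of "l ` ball 0 d"] d'
    by (simp add: l_def image_subset_iff)
  have "((\<lambda>t. h (l t)) has_derivative (\<lambda>t. D (t *\<^sub>R w))) (at 0 within ball 0 d)"
    using has_derivative_in_compose[OF l D0] by simp
  then have "((\<lambda>t. h (l t)) has_derivative (\<lambda>t. t *\<^sub>R D w)) (at 0 within ball 0 d)"
    using D by (simp add: has_derivative_linear linear_cmul)
  then show ?thesis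
    using d(1) by (simp add: has_vector_derivative_def l_def at_within_open[of 0 "ball 0 d"])
qed

lemma dir_deriv_eq:
  assumes "subspace V" "openin (top_of_set V) S" "y \<in> S" "w \<in> V"
    and "(h has_derivative D) (at y within S)"
  shows "dir_deriv h y w = D w"
  unfolding dir_deriv_def using has_vector_derivative_along_line[OF assms] by (rule vector_derivative_at)

lemma dir_deriv_cong:
  assumes "subspace V" "openin (top_of_set V) S" "y \<in> S" "w \<in> V" "\<And>z. z \<in> S \<Longrightarrow> h z = h' z"
  shows "dir_deriv h y w = dir_deriv h' y w"
  unfolding dir_deriv_def
proof (rule vector_derivative_cong_eq)
  have "\<forall>\<^sub>F t in nhds (0::real). y + t *\<^sub>R w \<in> S"
    using eventually_line_in_openin[OF assms(1-4)] assms(3) by (simp add: eventually_nhds_conv_at)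
  then show "\<forall>\<^sub>F t in nhds 0. t \<in> UNIV \<longrightarrow> h (y + t *\<^sub>R w) = h' (y + t *\<^sub>R w)"
    by (auto elim!: eventually_mono simp: assms(5))
qed (use assms in auto)

lemma dir_deriv_linear:
  assumes "subspace V" "openin (top_of_set V) S" "y \<in> S" "smooth_on S h"
  obtains D where "linear D" "\<And>w. w \<in> V \<Longrightarrow> dir_deriv h y w = D w"
proof -
  obtain D where D: "(h has_derivative D) (at y within S)"
    using smooth_on_has_derivative assms by blast
  with that[of D] dir_deriv_eq[OF assms(1-3) _ D] show ?thesis
    by (auto simp: has_derivative_linear)
qed

text \<open>
  For \<open>u\<close> orthogonal to \<open>W\<close>, the function \<open>h \<bullet> u\<close> vanishes on \<open>S\<close>, and hence so does its derivative.
\<close>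

lemma dir_deriv_in_subspace:
  fixes h :: "'e::euclidean_space \<Rightarrow> 'f::euclidean_space"
  assumes V: "subspace V" "openin (top_of_set V) S" "y \<in> S" "w \<in> V"
    and h: "smooth_on S h" "h ` S \<subseteq> W" "subspace W"
  shows "dir_deriv h y w \<in> W"
proof -
  obtain D where D: "(h has_derivative D) (at y within S)"
    using smooth_on_has_derivative assms by blast
  have "((\<lambda>t. h (y + t *\<^sub>R w)) has_vector_derivative D w) (at 0)"
    by (rule has_vector_derivative_along_line[OF V D])
  then have line: "((\<lambda>t. h (y + t *\<^sub>R w) \<bullet> u) has_vector_derivative D w \<bullet> u) (at 0)" for u
    by (rule bounded_linear.has_vector_derivative[OF bounded_linear_inner_left])
  have "D w \<bullet> u = 0" if u: "\<And>z. z \<in> W \<Longrightarrow> z \<bullet> u = 0" for u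
  proof -
    have "\<forall>\<^sub>F t in at 0. h (y + t *\<^sub>R w) \<bullet> u = 0"
      using eventually_line_in_openin[OF V] by eventually_elim (use h u in auto)
    moreover have "h y \<bullet> u = 0" using h u V(3) by auto
    ultimately have "\<forall>\<^sub>F t in nhds 0. h (y + t *\<^sub>R w) \<bullet> u = 0"
      by (simp add: eventually_nhds_conv_at)
    then have "vector_derivative (\<lambda>t. h (y + t *\<^sub>R w) \<bullet> u) (at 0) = vector_derivative (\<lambda>t. 0) (at 0)"
      by (intro vector_derivative_cong_eq) auto
    then show ?thesis using vector_derivative_at[OF line] by simp
  qed
  then have "D w \<in> orthogonal_comp (orthogonal_comp W)"
    by (auto simp: orthogonal_comp_def orthogonal_def inner_commute)
  then show ?thesis using dir_deriv_eq[OF V D] orthogonal_comp_self[OF h(3)] by simp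
qed

lemma dir_deriv_compose:
  assumes V: "subspace V" "openin (top_of_set V) S" "y \<in> S" "w \<in> V"
    and W: "subspace W" "openin (top_of_set W) T" "h ` S \<subseteq> T"
    and "smooth_on S h" "smooth_on T h2"
  shows "dir_deriv (h2 \<circ> h) y w = dir_deriv h2 (h y) (dir_deriv h y w)"
proof -
  obtain D where D: "(h has_derivative D) (at y within S)"
    using smooth_on_has_derivative assms by blast
  obtain E where E: "(h2 has_derivative E) (at (h y) within T)"
    using smooth_on_has_derivative[of T h2 "h y"] assms by blast
  have "h ` S \<subseteq> W" using W(3) openin_imp_subset[OF W(2)] by (rule subset_trans)
  then have hW: "dir_deriv h y w \<in> W"
    by (rule dir_deriv_in_subspace[OF V assms(8) _ W(1)])
  have "(h2 \<circ> h has_derivative (\<lambda>w. E (D w))) (at y within S)"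
    unfolding comp_def using has_derivative_in_compose[OF D has_derivative_subset[OF E W(3)]] .
  then have "dir_deriv (h2 \<circ> h) y w = E (D w)" by (rule dir_deriv_eq[OF V])
  also have "D w = dir_deriv h y w" using dir_deriv_eq[OF V D] by simp
  also have "E (dir_deriv h y w) = dir_deriv h2 (h y) (dir_deriv h y w)"
    using W(3) V(3) by (intro dir_deriv_eq[OF W(1,2) _ hW E, symmetric]) auto
  finally show ?thesis .
qed

lemma smooth_on_dir_deriv:
  assumes "subspace V" "openin (top_of_set V) S" "w \<in> V" "smooth_on S h"
  shows "smooth_on S (\<lambda>y. dir_deriv h y w)"
  unfolding smooth_on_def
proof
  fix y assume y: "y \<in> S"
  obtain U h' where U: "open U" "y \<in> U" "\<And>k. Ck_on k U h'" "\<And>z. z \<in> S \<Longrightarrow> z \<in> U \<Longrightarrow> h' z = h z"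
    using smooth_onE[OF assms(4) y] by blast
  have "Ck_on k U (\<lambda>z. frechet_derivative h' (at z) w)" for k
    using U(3)[of "Suc k"] by simp
  moreover have "frechet_derivative h' (at z) w = dir_deriv h z w" if "z \<in> S \<inter> U" for z
  proof -
    have "(h' has_derivative frechet_derivative h' (at z)) (at z within S)"
      using Ck_on_Suc_has_derivative[OF U(3), of z] that by (auto intro: has_derivative_at_withinI)
    then have "(h has_derivative frechet_derivative h' (at z)) (at z within S)"
      by (rule has_derivative_within_eq_on_open) (use U that in auto)
    then show ?thesis using dir_deriv_eq[OF assms(1,2) _ assms(3)] that by (metis IntD1)
  qed
  ultimately show "\<exists>U h'. open U \<and> y \<in> U \<and> (\<forall>k. Ck_on k U h') \<and> (\<forall>z\<in>S \<inter> U. h' z = dir_deriv h z w)"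
    using U(1,2)
    by (intro exI[of _ U] exI[of _ "\<lambda>z. frechet_derivative h' (at z) w"]) auto
qed

text \<open>
  From any point of \<open>S\<close>, a short step in each direction of \<open>V\<close> stays in \<open>S\<close>. So the model space of a chart is
  the subspace in which its image is open.
\<close>

lemma span_openin_subspace:
  fixes S :: "'e::real_normed_vector set"
  assumes "subspace V" "openin (top_of_set V) S" "S \<noteq> {}"
  shows "span S = V"
proof
  show "span S \<subseteq> V" by (rule span_minimal[OF openin_imp_subset[OF assms(2)] assms(1)])
  show "V \<subseteq> span S"
  proof
    fix w assume w: "w \<in> V"
    obtain y where y: "y \<in> S" using assms by blast
    have "\<forall>\<^sub>F t in at (0::real). y + t *\<^sub>R w \<in> S"
      by (rule eventually_line_in_openin) (use assms y w in auto)
    then have "\<forall>\<^sub>F t in at (0::real). y + t *\<^sub>R w \<in> S \<and> t \<noteq> 0"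
      by (simp add: eventually_at_filter eventually_conj_iff)
    then have "\<exists>t. y + t *\<^sub>R w \<in> S \<and> t \<noteq> (0::real)"
      by (rule eventually_happens'[rotated]) simp
    then obtain t where t: "y + t *\<^sub>R w \<in> S" "t \<noteq> (0::real)" by (elim exE conjE)
    then have "inverse t *\<^sub>R ((y + t *\<^sub>R w) - y) \<in> span S"
      by (intro span_scale span_diff span_base y)
    then show "w \<in> span S" using t(2) by simp
  qed
qed

section \<open>Maps in charts\<close>

text \<open>
  The part of \<open>smooth_manifold\<close> on which calculus depends. For a submanifold it is available before the
  dimensions of the slice charts are known to agree, and it serves to prove that they do.
\<close>

definition smooth_atlas :: "('a, 'e::euclidean_space) mfd \<Rightarrow> bool" where
  "smooth_atlas M \<longleftrightarrow>
     (\<forall>c\<in>atlas M. is_chart (topo M) c) \<and> (\<forall>c\<in>atlas M. \<forall>d\<in>atlas M. compatible c d) \<and>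
     (\<Union>c\<in>atlas M. fst c) = points M"

text \<open>
  The local representation of \<open>F\<close> in a chart \<open>c\<close> of the source and a chart \<open>d\<close> of the target. With \<open>F\<close> the
  identity, it is the change of coordinates from \<open>c\<close> to \<open>d\<close>, so that facts about maps cover
  transition maps as well.
\<close>

definition rep_dom :: "('a, 'e::euclidean_space) chart \<Rightarrow> ('b, 'f::euclidean_space) chart \<Rightarrow> ('a \<Rightarrow> 'b) \<Rightarrow> 'e set" where
  "rep_dom c d F = snd c ` (fst c \<inter> F -` fst d)"

definition rep :: "('a, 'e::euclidean_space) chart \<Rightarrow> ('b, 'f::euclidean_space) chart \<Rightarrow> ('a \<Rightarrow> 'b) \<Rightarrow> 'e \<Rightarrow> 'f" where
  "rep c d F = (\<lambda>y. snd d (F (chart_inv c y)))"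

text \<open>
  Smoothness in a single pair of charts, which need not belong to any given atlas: slice charts
  only lie in the maximal atlas.
\<close>

definition smooth_rep ::
  "'a topology \<Rightarrow> 'b topology \<Rightarrow> ('a, 'e::euclidean_space) chart \<Rightarrow> ('b, 'f::euclidean_space) chart \<Rightarrow> ('a \<Rightarrow> 'b) \<Rightarrow> bool" where
  "smooth_rep T T' c d F \<longleftrightarrow> is_chart T c \<and> is_chart T' d \<and> continuous_map T T' F \<and>
     smooth_on (rep_dom c d F) (rep c d F)"

definition chart_deriv ::
  "('a, 'e::euclidean_space) chart \<Rightarrow> ('b, 'f::euclidean_space) chart \<Rightarrow> ('a \<Rightarrow> 'b) \<Rightarrow> 'a \<Rightarrow> 'e \<Rightarrow> 'f" where
  "chart_deriv c d F x w = dir_deriv (rep c d F) (snd c x) w"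

lemma subspace_model_space: "subspace (model_space c)"
  by (simp add: model_space_def)

lemma chart_image_subset: "snd c ` fst c \<subseteq> model_space c"
  by (auto simp: model_space_def span_base)

lemma chart_inv_in: "y \<in> snd c ` fst c \<Longrightarrow> chart_inv c y \<in> fst c"
  unfolding chart_inv_def by (rule inv_into_into)

lemma chart_inv_right: "y \<in> snd c ` fst c \<Longrightarrow> snd c (chart_inv c y) = y"
  unfolding chart_inv_def by (rule f_inv_into_f)

lemma chart_subset: "is_chart T c \<Longrightarrow> fst c \<subseteq> topspace T"
  unfolding is_chart_def by (simp add: openin_subset)

lemma chart_inj: "is_chart T c \<Longrightarrow> inj_on (snd c) (fst c)"
  using chart_subset[of T c] by (auto simp: is_chart_def homeomorphic_map_def Int_absorb1)

lemma chart_inv_left: "is_chart T c \<Longrightarrow> x \<in> fst c \<Longrightarrow> chart_inv c (snd c x) = x"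
  unfolding chart_inv_def by (rule inv_into_f_f[OF chart_inj])

lemma chart_open_image:
  assumes c: "is_chart T c" and W: "openin T W" "W \<subseteq> fst c"
  shows "openin (top_of_set (model_space c)) (snd c ` W)"
proof -
  have "open_map (subtopology T (fst c)) (top_of_set (snd c ` fst c)) (snd c)"
    using c by (auto simp: is_chart_def homeomorphic_imp_open_map)
  moreover have "openin (subtopology T (fst c)) W"
    using W by (auto simp: openin_subtopology)
  ultimately have "openin (top_of_set (snd c ` fst c)) (snd c ` W)"
    by (simp add: open_map_def)
  then show ?thesis
    using c openin_trans by (auto simp: is_chart_def)
qed

lemma chart_continuous: "is_chart T c \<Longrightarrow> continuous_map (subtopology T (fst c)) euclidean (snd c)"
  unfolding is_chart_def by (intro continuous_map_into_fulltopology[OF homeomorphic_imp_continuous_map]) blast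

lemma chart_inv_continuous:
  assumes c: "is_chart T c"
  shows "continuous_map (top_of_set (snd c ` fst c)) T (chart_inv c)"
proof -
  obtain g where g: "homeomorphic_maps (subtopology T (fst c)) (top_of_set (snd c ` fst c)) (snd c) g"
    using c by (auto simp: is_chart_def homeomorphic_map_maps)
  have "g y = chart_inv c y" if "y \<in> snd c ` fst c" for y
  proof -
    from that obtain x where x: "x \<in> fst c" "y = snd c x" ..
    then have "g (snd c x) = x"
      using g chart_subset[OF c] by (auto simp: homeomorphic_maps_def)
    then show ?thesis using chart_inv_left[OF c x(1)] x(2) by simp
  qed
  moreover have "continuous_map (top_of_set (snd c ` fst c)) T g"
    using g continuous_map_into_fulltopology by (auto simp: homeomorphic_maps_def)
  ultimately show ?thesis
    using continuous_map_eq[of "top_of_set (snd c ` fst c)" T g "chart_inv c"] by simp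
qed

lemma is_chartI:
  assumes "U \<noteq> {}" "openin T U" "subspace V" "openin (top_of_set V) (\<phi> ` U)"
    and cont: "continuous_map (subtopology T U) euclidean \<phi>"
    and inv: "continuous_map (top_of_set (\<phi> ` U)) T \<psi>" "\<And>x. x \<in> U \<Longrightarrow> \<psi> (\<phi> x) = x"
  shows "is_chart T (U, \<phi>)" "model_space (U, \<phi>) = V"
proof -
  show V: "model_space (U, \<phi>) = V"
    unfolding model_space_def using span_openin_subspace[OF assms(3,4)] assms(1) by auto
  have top: "topspace (subtopology T U) = U"
    using openin_subset[OF assms(2)] by auto
  have "homeomorphic_maps (subtopology T U) (top_of_set (\<phi> ` U)) \<phi> \<psi>"
    unfolding homeomorphic_maps_def
    using cont inv top by (auto simp: continuous_map_in_subtopology image_subset_iff)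
  then have "homeomorphic_map (subtopology T U) (top_of_set (\<phi> ` U)) \<phi>"
    using homeomorphic_maps_map by blast
  then show "is_chart T (U, \<phi>)"
    using assms(1,2,4) V by (simp add: is_chart_def)
qed

lemma rep_dom_openin:
  assumes "is_chart T c" "is_chart T' d" "continuous_map T T' F"
  shows "openin (top_of_set (model_space c)) (rep_dom c d F)"
  unfolding rep_dom_def
proof (rule chart_open_image[OF assms(1)])
  have "openin T {x \<in> topspace T. F x \<in> fst d}"
    using assms(2,3) by (auto simp: is_chart_def continuous_map_def)
  then have "openin T (fst c \<inter> {x \<in> topspace T. F x \<in> fst d})"
    using assms(1) by (auto simp: is_chart_def)
  moreover have "fst c \<inter> {x \<in> topspace T. F x \<in> fst d} = fst c \<inter> F -` fst d"
    using chart_subset[OF assms(1)] by auto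
  ultimately show "openin T (fst c \<inter> F -` fst d)" by simp
qed auto

lemma rep_domE:
  assumes "y \<in> rep_dom c d F" "is_chart T c"
  obtains x where "x \<in> fst c" "F x \<in> fst d" "y = snd c x" "chart_inv c y = x"
  using assms chart_inv_left[OF assms(2)] unfolding rep_dom_def by blast

lemma rep_domI: "x \<in> fst c \<Longrightarrow> F x \<in> fst d \<Longrightarrow> snd c x \<in> rep_dom c d F"
  unfolding rep_dom_def by blast

lemma rep_at: "is_chart T c \<Longrightarrow> x \<in> fst c \<Longrightarrow> rep c d F (snd c x) = snd d (F x)"
  by (simp add: rep_def chart_inv_left)

lemma rep_image: "is_chart T c \<Longrightarrow> rep c d F ` rep_dom c d F \<subseteq> snd d ` fst d"
  by (auto simp: rep_at elim!: rep_domE)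

lemma smooth_repD:
  assumes "smooth_rep T T' c d F"
  shows "is_chart T c" "is_chart T' d" "continuous_map T T' F"
    "openin (top_of_set (model_space c)) (rep_dom c d F)" "smooth_on (rep_dom c d F) (rep c d F)"
    "rep c d F ` rep_dom c d F \<subseteq> snd d ` fst d" "rep c d F ` rep_dom c d F \<subseteq> model_space d"
proof -
  show c: "is_chart T c" "is_chart T' d" "continuous_map T T' F" "smooth_on (rep_dom c d F) (rep c d F)"
    using assms by (simp_all add: smooth_rep_def)
  show "openin (top_of_set (model_space c)) (rep_dom c d F)"
    using c(1-3) by (rule rep_dom_openin)
  show "rep c d F ` rep_dom c d F \<subseteq> snd d ` fst d" using c(1) by (rule rep_image)
  then show "rep c d F ` rep_dom c d F \<subseteq> model_space d" using chart_image_subset by (rule subset_trans)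
qed

lemma chart_deriv_linear:
  assumes "smooth_rep T T' c d F" "x \<in> fst c" "F x \<in> fst d"
  obtains D where "linear D" "\<And>w. w \<in> model_space c \<Longrightarrow> chart_deriv c d F x w = D w"
  using dir_deriv_linear[OF subspace_model_space smooth_repD(4)[OF assms(1)] rep_domI[where F=F, OF assms(2,3)]
      smooth_repD(5)[OF assms(1)]] unfolding chart_deriv_def by blast

lemma chart_deriv_in:
  assumes "smooth_rep T T' c d F" "x \<in> fst c" "F x \<in> fst d" "w \<in> model_space c"
  shows "chart_deriv c d F x w \<in> model_space d"
  unfolding chart_deriv_def
  by (rule dir_deriv_in_subspace[OF subspace_model_space smooth_repD(4)[OF assms(1)]
        rep_domI[where F=F, OF assms(2,3)] assms(4) smooth_repD(5)[OF assms(1)] smooth_repD(7)[OF assms(1)]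
        subspace_model_space])

text \<open>
  The chain rule, applied on the set of those coordinates at which the composite passes through the
  intermediate chart.
\<close>

lemma chart_deriv_compose:
  assumes F: "smooth_rep T T' c d F" and G: "smooth_rep T' T'' d e G"
    and x: "x \<in> fst c" "F x \<in> fst d" "G (F x) \<in> fst e" and w: "w \<in> model_space c"
  shows "chart_deriv c e (\<lambda>x. G (F x)) x w = chart_deriv d e G (F x) (chart_deriv c d F x w)"
proof -
  note F' = smooth_repD[OF F] and G' = smooth_repD[OF G]
  define S where "S = rep_dom c d F \<inter> rep_dom c e (\<lambda>x. G (F x))"
  have GF: "continuous_map T T'' (\<lambda>x. G (F x))"
    using continuous_map_compose[OF F'(3) G'(3)] by (simp add: comp_def)
  have S: "openin (top_of_set (model_space c)) S" unfolding S_def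
    by (intro openin_Int F'(4) rep_dom_openin[OF F'(1) G'(2) GF])
  have xS: "snd c x \<in> S" unfolding S_def using x by (auto intro!: rep_domI)
  have sub: "rep c d F ` S \<subseteq> rep_dom d e G"
  proof
    fix z assume "z \<in> rep c d F ` S"
    then obtain y where y: "y \<in> rep_dom c d F" "y \<in> rep_dom c e (\<lambda>x. G (F x))" "z = rep c d F y"
      by (auto simp: S_def)
    obtain p where p: "p \<in> fst c" "F p \<in> fst d" "y = snd c p" "chart_inv c y = p"
      using y(1) F'(1) by (rule rep_domE)
    have "G (F p) \<in> fst e" using y(2) F'(1) p(4) by (auto elim!: rep_domE)
    then have "snd d (F p) \<in> rep_dom d e G" using p by (intro rep_domI)
    then show "z \<in> rep_dom d e G" using p y(3) by (simp add: rep_def)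
  qed
  have smF: "smooth_on S (rep c d F)"
    using F'(5) by (rule smooth_on_subset) (auto simp: S_def)
  have "dir_deriv (rep d e G \<circ> rep c d F) (snd c x) w =
      dir_deriv (rep d e G) (rep c d F (snd c x)) (dir_deriv (rep c d F) (snd c x) w)"
    by (rule dir_deriv_compose[OF subspace_model_space S xS w subspace_model_space G'(4) sub smF G'(5)])
  moreover have "dir_deriv (rep c e (\<lambda>x. G (F x))) (snd c x) w = dir_deriv (rep d e G \<circ> rep c d F) (snd c x) w"
  proof (rule dir_deriv_cong[OF subspace_model_space S xS w])
    show "rep c e (\<lambda>x. G (F x)) z = (rep d e G \<circ> rep c d F) z" if "z \<in> S" for z
      using that F'(1) chart_inv_left[OF G'(1)] by (auto simp: S_def rep_def elim!: rep_domE)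
  qed
  ultimately show ?thesis
    unfolding chart_deriv_def by (simp only: rep_at[OF F'(1) x(1)])
qed

lemma chart_deriv_cong:
  assumes "is_chart T c" "is_chart T' d" "continuous_map T T' F" "x \<in> fst c" "F x \<in> fst d" "w \<in> model_space c"
    and "\<And>z. z \<in> topspace T \<Longrightarrow> F z = G z"
  shows "chart_deriv c d F x w = chart_deriv c d G x w"
  unfolding chart_deriv_def
proof (rule dir_deriv_cong[OF subspace_model_space rep_dom_openin[OF assms(1-3)] _ assms(6)])
  show "snd c x \<in> rep_dom c d F" using assms(4,5) by (rule rep_domI)
  show "rep c d F z = rep c d G z" if "z \<in> rep_dom c d F" for z
    using that assms(1) assms(7) chart_subset[OF assms(1)] by (auto simp: rep_def elim!: rep_domE)
qed

lemma chart_deriv_id: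
  assumes c: "is_chart T c" "x \<in> fst c" "w \<in> model_space c"
  shows "chart_deriv c c (\<lambda>x. x) x w = w"
proof -
  have S: "openin (top_of_set (model_space c)) (snd c ` fst c)" using c by (simp add: is_chart_def)
  have xS: "snd c x \<in> snd c ` fst c" using c by blast
  have "chart_deriv c c (\<lambda>x. x) x w = dir_deriv (\<lambda>y. y) (snd c x) w"
    unfolding chart_deriv_def
    by (rule dir_deriv_cong[OF subspace_model_space S xS c(3)]) (simp add: rep_def chart_inv_right)
  also have "\<dots> = w"
    by (rule dir_deriv_eq[OF subspace_model_space S xS c(3) has_derivative_ident])
  finally show ?thesis .
qed

text \<open>
  No single intermediate chart need cover the image of \<open>F\<close>. As smoothness is local, it suffices to
  have one around each point.
\<close>

lemma smooth_rep_compose: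
  fixes c :: "('a, 'e::euclidean_space) chart" and e :: "('c, 'g::euclidean_space) chart"
    and T' :: "'b topology"
  assumes c: "is_chart T c" and e: "is_chart T'' e" and F: "continuous_map T T' F" and G: "continuous_map T' T'' G"
    and mid: "\<And>x. x \<in> fst c \<Longrightarrow> G (F x) \<in> fst e \<Longrightarrow>
      \<exists>d :: ('b, 'f::euclidean_space) chart. F x \<in> fst d \<and> smooth_rep T T' c d F \<and> smooth_rep T' T'' d e G"
  shows "smooth_rep T T'' c e (\<lambda>x. G (F x))"
  unfolding smooth_rep_def
proof (intro conjI c e)
  show GF: "continuous_map T T'' (\<lambda>x. G (F x))"
    using continuous_map_compose[OF F G] by (simp add: comp_def)
  show "smooth_on (rep_dom c e (\<lambda>x. G (F x))) (rep c e (\<lambda>x. G (F x)))"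
  proof (rule smooth_onI_local)
    fix y assume "y \<in> rep_dom c e (\<lambda>x. G (F x))"
    then obtain x where x: "x \<in> fst c" "G (F x) \<in> fst e" "y = snd c x"
      using c by (rule rep_domE)
    from mid[OF x(1,2)] obtain d :: "('b, 'f) chart"
      where d: "F x \<in> fst d" "smooth_rep T T' c d F" "smooth_rep T' T'' d e G"
      by (elim exE conjE)
    note F' = smooth_repD[OF d(2)] and G' = smooth_repD[OF d(3)]
    obtain U where U: "open U" "rep_dom c d F = model_space c \<inter> U"
      using F'(4) unfolding openin_open by blast
    define S where "S = rep_dom c e (\<lambda>x. G (F x)) \<inter> U"
    have pt: "\<exists>p. p \<in> fst c \<and> F p \<in> fst d \<and> G (F p) \<in> fst e \<and> z = snd c p \<and> chart_inv c z = p \<and> z \<in> rep_dom c d F"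
      if z: "z \<in> S" for z
    proof -
      obtain p where p: "p \<in> fst c" "G (F p) \<in> fst e" "z = snd c p" "chart_inv c z = p"
        using z unfolding S_def by (elim IntE rep_domE[OF _ c])
      then have "z \<in> rep_dom c d F"
        using z chart_image_subset[of c] unfolding U S_def by auto
      moreover from this have "F p \<in> fst d" using p(4) c by (auto elim!: rep_domE)
      ultimately show ?thesis using p by blast
    qed
    have "smooth_on S (rep d e G \<circ> rep c d F)"
    proof (rule smooth_on_compose[OF G'(5)])
      show "smooth_on S (rep c d F)" using F'(5) by (rule smooth_on_subset) (use pt in blast)
      show "rep c d F ` S \<subseteq> rep_dom d e G"
        using pt by (fastforce simp: rep_def intro: rep_domI)
    qed
    then have "smooth_on S (rep c e (\<lambda>x. G (F x)))"
      by (rule smooth_on_eq) (use pt chart_inv_left[OF G'(1)] in \<open>fastforce simp: rep_def\<close>)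
    moreover have "y \<in> U" using rep_domI[of x c F d] x d U by auto
    ultimately show "\<exists>U. open U \<and> y \<in> U \<and> smooth_on (rep_dom c e (\<lambda>x. G (F x)) \<inter> U) (rep c e (\<lambda>x. G (F x)))"
      using U(1) unfolding S_def by blast
  qed
qed

lemma smooth_map_iff:
  "smooth_map M N F \<longleftrightarrow> continuous_map (topo M) (topo N) F \<and>
     (\<forall>c\<in>atlas M. \<forall>d\<in>atlas N. smooth_on (rep_dom c d F) (rep c d F))"
  by (simp add: smooth_map_def rep_dom_def rep_def comp_def)

lemma smooth_mapI:
  assumes "continuous_map (topo M) (topo N) F"
    and "\<And>c d. c \<in> atlas M \<Longrightarrow> d \<in> atlas N \<Longrightarrow> smooth_rep (topo M) (topo N) c d F"
  shows "smooth_map M N F"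
  using assms by (simp add: smooth_map_iff smooth_rep_def)

lemma smooth_map_continuous: "smooth_map M N F \<Longrightarrow> continuous_map (topo M) (topo N) F"
  by (simp add: smooth_map_iff)

lemma smooth_map_points: "smooth_map M N F \<Longrightarrow> x \<in> points M \<Longrightarrow> F x \<in> points N"
  by (auto simp: smooth_map_iff continuous_map_def Pi_iff)

lemma smooth_atlas_chart: "smooth_atlas M \<Longrightarrow> c \<in> atlas M \<Longrightarrow> is_chart (topo M) c"
  by (simp add: smooth_atlas_def)

lemma smooth_atlas_obtain:
  assumes "smooth_atlas M" "x \<in> points M"
  obtains c where "c \<in> atlas M" "x \<in> fst c" "c \<in> charts_at M x" "c \<in> maximal_atlas M" "is_chart (topo M) c"
proof -
  obtain c where "c \<in> atlas M" "x \<in> fst c" using assms unfolding smooth_atlas_def by blast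
  with assms show ?thesis
    by (intro that[of c]) (auto simp: smooth_atlas_def charts_at_def maximal_atlas_def)
qed

lemma atlas_subset_maximal: "smooth_atlas M \<Longrightarrow> c \<in> atlas M \<Longrightarrow> c \<in> maximal_atlas M"
  by (auto simp: smooth_atlas_def maximal_atlas_def)

lemma compatible_smooth_rep:
  assumes "is_chart T c" "is_chart T d"
  shows "compatible c d \<longleftrightarrow> smooth_rep T T c d (\<lambda>x. x) \<and> smooth_rep T T d c (\<lambda>x. x)"
  using assms by (simp add: compatible_def smooth_rep_def rep_dom_def rep_def comp_def Int_commute)

lemma maximal_atlas_chart: "c \<in> maximal_atlas M \<Longrightarrow> is_chart (topo M) c"
  by (simp add: maximal_atlas_def)

lemma maximal_atlas_iff:
  assumes "smooth_atlas M"
  shows "c \<in> maximal_atlas M \<longleftrightarrow> is_chart (topo M) c \<and>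
    (\<forall>d\<in>atlas M. smooth_rep (topo M) (topo M) c d (\<lambda>x. x) \<and> smooth_rep (topo M) (topo M) d c (\<lambda>x. x))"
  using assms compatible_smooth_rep[of "topo M" c]
  by (auto simp: maximal_atlas_def smooth_atlas_chart)

text \<open>
  Smoothness in the given atlases carries over to the maximal ones: around each point, factor the
  representation through charts of the given atlases.
\<close>

lemma smooth_map_rep:
  fixes M :: "('a, 'e::euclidean_space) mfd" and N :: "('b, 'f::euclidean_space) mfd"
  assumes M: "smooth_atlas M" and N: "smooth_atlas N" and F: "smooth_map M N F"
    and c: "c \<in> maximal_atlas M" and d: "d \<in> maximal_atlas N"
  shows "smooth_rep (topo M) (topo N) c d F"
proof -
  note cont = smooth_map_continuous[OF F]
  have basic: "smooth_rep (topo M) (topo N) c' d' F" if "c' \<in> atlas M" "d' \<in> atlas N" for c' d'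
    using that M N F by (auto simp: smooth_map_iff smooth_rep_def smooth_atlas_def)
  have step: "smooth_rep (topo M) (topo N) c d' F" if d': "d' \<in> atlas N" for d'
  proof (rule smooth_rep_compose[of "topo M" c "topo N" d' "topo M" "\<lambda>x. x" F])
    fix x assume "x \<in> fst c"
    then have "x \<in> points M" using chart_subset[OF maximal_atlas_chart[OF c]] by blast
    then obtain c' where "c' \<in> atlas M" "x \<in> fst c'" using smooth_atlas_obtain[OF M] by metis
    then show "\<exists>c' :: ('a, 'e) chart. x \<in> fst c' \<and> smooth_rep (topo M) (topo M) c c' (\<lambda>x. x) \<and>
        smooth_rep (topo M) (topo N) c' d' F"
      using basic d' c maximal_atlas_iff[OF M, of c] by (intro exI[of _ c']) simp
  qed (use c d' cont N in \<open>auto intro: smooth_atlas_chart maximal_atlas_chart\<close>)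
  show ?thesis
  proof (rule smooth_rep_compose[of "topo M" c "topo N" d "topo N" F "\<lambda>x. x"])
    fix x assume "x \<in> fst c" "F x \<in> fst d"
    then have "F x \<in> points N" using chart_subset[OF maximal_atlas_chart[OF d]] by blast
    then obtain d' where "d' \<in> atlas N" "F x \<in> fst d'" using smooth_atlas_obtain[OF N] by metis
    then show "\<exists>d' :: ('b, 'f) chart. F x \<in> fst d' \<and> smooth_rep (topo M) (topo N) c d' F \<and>
        smooth_rep (topo N) (topo N) d' d (\<lambda>x. x)"
      using step d maximal_atlas_iff[OF N, of d] by (intro exI[of _ d']) simp
  qed (use c d cont in \<open>auto intro: maximal_atlas_chart\<close>)
qed

lemma smooth_map_id: "smooth_atlas M \<Longrightarrow> smooth_map M M (\<lambda>x. x)"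
  by (rule smooth_mapI)
    (use maximal_atlas_iff[of M] atlas_subset_maximal[of M] in \<open>simp_all del: split_paired_All\<close>)

lemma smooth_map_compose:
  fixes N :: "('b, 'f::euclidean_space) mfd"
  assumes "smooth_atlas M" "smooth_atlas N" "smooth_atlas Q" "smooth_map M N F" "smooth_map N Q G"
  shows "smooth_map M Q (\<lambda>x. G (F x))"
proof (rule smooth_mapI)
  show "continuous_map (topo M) (topo Q) (\<lambda>x. G (F x))"
    using continuous_map_compose[OF assms(4,5)[THEN smooth_map_continuous]] by (simp add: comp_def)
  fix c e assume ce: "c \<in> atlas M" "e \<in> atlas Q"
  show "smooth_rep (topo M) (topo Q) c e (\<lambda>x. G (F x))"
  proof (rule smooth_rep_compose[OF _ _ assms(4,5)[THEN smooth_map_continuous]])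
    fix x assume "x \<in> fst c"
    then have "x \<in> points M" using ce(1) chart_subset[OF smooth_atlas_chart[OF assms(1)]] by blast
    then obtain d where "d \<in> atlas N" "F x \<in> fst d"
      using smooth_atlas_obtain[OF assms(2)] smooth_map_points[OF assms(4)] by metis
    then show "\<exists>d :: ('b, 'f) chart. F x \<in> fst d \<and> smooth_rep (topo M) (topo N) c d F \<and> smooth_rep (topo N) (topo Q) d e G"
      using ce by (intro exI[of _ d] conjI smooth_map_rep[OF assms(1,2,4)] smooth_map_rep[OF assms(2,3,5)]
          assms(1-3)[THEN atlas_subset_maximal])
  qed (use ce assms in \<open>auto intro: smooth_atlas_chart\<close>)
qed

lemma smooth_map_cong:
  assumes "smooth_atlas M" "smooth_atlas N" "smooth_map M N F" "\<And>x. x \<in> points M \<Longrightarrow> F x = G x"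
  shows "smooth_map M N G"
  unfolding smooth_map_iff
proof (intro conjI ballI)
  show "continuous_map (topo M) (topo N) G"
    using smooth_map_continuous[OF assms(3)] assms(4) by (rule continuous_map_eq)
  fix c d assume cd: "c \<in> atlas M" "d \<in> atlas N"
  note c = smooth_atlas_chart[OF assms(1) cd(1)]
  have eq: "F x = G x" if "x \<in> fst c" for x using that chart_subset[OF c] assms(4) by blast
  have "rep_dom c d F = rep_dom c d G" unfolding rep_dom_def using eq by auto
  moreover have "smooth_on (rep_dom c d F) (rep c d F)" using assms(3) cd by (simp add: smooth_map_iff)
  moreover have "rep c d F y = rep c d G y" if "y \<in> rep_dom c d F" for y
    using that c eq by (auto simp: rep_def elim!: rep_domE)
  ultimately show "smooth_on (rep_dom c d G) (rep c d G)" by (metis smooth_on_eq)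
qed

section \<open>Tangent vectors and tangent maps\<close>

lemma smooth_rep_id:
  assumes "smooth_atlas M" "c \<in> maximal_atlas M" "d \<in> maximal_atlas M"
  shows "smooth_rep (topo M) (topo M) c d (\<lambda>x. x)"
  by (rule smooth_map_rep[OF assms(1,1) smooth_map_id[OF assms(1)] assms(2,3)])

lemma charts_at_maximal: "smooth_atlas M \<Longrightarrow> c \<in> charts_at M x \<Longrightarrow> c \<in> maximal_atlas M"
  by (simp add: charts_at_def atlas_subset_maximal)

lemma charts_at_in: "c \<in> charts_at M x \<Longrightarrow> x \<in> fst c"
  by (simp add: charts_at_def)

lemma charts_at_points: "smooth_atlas M \<Longrightarrow> c \<in> charts_at M x \<Longrightarrow> x \<in> points M"
  using chart_subset[OF smooth_atlas_chart, of M c] by (auto simp: charts_at_def)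

lemma coord_vec_eq:
  "coord_vec M c x w = (\<lambda>d. if d \<in> charts_at M x then chart_deriv c d (\<lambda>x. x) x w else 0)"
  by (simp add: coord_vec_def chart_deriv_def rep_def comp_def cong: if_cong)

lemma coord_vec_chart:
  assumes "smooth_atlas M" "c \<in> charts_at M x" "w \<in> model_space c"
  shows "coord_vec M c x w c = w"
  using assms chart_deriv_id[OF smooth_atlas_chart[OF assms(1)], of c x w]
  by (simp add: coord_vec_eq charts_at_def)

lemma tangent_space_chart: "X \<in> tangent_space M x \<Longrightarrow> c \<in> charts_at M x \<Longrightarrow> X c \<in> model_space c"
  unfolding tangent_space_def by blast

lemma tangent_space_change:
  "X \<in> tangent_space M x \<Longrightarrow> c \<in> charts_at M x \<Longrightarrow> d \<in> charts_at M x \<Longrightarrow>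
    X d = chart_deriv c d (\<lambda>x. x) x (X c)"
  unfolding tangent_space_def chart_deriv_def rep_def comp_def by blast

lemma tangent_space_outside: "X \<in> tangent_space M x \<Longrightarrow> c \<notin> charts_at M x \<Longrightarrow> X c = 0"
  unfolding tangent_space_def by blast

lemma coord_vec_tangent:
  assumes M: "smooth_atlas M" and c: "c \<in> maximal_atlas M" "x \<in> fst c" and w: "w \<in> model_space c"
  shows "coord_vec M c x w \<in> tangent_space M x"
  unfolding tangent_space_def
proof (intro CollectI conjI allI impI ballI)
  fix d assume "d \<notin> charts_at M x" then show "coord_vec M c x w d = 0" by (simp add: coord_vec_eq)
next
  fix d assume d: "d \<in> charts_at M x"
  note cd = smooth_rep_id[OF M c(1) charts_at_maximal[OF M d]]
  show "coord_vec M c x w d \<in> model_space d"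
    using chart_deriv_in[OF cd c(2) charts_at_in[OF d] w] d by (simp add: coord_vec_eq)
  fix e assume e: "e \<in> charts_at M x"
  note de = smooth_rep_id[OF M charts_at_maximal[OF M d] charts_at_maximal[OF M e]]
  show "coord_vec M c x w e = dir_deriv (snd e \<circ> chart_inv d) (snd d x) (coord_vec M c x w d)"
    using chart_deriv_compose[OF cd de c(2) charts_at_in[OF d] charts_at_in[OF e] w] d e
    by (simp add: coord_vec_eq chart_deriv_def[of d e] rep_def comp_def)
qed

lemma tangent_vec_eq_coord_vec:
  assumes "X \<in> tangent_space M x" "c \<in> charts_at M x"
  shows "X = coord_vec M c x (X c)"
  by (rule ext) (simp add: coord_vec_eq tangent_space_outside[OF assms(1)] tangent_space_change[OF assms])

lemma tangent_vec_eqI: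
  assumes "X \<in> tangent_space M x" "Y \<in> tangent_space M x" "c \<in> charts_at M x" "X c = Y c"
  shows "X = Y"
  using tangent_vec_eq_coord_vec[OF assms(1,3)] tangent_vec_eq_coord_vec[OF assms(2,3)] assms(4) by simp

lemma coord_vec_linear:
  assumes M: "smooth_atlas M" and c: "c \<in> maximal_atlas M" "x \<in> fst c"
    and u: "u \<in> model_space c" and w: "w \<in> model_space c"
  shows "coord_vec M c x (a *\<^sub>R u + b *\<^sub>R w) = (\<lambda>d. a *\<^sub>R coord_vec M c x u d + b *\<^sub>R coord_vec M c x w d)"
proof
  fix d
  show "coord_vec M c x (a *\<^sub>R u + b *\<^sub>R w) d = a *\<^sub>R coord_vec M c x u d + b *\<^sub>R coord_vec M c x w d"
  proof (cases "d \<in> charts_at M x")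
    case d: True
    obtain D where D: "linear D" "\<And>w. w \<in> model_space c \<Longrightarrow> chart_deriv c d (\<lambda>x. x) x w = D w"
      using chart_deriv_linear[OF smooth_rep_id[OF M c(1) charts_at_maximal[OF M d]] c(2) charts_at_in[OF d]]
      by blast
    have "a *\<^sub>R u + b *\<^sub>R w \<in> model_space c"
      by (intro subspace_add subspace_scale subspace_model_space u w)
    then show ?thesis using d u w by (simp add: coord_vec_eq D linear_add linear_cmul)
  qed (simp add: coord_vec_eq)
qed

lemma tangent_space_lincomb:
  assumes M: "smooth_atlas M" and x: "x \<in> points M"
    and X: "X \<in> tangent_space M x" and Y: "Y \<in> tangent_space M x"
  shows "(\<lambda>c. a *\<^sub>R X c + b *\<^sub>R Y c) \<in> tangent_space M x"
proof -
  obtain c where c: "c \<in> charts_at M x" using smooth_atlas_obtain[OF M x] by blast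
  note c' = charts_at_maximal[OF M c] charts_at_in[OF c] tangent_space_chart[OF X c] tangent_space_chart[OF Y c]
  have "(\<lambda>c. a *\<^sub>R X c + b *\<^sub>R Y c) = coord_vec M c x (a *\<^sub>R X c + b *\<^sub>R Y c)"
    unfolding coord_vec_linear[OF M c']
    using tangent_vec_eq_coord_vec[OF X c] tangent_vec_eq_coord_vec[OF Y c] by metis
  moreover have "\<dots> \<in> tangent_space M x"
    by (intro coord_vec_tangent[OF M c'(1,2)] subspace_add subspace_scale subspace_model_space c')
  ultimately show ?thesis by simp
qed

lemma zero_tangent: 
  assumes "smooth_atlas M" "x \<in> points M"
  shows "(\<lambda>_. 0) \<in> tangent_space M x"
proof -
  obtain c where c: "c \<in> charts_at M x" using smooth_atlas_obtain[OF assms] by blast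
  have "coord_vec M c x 0 \<in> tangent_space M x"
    by (intro coord_vec_tangent assms charts_at_maximal[OF assms(1) c] charts_at_in[OF c]
        subspace_0 subspace_model_space)
  from tangent_space_lincomb[OF assms this this, of 0 0] show ?thesis by simp
qed

text \<open>
  The definition of \<open>tangent_map\<close> uses an arbitrary chart around \<open>x\<close>; by the chain rule, the
  compatibility of the components of \<open>X\<close> makes this choice immaterial.
\<close>

lemma tangent_map_chart:
  assumes M: "smooth_atlas M" and N: "smooth_atlas N" and F: "smooth_map M N F"
    and X: "X \<in> tangent_space M x" and c: "c \<in> charts_at M x" and d: "d \<in> charts_at N (F x)"
  shows "tangent_map M N F x X d = chart_deriv c d F x (X c)"
proof -
  define s where "s = (SOME c. c \<in> charts_at M x)"
  have s: "s \<in> charts_at M x" unfolding s_def using c by (rule someI)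
  note max = charts_at_maximal[OF M c] charts_at_maximal[OF M s] charts_at_maximal[OF N d]
  have "chart_deriv s d (\<lambda>x. F x) x (X s) = chart_deriv c d F x (chart_deriv s c (\<lambda>x. x) x (X s))"
    by (rule chart_deriv_compose[OF smooth_rep_id[OF M max(2,1)] smooth_map_rep[OF M N F max(1,3)]
          charts_at_in[OF s] charts_at_in[OF c] charts_at_in[OF d] tangent_space_chart[OF X s]])
  then show ?thesis
    using d by (simp add: tangent_map_def s_def[symmetric] tangent_space_change[OF X s c]
        chart_deriv_def[of s d] rep_def comp_def)
qed

lemma tangent_map_coord_vec:
  assumes M: "smooth_atlas M" and N: "smooth_atlas N" and F: "smooth_map M N F"
    and X: "X \<in> tangent_space M x" and c: "c \<in> charts_at M x" and d: "d \<in> charts_at N (F x)"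
  shows "tangent_map M N F x X = coord_vec N d (F x) (chart_deriv c d F x (X c))"
proof
  fix e
  show "tangent_map M N F x X e = coord_vec N d (F x) (chart_deriv c d F x (X c)) e"
  proof (cases "e \<in> charts_at N (F x)")
    case e: True
    note max = charts_at_maximal[OF M c] charts_at_maximal[OF N d] charts_at_maximal[OF N e]
    have "chart_deriv c e (\<lambda>x. F x) x (X c) = chart_deriv d e (\<lambda>x. x) (F x) (chart_deriv c d F x (X c))"
      by (rule chart_deriv_compose[OF smooth_map_rep[OF M N F max(1,2)] smooth_rep_id[OF N max(2,3)]
            charts_at_in[OF c] charts_at_in[OF d] charts_at_in[OF e] tangent_space_chart[OF X c]])
    then show ?thesis using e by (simp add: tangent_map_chart[OF M N F X c e] coord_vec_eq)
  qed (simp add: tangent_map_def coord_vec_eq Let_def)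
qed

lemma tangent_map_in:
  assumes M: "smooth_atlas M" and N: "smooth_atlas N" and F: "smooth_map M N F"
    and x: "x \<in> points M" and X: "X \<in> tangent_space M x"
  shows "tangent_map M N F x X \<in> tangent_space N (F x)"
proof -
  obtain c where c: "c \<in> charts_at M x" using smooth_atlas_obtain[OF M x] by blast
  obtain d where d: "d \<in> charts_at N (F x)"
    using smooth_atlas_obtain[OF N smooth_map_points[OF F x]] by blast
  note max = charts_at_maximal[OF M c] charts_at_maximal[OF N d]
  show ?thesis unfolding tangent_map_coord_vec[OF M N F X c d]
    by (intro coord_vec_tangent[OF N max(2) charts_at_in[OF d]]
        chart_deriv_in[OF smooth_map_rep[OF M N F max] charts_at_in[OF c] charts_at_in[OF d]]
        tangent_space_chart[OF X c])
qed

lemma tangent_map_linear: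
  assumes M: "smooth_atlas M" and N: "smooth_atlas N" and F: "smooth_map M N F" and x: "x \<in> points M"
    and X: "X \<in> tangent_space M x" and Y: "Y \<in> tangent_space M x"
  shows "tangent_map M N F x (\<lambda>c. a *\<^sub>R X c + b *\<^sub>R Y c) =
    (\<lambda>d. a *\<^sub>R tangent_map M N F x X d + b *\<^sub>R tangent_map M N F x Y d)"
proof -
  obtain c where c: "c \<in> charts_at M x" using smooth_atlas_obtain[OF M x] by blast
  obtain d where d: "d \<in> charts_at N (F x)"
    using smooth_atlas_obtain[OF N smooth_map_points[OF F x]] by blast
  note max = charts_at_maximal[OF M c] charts_at_maximal[OF N d]
  note cd = smooth_map_rep[OF M N F max] charts_at_in[OF c] charts_at_in[OF d]
  obtain D where D: "linear D" "\<And>w. w \<in> model_space c \<Longrightarrow> chart_deriv c d F x w = D w"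
    using chart_deriv_linear[OF cd] by blast
  have in_c: "X c \<in> model_space c" "Y c \<in> model_space c" "a *\<^sub>R X c + b *\<^sub>R Y c \<in> model_space c"
    using tangent_space_chart[OF X c] tangent_space_chart[OF Y c]
    by (auto intro: subspace_add subspace_scale subspace_model_space)
  then have "D (X c) \<in> model_space d" "D (Y c) \<in> model_space d"
    using chart_deriv_in[OF cd] D(2) by metis+
  then show ?thesis
    unfolding tangent_map_coord_vec[OF M N F X c d] tangent_map_coord_vec[OF M N F Y c d]
      tangent_map_coord_vec[OF M N F tangent_space_lincomb[OF M x X Y] c d]
    using in_c D coord_vec_linear[OF N max(2) charts_at_in[OF d]]
    by (simp add: linear_add linear_cmul)
qed

lemma tangent_map_compose:
  assumes M: "smooth_atlas M" and N: "smooth_atlas N" and Q: "smooth_atlas Q"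
    and F: "smooth_map M N F" and G: "smooth_map N Q G"
    and x: "x \<in> points M" and X: "X \<in> tangent_space M x"
  shows "tangent_map M Q (\<lambda>x. G (F x)) x X = tangent_map N Q G (F x) (tangent_map M N F x X)"
proof -
  obtain c where c: "c \<in> charts_at M x" using smooth_atlas_obtain[OF M x] by blast
  note Fx = smooth_map_points[OF F x]
  obtain d where d: "d \<in> charts_at N (F x)" using smooth_atlas_obtain[OF N Fx] by blast
  obtain e where e: "e \<in> charts_at Q (G (F x))"
    using smooth_atlas_obtain[OF Q smooth_map_points[OF G Fx]] by blast
  note max = charts_at_maximal[OF M c] charts_at_maximal[OF N d] charts_at_maximal[OF Q e]
  note TX = tangent_map_in[OF M N F x X]
  have "chart_deriv c e (\<lambda>x. G (F x)) x (X c) = chart_deriv d e G (F x) (chart_deriv c d F x (X c))"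
    by (rule chart_deriv_compose[OF smooth_map_rep[OF M N F max(1,2)] smooth_map_rep[OF N Q G max(2,3)]
          charts_at_in[OF c] charts_at_in[OF d] charts_at_in[OF e] tangent_space_chart[OF X c]])
  then show ?thesis
    unfolding tangent_map_coord_vec[OF M Q smooth_map_compose[OF M N Q F G] X c e]
      tangent_map_coord_vec[OF N Q G TX d e] tangent_map_chart[OF M N F X c d] by simp
qed

lemma tangent_map_id:
  assumes M: "smooth_atlas M" and x: "x \<in> points M" and X: "X \<in> tangent_space M x"
  shows "tangent_map M M (\<lambda>x. x) x X = X"
proof -
  obtain c where c: "c \<in> charts_at M x" using smooth_atlas_obtain[OF M x] by blast
  show ?thesis
    unfolding tangent_map_coord_vec[OF M M smooth_map_id[OF M] X c c]
    using c chart_deriv_id[OF _ charts_at_in[OF c] tangent_space_chart[OF X c]]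
      tangent_vec_eq_coord_vec[OF X c] maximal_atlas_chart[OF charts_at_maximal[OF M c]] by metis
qed

lemma tangent_map_cong:
  assumes M: "smooth_atlas M" and N: "smooth_atlas N" and F: "smooth_map M N F"
    and x: "x \<in> points M" and X: "X \<in> tangent_space M x"
    and eq: "\<And>z. z \<in> points M \<Longrightarrow> F z = G z"
  shows "tangent_map M N F x X = tangent_map M N G x X"
proof -
  note G = smooth_map_cong[OF M N F eq, simplified]
  obtain c where c: "c \<in> charts_at M x" using smooth_atlas_obtain[OF M x] by blast
  obtain d where d: "d \<in> charts_at N (F x)"
    using smooth_atlas_obtain[OF N smooth_map_points[OF F x]] by blast
  then have d': "d \<in> charts_at N (G x)" using eq x by simp
  have "chart_deriv c d F x (X c) = chart_deriv c d G x (X c)"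
    by (rule chart_deriv_cong[OF maximal_atlas_chart[OF charts_at_maximal[OF M c]]
          maximal_atlas_chart[OF charts_at_maximal[OF N d]] smooth_map_continuous[OF F]
          charts_at_in[OF c] charts_at_in[OF d] tangent_space_chart[OF X c] eq])
  then show ?thesis
    unfolding tangent_map_coord_vec[OF M N F X c d] tangent_map_coord_vec[OF M N G X c d'] 
    using eq x by simp
qed

text \<open>In product charts, projections and inclusions of factors are affine; so are constant maps in all charts.\<close>

lemma chart_deriv_affine:
  fixes L :: "'e::euclidean_space \<Rightarrow> 'f::euclidean_space"
  assumes "is_chart T c" "is_chart T' d" "continuous_map T T' F" "x \<in> fst c" "F x \<in> fst d"
    and w: "w \<in> model_space c" and L: "bounded_linear L"
    and eq: "\<And>y. y \<in> rep_dom c d F \<Longrightarrow> rep c d F y = L y + k"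
  shows "chart_deriv c d F x w = L w"
proof -
  note S = subspace_model_space rep_dom_openin[OF assms(1-3)] rep_domI[where F=F, OF assms(4,5)] w
  have "((\<lambda>y. L y + k) has_derivative L) (at (snd c x) within rep_dom c d F)"
    using bounded_linear_imp_has_derivative[OF L] by (auto intro!: derivative_eq_intros)
  then have "dir_deriv (\<lambda>y. L y + k) (snd c x) w = L w" by (rule dir_deriv_eq[OF S])
  then show ?thesis unfolding chart_deriv_def by (simp add: dir_deriv_cong[OF S eq])
qed

lemma chart_deriv_inverse:
  assumes M: "smooth_atlas M" and N: "smooth_atlas N" and F: "smooth_map M N F" and G: "smooth_map N M G"
    and GF: "\<And>x. x \<in> points M \<Longrightarrow> G (F x) = x"
    and c: "c \<in> maximal_atlas M" "x \<in> fst c" and d: "d \<in> maximal_atlas N" "F x \<in> fst d"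
    and w: "w \<in> model_space c"
  shows "chart_deriv d c G (F x) (chart_deriv c d F x w) = w"
proof -
  note reps = smooth_map_rep[OF M N F c(1) d(1)] smooth_map_rep[OF N M G d(1) c(1)]
  have x: "x \<in> points M" using c chart_subset[OF maximal_atlas_chart] by blast
  have "chart_deriv d c G (F x) (chart_deriv c d F x w) = chart_deriv c c (\<lambda>x. G (F x)) x w"
    using chart_deriv_compose[OF reps c(2) d(2) _ w] GF[OF x] c(2) by simp
  also have "\<dots> = chart_deriv c c (\<lambda>x. x) x w"
    using GF[OF x] c GF smooth_map_continuous[OF smooth_map_compose[OF M N M F G]] w
    by (intro chart_deriv_cong[OF maximal_atlas_chart maximal_atlas_chart]) auto
  also have "\<dots> = w" by (rule chart_deriv_id[OF maximal_atlas_chart[OF c(1)] c(2) w])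
  finally show ?thesis .
qed

lemma model_space_iso:
  assumes M: "smooth_atlas M" and N: "smooth_atlas N" and F: "smooth_map M N F" and G: "smooth_map N M G"
    and GF: "\<And>x. x \<in> points M \<Longrightarrow> G (F x) = x" and FG: "\<And>x. x \<in> points N \<Longrightarrow> F (G x) = x"
    and c: "c \<in> maximal_atlas M" "x \<in> fst c" and d: "d \<in> maximal_atlas N" "F x \<in> fst d"
  obtains D where "linear D" "\<And>w. w \<in> model_space c \<Longrightarrow> chart_deriv c d F x w = D w"
    "inj_on D (model_space c)" "D ` model_space c = model_space d"
proof -
  have x: "x \<in> points M" using c chart_subset[OF maximal_atlas_chart] by blast
  obtain D where D: "linear D" "\<And>w. w \<in> model_space c \<Longrightarrow> chart_deriv c d F x w = D w"
    using chart_deriv_linear[OF smooth_map_rep[OF M N F c(1) d(1)] c(2) d(2)] by blast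
  have inv: "chart_deriv d c G (F x) (D w) = w" if "w \<in> model_space c" for w
    using chart_deriv_inverse[OF M N F G GF c d that] D(2)[OF that] by simp
  have "w \<in> D ` model_space c" if w: "w \<in> model_space d" for w
  proof -
    have "chart_deriv c d F (G (F x)) (chart_deriv d c G (F x) w) = w"
      by (rule chart_deriv_inverse[OF N M G F FG d c(1) _ w]) (simp_all add: GF x c)
    moreover have "chart_deriv d c G (F x) w \<in> model_space c"
      by (rule chart_deriv_in[OF smooth_map_rep[OF N M G d(1) c(1)] d(2) _ w]) (simp add: GF x c)
    ultimately show ?thesis using D(2) by (metis GF x imageI)
  qed
  moreover have "D w \<in> model_space d" if "w \<in> model_space c" for w
    using chart_deriv_in[OF smooth_map_rep[OF M N F c(1) d(1)] c(2) d(2) that] D(2)[OF that] by simp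
  ultimately have "D ` model_space c = model_space d" by blast
  with D inv show ?thesis by (intro that[of D]) (auto intro: inj_on_inverseI)
qed

lemma dim_linear_image_eq:
  fixes D :: "'e::euclidean_space \<Rightarrow> 'f::euclidean_space"
  assumes "linear D" "inj_on D V" "subspace V"
  shows "dim (D ` V) = dim V"
  using dim_image_eq[OF assms(1), of V] assms(2,3) span_eq_iff[of V] by metis

text \<open>
  The derivative of the change of coordinates is an isomorphism between the model spaces.
\<close>

lemma dim_model_space_eq:
  assumes "smooth_atlas M" "c \<in> maximal_atlas M" "x \<in> fst c" "d \<in> maximal_atlas M" "x \<in> fst d"
  shows "dim (model_space c) = dim (model_space d)"
  using model_space_iso[OF assms(1,1) smooth_map_id[OF assms(1)] smooth_map_id[OF assms(1)] refl refl assms(2-5)]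
    dim_linear_image_eq[OF _ _ subspace_model_space] by metis

section \<open>The half-line, products and submanifolds\<close>

abbreviation pos_chart :: "(real, real) chart" where
  "pos_chart \<equiv> ({0<..}, \<lambda>r. r)"

lemma points_pos_reals [simp]: "points pos_reals = {0<..}"
  by (simp add: pos_reals_def)

lemma atlas_pos_reals: "atlas pos_reals = {pos_chart}"
  by (simp add: pos_reals_def)

lemma pos_chart_inv: "r > 0 \<Longrightarrow> chart_inv pos_chart r = r"
  unfolding chart_inv_def by (simp add: inv_into_f_eq)

lemma is_chart_pos: "is_chart (topo pos_reals) pos_chart"
  and model_space_pos: "model_space pos_chart = UNIV"
proof -
  have "openin (topo pos_reals) {0<..}" "openin (top_of_set UNIV) ((\<lambda>r. r) ` {0::real<..})"
    "continuous_map (subtopology (topo pos_reals) {0<..}) euclidean (\<lambda>r. r)"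
    "continuous_map (top_of_set ((\<lambda>r. r) ` {0<..})) (topo pos_reals) (\<lambda>r. r)"
    by (auto simp: pos_reals_def subtopology_subtopology continuous_map_in_subtopology)
  from is_chartI[OF _ this(1) subspace_UNIV this(2-4)]
  show "is_chart (topo pos_reals) pos_chart" "model_space pos_chart = UNIV" by auto
qed

lemma rep_pos: "r > 0 \<Longrightarrow> rep pos_chart d F r = snd d (F r)"
  by (simp add: rep_def pos_chart_inv)

lemma rep_dom_pos: "rep_dom pos_chart d F = {r. r > 0 \<and> F r \<in> fst d}"
  by (auto simp: rep_dom_def)

lemma smooth_atlas_pos_reals: "smooth_atlas pos_reals"
proof -
  have "smooth_on (rep_dom pos_chart pos_chart (\<lambda>x. x)) (rep pos_chart pos_chart (\<lambda>x. x))"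
    by (rule smooth_on_eq[OF smooth_on_ident]) (simp add: rep_dom_pos rep_pos)
  then have "smooth_rep (topo pos_reals) (topo pos_reals) pos_chart pos_chart (\<lambda>x. x)"
    using continuous_map_id[of "topo pos_reals"] by (simp add: smooth_rep_def is_chart_pos id_def)
  then show ?thesis
    by (simp add: smooth_atlas_def atlas_pos_reals is_chart_pos compatible_smooth_rep[OF is_chart_pos is_chart_pos])
qed

lemma charts_at_pos_reals: "r > 0 \<Longrightarrow> charts_at pos_reals r = {pos_chart}"
  by (auto simp: charts_at_def atlas_pos_reals)

lemma smooth_map_powr:
  assumes "c > 0"
  shows "smooth_map pos_reals pos_reals (\<lambda>r. c * r powr b)"
proof -
  have "continuous_on {0<..} (\<lambda>r. c * r powr b)"
    by (auto intro!: continuous_intros)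
  moreover have "smooth_on (rep_dom pos_chart pos_chart (\<lambda>r. c * r powr b)) (rep pos_chart pos_chart (\<lambda>r. c * r powr b))"
    by (rule smooth_on_subset_eq[OF smooth_on_powr[of c b]]) (auto simp: rep_dom_pos rep_pos)
  ultimately show ?thesis
    unfolding smooth_map_iff atlas_pos_reals using assms
    by (auto simp: pos_reals_def continuous_map_in_subtopology)
qed

lemma smooth_map_pos_realsD:
  assumes M: "smooth_atlas M" and f: "smooth_map M pos_reals f" and c: "c \<in> maximal_atlas M"
  shows "smooth_on (snd c ` fst c) (\<lambda>y. f (chart_inv c y))"
proof -
  have pos: "f x > 0" if "x \<in> fst c" for x
    using smooth_map_points[OF f, of x] that chart_subset[OF maximal_atlas_chart[OF c]] by auto
  have "smooth_rep (topo M) (topo pos_reals) c pos_chart f"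
    by (rule smooth_map_rep[OF M smooth_atlas_pos_reals f c])
      (simp add: atlas_subset_maximal[OF smooth_atlas_pos_reals] atlas_pos_reals)
  from smooth_repD(5)[OF this] show ?thesis
    by (rule smooth_on_subset_eq) (auto simp: rep_def rep_dom_def pos)
qed

lemma differential_eq_tangent_map:
  assumes "f x > 0"
  shows "differential M f x X = tangent_map M pos_reals f x X pos_chart"
  using assms by (simp add: differential_def tangent_map_def charts_at_pos_reals Let_def comp_def)

definition prod_chart ::
  "('a, 'e::euclidean_space) chart \<Rightarrow> ('b, 'f::euclidean_space) chart \<Rightarrow> ('a \<times> 'b, 'e \<times> 'f) chart" where
  "prod_chart c d = (fst c \<times> fst d, map_prod (snd c) (snd d))"

lemma fst_prod_chart [simp]: "fst (prod_chart c d) = fst c \<times> fst d"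
  by (simp add: prod_chart_def)

lemma snd_prod_chart [simp]: "snd (prod_chart c d) = map_prod (snd c) (snd d)"
  by (simp add: prod_chart_def)

lemma points_prod_mfd [simp]: "points (prod_mfd M N) = points M \<times> points N"
  by (simp add: prod_mfd_def)

lemma topo_prod_mfd: "topo (prod_mfd M N) = prod_topology (topo M) (topo N)"
  by (simp add: prod_mfd_def)

lemma atlas_prod_mfd: "atlas (prod_mfd M N) = {prod_chart c d |c d. c \<in> atlas M \<and> d \<in> atlas N}"
  by (simp add: prod_mfd_def prod_chart_def)

lemma prod_chart_in_atlas: "c \<in> atlas M \<Longrightarrow> d \<in> atlas N \<Longrightarrow> prod_chart c d \<in> atlas (prod_mfd M N)"
  unfolding atlas_prod_mfd by blast

lemma atlas_prodE:
  assumes "e \<in> atlas (prod_mfd M N)"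
  obtains c d where "e = prod_chart c d" "c \<in> atlas M" "d \<in> atlas N"
  using assms unfolding atlas_prod_mfd by blast

lemma is_chart_prod:
  assumes c: "is_chart T c" and d: "is_chart T' d"
  shows "is_chart (prod_topology T T') (prod_chart c d)"
    and "model_space (prod_chart c d) = model_space c \<times> model_space d"
proof -
  have img: "map_prod (snd c) (snd d) ` (fst c \<times> fst d) = (snd c ` fst c) \<times> (snd d ` fst d)"
    by auto
  have "continuous_map (prod_topology (subtopology T (fst c)) (subtopology T' (fst d)))
      (prod_topology euclidean euclidean) (\<lambda>(x, y). (snd c x, snd d y))"
    using chart_continuous[OF c] chart_continuous[OF d]
    by (simp add: continuous_map_prod_top del: prod_topology_euclidean)
  then have cont: "continuous_map (subtopology (prod_topology T T') (fst c \<times> fst d)) euclidean (map_prod (snd c) (snd d))"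
    by (simp add: subtopology_Times map_prod_def)
  have "continuous_map (prod_topology (top_of_set (snd c ` fst c)) (top_of_set (snd d ` fst d)))
      (prod_topology T T') (\<lambda>(x, y). (chart_inv c x, chart_inv d y))"
    using chart_inv_continuous[OF c] chart_inv_continuous[OF d]
    by (simp add: continuous_map_prod_top del: prod_topology_subtopology_eu)
  then have inv: "continuous_map (top_of_set (map_prod (snd c) (snd d) ` (fst c \<times> fst d)))
      (prod_topology T T') (map_prod (chart_inv c) (chart_inv d))"
    unfolding img by (simp add: map_prod_def)
  have "openin (top_of_set (model_space c \<times> model_space d)) (map_prod (snd c) (snd d) ` (fst c \<times> fst d))"
    unfolding img using c d by (intro openin_Times) (auto simp: is_chart_def)
  note I = is_chartI[OF _ _ subspace_Times[OF subspace_model_space subspace_model_space] this cont inv]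
  have op: "openin (prod_topology T T') (fst c \<times> fst d)" "fst c \<times> fst d \<noteq> {}"
    using c d by (auto simp: is_chart_def openin_prod_Times_iff)
  have left: "map_prod (chart_inv c) (chart_inv d) (map_prod (snd c) (snd d) x) = x" if "x \<in> fst c \<times> fst d" for x
    using that chart_inv_left[OF c] chart_inv_left[OF d] by (cases x) simp
  show "is_chart (prod_topology T T') (prod_chart c d)"
    and "model_space (prod_chart c d) = model_space c \<times> model_space d"
    unfolding prod_chart_def by (rule I[OF op(2,1)], rule left, simp)+
qed

lemma prod_chart_inv:
  assumes c: "is_chart T c" and d: "is_chart T' d" and "y \<in> snd c ` fst c" "z \<in> snd d ` fst d"
  shows "chart_inv (prod_chart c d) (y, z) = (chart_inv c y, chart_inv d z)"
proof -
  have "(chart_inv c y, chart_inv d z) \<in> fst (prod_chart c d)"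
    using chart_inv_in[OF assms(3)] chart_inv_in[OF assms(4)] by simp
  from chart_inv_left[OF is_chart_prod(1)[OF c d] this] show ?thesis
    using chart_inv_right[OF assms(3)] chart_inv_right[OF assms(4)] by simp
qed

lemma smooth_rep_Pair:
  assumes F: "smooth_rep T T' q c F" and G: "smooth_rep T T'' q d G"
  shows "smooth_rep T (prod_topology T' T'') q (prod_chart c d) (\<lambda>x. (F x, G x))"
  unfolding smooth_rep_def
proof (intro conjI is_chart_prod smooth_repD(2)[OF F] smooth_repD(2)[OF G] smooth_repD(1)[OF F])
  show "continuous_map T (prod_topology T' T'') (\<lambda>x. (F x, G x))"
    using smooth_repD(3)[OF F] smooth_repD(3)[OF G] by (simp add: continuous_map_paired)
  have sub: "rep_dom q (prod_chart c d) (\<lambda>x. (F x, G x)) \<subseteq> rep_dom q c F \<inter> rep_dom q d G"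
    by (auto simp: rep_dom_def)
  show "smooth_on (rep_dom q (prod_chart c d) (\<lambda>x. (F x, G x))) (rep q (prod_chart c d) (\<lambda>x. (F x, G x)))"
    using smooth_on_Pair[OF smooth_on_subset[OF smooth_repD(5)[OF F]] smooth_on_subset[OF smooth_repD(5)[OF G]]]
      sub by (auto simp: rep_def)
qed

lemma rep_dom_fst: "rep_dom (prod_chart c d) c' fst = rep_dom c c' (\<lambda>x. x) \<times> snd d ` fst d"
  by (auto simp: rep_dom_def image_iff)

lemma rep_dom_snd: "rep_dom (prod_chart c d) d' snd = snd c ` fst c \<times> rep_dom d d' (\<lambda>x. x)"
  by (auto simp: rep_dom_def image_iff)

lemma rep_fst:
  assumes "is_chart T c" "is_chart T' d" "y \<in> rep_dom (prod_chart c d) c' fst"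
  shows "rep (prod_chart c d) c' fst y = rep c c' (\<lambda>x. x) (fst y)"
  using assms(3) prod_chart_inv[OF assms(1,2), of "fst y" "snd y"]
  by (auto simp: rep_dom_fst rep_def rep_dom_def)

lemma rep_snd:
  assumes "is_chart T c" "is_chart T' d" "y \<in> rep_dom (prod_chart c d) d' snd"
  shows "rep (prod_chart c d) d' snd y = rep d d' (\<lambda>x. x) (snd y)"
  using assms(3) prod_chart_inv[OF assms(1,2), of "fst y" "snd y"]
  by (auto simp: rep_dom_snd rep_def rep_dom_def)

lemma smooth_rep_fst:
  assumes c: "smooth_rep T T c c' (\<lambda>x. x)" and d: "is_chart T' d"
  shows "smooth_rep (prod_topology T T') T (prod_chart c d) c' fst"
  unfolding smooth_rep_def
proof (intro conjI is_chart_prod d smooth_repD(1,2)[OF c] continuous_map_fst)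
  have "smooth_on (rep_dom (prod_chart c d) c' fst) (rep c c' (\<lambda>x. x) \<circ> fst)"
    by (rule smooth_on_compose[OF smooth_repD(5)[OF c] smooth_on_bounded_linear[OF bounded_linear_fst]])
      (auto simp: rep_dom_fst)
  then show "smooth_on (rep_dom (prod_chart c d) c' fst) (rep (prod_chart c d) c' fst)"
    by (rule smooth_on_eq) (simp add: rep_fst[OF smooth_repD(1)[OF c] d])
qed

lemma smooth_rep_snd:
  assumes c: "is_chart T c" and d: "smooth_rep T' T' d d' (\<lambda>x. x)"
  shows "smooth_rep (prod_topology T T') T' (prod_chart c d) d' snd"
  unfolding smooth_rep_def
proof (intro conjI is_chart_prod c smooth_repD(1,2)[OF d] continuous_map_snd)
  have "smooth_on (rep_dom (prod_chart c d) d' snd) (rep d d' (\<lambda>x. x) \<circ> snd)"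
    by (rule smooth_on_compose[OF smooth_repD(5)[OF d] smooth_on_bounded_linear[OF bounded_linear_snd]])
      (auto simp: rep_dom_snd)
  then show "smooth_on (rep_dom (prod_chart c d) d' snd) (rep (prod_chart c d) d' snd)"
    by (rule smooth_on_eq) (simp add: rep_snd[OF c smooth_repD(1)[OF d]])
qed

lemma smooth_atlas_prod:
  assumes M: "smooth_atlas M" and N: "smooth_atlas N"
  shows "smooth_atlas (prod_mfd M N)"
proof -
  have chart: "is_chart (topo (prod_mfd M N)) e" if "e \<in> atlas (prod_mfd M N)" for e
    using that is_chart_prod(1)[OF smooth_atlas_chart[OF M] smooth_atlas_chart[OF N]]
    by (auto simp: atlas_prod_mfd topo_prod_mfd)
  have rep: "smooth_rep (topo (prod_mfd M N)) (topo (prod_mfd M N)) e e' (\<lambda>x. x)"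
    if e_in: "e \<in> atlas (prod_mfd M N)" and e'_in: "e' \<in> atlas (prod_mfd M N)" for e e'
  proof -
    obtain c d where e: "e = prod_chart c d" "c \<in> atlas M" "d \<in> atlas N" using e_in by (rule atlas_prodE)
    obtain c' d' where e': "e' = prod_chart c' d'" "c' \<in> atlas M" "d' \<in> atlas N" using e'_in by (rule atlas_prodE)
    have "smooth_rep (topo (prod_mfd M N)) (topo M) e c' fst" unfolding e(1) topo_prod_mfd
      using e e' by (intro smooth_rep_fst smooth_rep_id[OF M] smooth_atlas_chart[OF N] atlas_subset_maximal[OF M])
    moreover have "smooth_rep (topo (prod_mfd M N)) (topo N) e d' snd" unfolding e(1) topo_prod_mfd
      using e e' by (intro smooth_rep_snd smooth_rep_id[OF N] smooth_atlas_chart[OF M] atlas_subset_maximal[OF N])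
    ultimately have "smooth_rep (topo (prod_mfd M N)) (topo (prod_mfd M N)) e e' (\<lambda>x. (fst x, snd x))"
      unfolding e'(1) topo_prod_mfd by (rule smooth_rep_Pair)
    then show ?thesis by simp
  qed
  have "compatible e e'" if "e \<in> atlas (prod_mfd M N)" "e' \<in> atlas (prod_mfd M N)" for e e'
    using compatible_smooth_rep[OF chart[OF that(1)] chart[OF that(2)]] rep that by blast
  moreover have "(\<Union>e\<in>atlas (prod_mfd M N). fst e) = points (prod_mfd M N)"
  proof
    show "(\<Union>e\<in>atlas (prod_mfd M N). fst e) \<subseteq> points (prod_mfd M N)"
      using chart chart_subset by blast
    show "points (prod_mfd M N) \<subseteq> (\<Union>e\<in>atlas (prod_mfd M N). fst e)"
    proof
      fix p assume p: "p \<in> points (prod_mfd M N)"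
      obtain c where "c \<in> atlas M" "fst p \<in> fst c"
        by (rule smooth_atlas_obtain[OF M, of "fst p"]) (use p in auto)
      moreover obtain d where "d \<in> atlas N" "snd p \<in> fst d"
        by (rule smooth_atlas_obtain[OF N, of "snd p"]) (use p in auto)
      ultimately show "p \<in> (\<Union>e\<in>atlas (prod_mfd M N). fst e)"
        using p by (intro UN_I[OF prod_chart_in_atlas[of c _ d]]) (auto simp: mem_Times_iff)
    qed
  qed
  ultimately show ?thesis using chart by (simp add: smooth_atlas_def)
qed

lemma smooth_map_Pair:
  assumes "smooth_atlas Q" "smooth_atlas M" "smooth_atlas N" and F: "smooth_map Q M F" and G: "smooth_map Q N G"
  shows "smooth_map Q (prod_mfd M N) (\<lambda>x. (F x, G x))"
proof (rule smooth_mapI)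
  show "continuous_map (topo Q) (topo (prod_mfd M N)) (\<lambda>x. (F x, G x))"
    using F G by (simp add: topo_prod_mfd continuous_map_paired smooth_map_continuous)
  fix q e assume q: "q \<in> atlas Q" and "e \<in> atlas (prod_mfd M N)"
  then obtain c d where e: "e = prod_chart c d" "c \<in> atlas M" "d \<in> atlas N" by (blast elim: atlas_prodE)
  show "smooth_rep (topo Q) (topo (prod_mfd M N)) q e (\<lambda>x. (F x, G x))"
    unfolding e(1) topo_prod_mfd using q e assms
    by (intro smooth_rep_Pair smooth_map_rep atlas_subset_maximal)
qed

lemma smooth_map_fst:
  assumes M: "smooth_atlas M" and N: "smooth_atlas N"
  shows "smooth_map (prod_mfd M N) M fst"
proof (rule smooth_mapI)
  show "continuous_map (topo (prod_mfd M N)) (topo M) fst" unfolding topo_prod_mfd by (rule continuous_map_fst)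
  fix e c' assume c': "c' \<in> atlas M" and "e \<in> atlas (prod_mfd M N)"
  then obtain c d where e: "e = prod_chart c d" "c \<in> atlas M" "d \<in> atlas N" by (blast elim: atlas_prodE)
  show "smooth_rep (topo (prod_mfd M N)) (topo M) e c' fst" unfolding e(1) topo_prod_mfd
    using e c' by (intro smooth_rep_fst smooth_rep_id[OF M] smooth_atlas_chart[OF N] atlas_subset_maximal[OF M])
qed

lemma smooth_map_snd:
  assumes M: "smooth_atlas M" and N: "smooth_atlas N"
  shows "smooth_map (prod_mfd M N) N snd"
proof (rule smooth_mapI)
  show "continuous_map (topo (prod_mfd M N)) (topo N) snd" unfolding topo_prod_mfd by (rule continuous_map_snd)
  fix e d' assume d': "d' \<in> atlas N" and "e \<in> atlas (prod_mfd M N)"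
  then obtain c d where e: "e = prod_chart c d" "c \<in> atlas M" "d \<in> atlas N" by (blast elim: atlas_prodE)
  show "smooth_rep (topo (prod_mfd M N)) (topo N) e d' snd" unfolding e(1) topo_prod_mfd
    using e d' by (intro smooth_rep_snd smooth_rep_id[OF N] smooth_atlas_chart[OF M] atlas_subset_maximal[OF N])
qed

lemma smooth_map_const:
  assumes M: "smooth_atlas M" and N: "smooth_atlas N" and y: "y \<in> points N"
  shows "smooth_map M N (\<lambda>_. y)"
  unfolding smooth_map_iff using y by (auto simp: rep_def smooth_on_const)

text \<open>
  In a product chart, a tangent vector of the product is a pair; the two summands below are
  represented by this pair with one entry replaced by \<open>0\<close>.
\<close>

lemma tangent_prod_decompose:
  assumes M: "smooth_atlas M" and N: "smooth_atlas N" and a: "a \<in> points M" and b: "b \<in> points N"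
    and X: "X \<in> tangent_space (prod_mfd M N) (a, b)"
  defines "P \<equiv> prod_mfd M N"
  shows "X = (\<lambda>e. tangent_map M P (\<lambda>x. (x, b)) a (tangent_map P M fst (a, b) X) e
                + tangent_map N P (\<lambda>y. (a, y)) b (tangent_map P N snd (a, b) X) e)"
    (is "X = (\<lambda>e. ?A e + ?B e)")
proof -
  note P = smooth_atlas_prod[OF M N, folded P_def]
  have ab: "(a, b) \<in> points P" using a b by (simp add: P_def)
  have X': "X \<in> tangent_space P (a, b)" using X by (simp add: P_def)
  obtain c where c: "c \<in> charts_at M a" "c \<in> atlas M" "is_chart (topo M) c" using smooth_atlas_obtain[OF M a] by blast
  obtain d where d: "d \<in> charts_at N b" "d \<in> atlas N" "is_chart (topo N) d" using smooth_atlas_obtain[OF N b] by blast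
  define e where "e = prod_chart c d"
  have e: "e \<in> charts_at P (a, b)" using c d prod_chart_in_atlas[of c M d N]
    by (simp add: charts_at_def e_def P_def)
  have e': "is_chart (topo P) e" "e \<in> maximal_atlas P" "(a, b) \<in> fst e"
    using charts_at_maximal[OF P e] maximal_atlas_chart[OF charts_at_maximal[OF P e]] charts_at_in[OF e] by auto
  have Xe: "X e \<in> model_space c \<times> model_space d"
    using tangent_space_chart[OF X' e] is_chart_prod(2)[OF c(3) d(3)] by (simp add: e_def)
  note fst' = smooth_map_fst[OF M N, folded P_def] and snd' = smooth_map_snd[OF M N, folded P_def]
  note inl = smooth_map_Pair[OF M M N smooth_map_id[OF M] smooth_map_const[OF M N b], folded P_def]
  note inr = smooth_map_Pair[OF N M N smooth_map_const[OF N M a] smooth_map_id[OF N], folded P_def]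
  have TA: "tangent_map P M fst (a, b) X \<in> tangent_space M a"
    using tangent_map_in[OF P M fst' ab X'] by simp
  have TB: "tangent_map P N snd (a, b) X \<in> tangent_space N b"
    using tangent_map_in[OF P N snd' ab X'] by simp
  have 1: "tangent_map P M fst (a, b) X c = fst (X e)"
  proof -
    have "tangent_map P M fst (a, b) X c = chart_deriv e c fst (a, b) (X e)"
      using c by (intro tangent_map_chart[OF P M fst' X' e]) simp
    also have "\<dots> = fst (X e)"
    proof (rule chart_deriv_affine[OF e'(1) c(3) smooth_map_continuous[OF fst'] e'(3) _
          tangent_space_chart[OF X' e] bounded_linear_fst])
      show "rep e c fst y = fst y + 0" if "y \<in> rep_dom e c fst" for y
      proof -
        have y: "y \<in> rep_dom (prod_chart c d) c fst" using that by (simp add: e_def)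
        then have "fst y \<in> snd c ` fst c" by (auto simp: rep_dom_fst rep_dom_def)
        then show ?thesis using rep_fst[OF c(3) d(3) y] by (simp add: e_def rep_def chart_inv_right)
      qed
    qed (use charts_at_in[OF c(1)] in simp)
    finally show ?thesis .
  qed
  have 2: "tangent_map P N snd (a, b) X d = snd (X e)"
  proof -
    have "tangent_map P N snd (a, b) X d = chart_deriv e d snd (a, b) (X e)"
      using d by (intro tangent_map_chart[OF P N snd' X' e]) simp
    also have "\<dots> = snd (X e)"
    proof (rule chart_deriv_affine[OF e'(1) d(3) smooth_map_continuous[OF snd'] e'(3) _
          tangent_space_chart[OF X' e] bounded_linear_snd])
      show "rep e d snd y = snd y + 0" if "y \<in> rep_dom e d snd" for y
      proof -
        have y: "y \<in> rep_dom (prod_chart c d) d snd" using that by (simp add: e_def)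
        then have "snd y \<in> snd d ` fst d" by (auto simp: rep_dom_snd rep_dom_def)
        then show ?thesis using rep_snd[OF c(3) d(3) y] by (simp add: e_def rep_def chart_inv_right)
      qed
    qed (use charts_at_in[OF d(1)] in simp)
    finally show ?thesis .
  qed
  have "?A e = chart_deriv c e (\<lambda>x. (x, b)) a (fst (X e))"
    using tangent_map_chart[OF M P inl TA c(1) e] 1 by simp
  also have "\<dots> = (fst (X e), 0)"
  proof (rule chart_deriv_affine[OF c(3) e'(1) smooth_map_continuous[OF inl] charts_at_in[OF c(1)] e'(3)])
    show "fst (X e) \<in> model_space c" using Xe by auto
    show "bounded_linear (\<lambda>u. (u, 0))" by (auto intro!: bounded_linear_intros)
    show "rep c e (\<lambda>x. (x, b)) y = (y, 0) + (0, snd d b)" if "y \<in> rep_dom c e (\<lambda>x. (x, b))" for y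
      using that by (auto simp: rep_def rep_dom_def e_def chart_inv_left[OF c(3)])
  qed
  finally have A: "?A e = (fst (X e), 0)" .
  have "?B e = chart_deriv d e (\<lambda>y. (a, y)) b (snd (X e))"
    using tangent_map_chart[OF N P inr TB d(1) e] 2 by simp
  also have "\<dots> = (0, snd (X e))"
  proof (rule chart_deriv_affine[OF d(3) e'(1) smooth_map_continuous[OF inr] charts_at_in[OF d(1)] e'(3)])
    show "snd (X e) \<in> model_space d" using Xe by auto
    show "bounded_linear (\<lambda>u. (0, u))" by (auto intro!: bounded_linear_intros)
    show "rep d e (\<lambda>y. (a, y)) y = (0, y) + (snd c a, 0)" if "y \<in> rep_dom d e (\<lambda>y. (a, y))" for y
      using that by (auto simp: rep_def rep_dom_def e_def chart_inv_left[OF d(3)])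
  qed
  finally have B: "?B e = (0, snd (X e))" .
  have "(\<lambda>e. 1 *\<^sub>R ?A e + 1 *\<^sub>R ?B e) \<in> tangent_space P (a, b)"
    by (intro tangent_space_lincomb[OF P ab] tangent_map_in[OF M P inl a TA] tangent_map_in[OF N P inr b TB])
  then show ?thesis
    by (intro tangent_vec_eqI[OF X' _ e]) (simp_all add: A B)
qed

lemma second_countable_prod_topology:
  assumes "second_countable X" "second_countable Y"
  shows "second_countable (prod_topology X Y)"
proof -
  obtain A where A: "countable A" "\<And>V. V \<in> A \<Longrightarrow> openin X V"
    "\<And>U x. openin X U \<and> x \<in> U \<longrightarrow> (\<exists>V\<in>A. x \<in> V \<and> V \<subseteq> U)"
    using assms(1) by (auto simp: second_countable_def)
  obtain B where B: "countable B" "\<And>V. V \<in> B \<Longrightarrow> openin Y V"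
    "\<And>U x. openin Y U \<and> x \<in> U \<longrightarrow> (\<exists>V\<in>B. x \<in> V \<and> V \<subseteq> U)"
    using assms(2) by (auto simp: second_countable_def)
  show ?thesis unfolding second_countable_def
  proof (intro exI[of _ "(\<lambda>(V, W). V \<times> W) ` (A \<times> B)"] conjI allI impI ballI)
    show "countable ((\<lambda>(V, W). V \<times> W) ` (A \<times> B))" using A B by blast
    show "openin (prod_topology X Y) U" if "U \<in> (\<lambda>(V, W). V \<times> W) ` (A \<times> B)" for U
      using that A(2) B(2) by (auto simp: openin_prod_Times_iff)
    fix U p assume "openin (prod_topology X Y) U \<and> p \<in> U"
    then have "openin (prod_topology X Y) U" "(fst p, snd p) \<in> U" by auto
    then have "\<exists>V W. openin X V \<and> openin Y W \<and> fst p \<in> V \<and> snd p \<in> W \<and> V \<times> W \<subseteq> U"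
      unfolding openin_prod_topology_alt by blast
    then obtain V W where VW: "openin X V" "openin Y W" "fst p \<in> V" "snd p \<in> W" "V \<times> W \<subseteq> U"
      by (elim exE conjE)
    obtain V' where "V' \<in> A" "fst p \<in> V'" "V' \<subseteq> V" using A(3) VW(1,3) by blast
    moreover obtain W' where "W' \<in> B" "snd p \<in> W'" "W' \<subseteq> W" using B(3) VW(2,4) by blast
    ultimately show "\<exists>Z\<in>(\<lambda>(V, W). V \<times> W) ` (A \<times> B). p \<in> Z \<and> Z \<subseteq> U"
      using VW(5) by (intro bexI[of _ "V' \<times> W'"]) (auto simp: mem_Times_iff)
  qed
qed

lemma smooth_manifold_iff:
  "smooth_manifold M \<longleftrightarrow> smooth_atlas M \<and> Hausdorff_space (topo M) \<and> second_countable (topo M) \<and>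
     (\<exists>n. \<forall>c\<in>atlas M. dim (model_space c) = n)"
  by (auto simp: smooth_manifold_def smooth_atlas_def)

lemma smooth_manifold_pos_reals: "smooth_manifold pos_reals"
proof -
  have "second_countable (euclidean :: real topology)"
  proof -
    obtain B :: "real set set" where B: "countable B" "\<And>C. C \<in> B \<Longrightarrow> open C"
      "\<And>S. open S \<Longrightarrow> \<exists>U. U \<subseteq> B \<and> S = \<Union>U"
      using univ_second_countable by blast
    have "\<exists>V\<in>B. x \<in> V \<and> V \<subseteq> U" if "open U" "x \<in> U" for U x
      using B(3)[OF that(1)] that(2) by blast
    then show ?thesis unfolding second_countable_def using B(1,2)
      by (intro exI[of _ B]) auto
  qed
  then show ?thesis
    using smooth_atlas_pos_reals
    by (auto simp: smooth_manifold_iff pos_reals_def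
        intro!: second_countable_subtopology Hausdorff_space_subtopology)
qed

lemma smooth_manifold_prod:
  assumes M: "smooth_manifold M" and N: "smooth_manifold N"
  shows "smooth_manifold (prod_mfd M N)"
proof -
  obtain k n where kn: "\<forall>c\<in>atlas M. dim (model_space c) = k" "\<forall>c\<in>atlas N. dim (model_space c) = n"
    using M N by (auto simp: smooth_manifold_iff)
  have "dim (model_space e) = k + n" if e_in: "e \<in> atlas (prod_mfd M N)" for e
  proof -
    obtain c d where e: "e = prod_chart c d" "c \<in> atlas M" "d \<in> atlas N" using e_in by (rule atlas_prodE)
    have "model_space e = model_space c \<times> model_space d"
      unfolding e(1) using M N e(2,3) unfolding smooth_manifold_iff
      by (intro is_chart_prod(2)[of "topo M" c "topo N" d]) (auto intro: smooth_atlas_chart)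
    then show ?thesis using kn e by (simp add: dim_Times subspace_model_space)
  qed
  then show ?thesis
    using M N unfolding smooth_manifold_iff topo_prod_mfd
    by (auto intro: smooth_atlas_prod second_countable_prod_topology simp: Hausdorff_space_prod_topology)
qed

definition restrict_chart :: "'a set \<Rightarrow> ('a, 'e) chart \<Rightarrow> ('a, 'e) chart" where
  "restrict_chart S c = (fst c \<inter> S, snd c)"

lemma fst_restrict_chart [simp]: "fst (restrict_chart S c) = fst c \<inter> S"
  by (simp add: restrict_chart_def)

lemma snd_restrict_chart [simp]: "snd (restrict_chart S c) = snd c"
  by (simp add: restrict_chart_def)

lemma topo_sub_mfd: "topo (sub_mfd M S) = subtopology (topo M) S"
  by (simp add: sub_mfd_def)

lemma points_sub_mfd [simp]: "points (sub_mfd M S) = points M \<inter> S"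
  by (simp add: sub_mfd_def)

lemma atlas_sub_mfdE:
  assumes "e \<in> atlas (sub_mfd M S)"
  obtains c K where "e = restrict_chart S c" "slice_chart M S K c" "fst c \<inter> S \<noteq> {}"
proof -
  from assms obtain c K where "e = (fst c \<inter> S, snd c)" "slice_chart M S K c" "fst c \<inter> S \<noteq> {}"
    unfolding sub_mfd_def mfd.simps mem_Collect_eq by (elim exE conjE)
  then show ?thesis by (intro that[of c K]) (simp_all add: restrict_chart_def)
qed

lemma restrict_chart_in_atlas:
  "slice_chart M S K c \<Longrightarrow> fst c \<inter> S \<noteq> {} \<Longrightarrow> restrict_chart S c \<in> atlas (sub_mfd M S)"
  unfolding sub_mfd_def mfd.simps mem_Collect_eq restrict_chart_def by blast

lemma slice_chartD:
  assumes "slice_chart M S K c"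
  shows "c \<in> maximal_atlas M" "is_chart (topo M) c" "subspace K" "K \<subseteq> model_space c"
    "snd c ` (fst c \<inter> S) = snd c ` fst c \<inter> K"
  using assms maximal_atlas_chart[of c M] by (simp_all add: slice_chart_def)

lemma restrict_chart_inv:
  assumes "is_chart T c" "y \<in> snd c ` (fst c \<inter> S)"
  shows "chart_inv (restrict_chart S c) y = chart_inv c y"
proof -
  obtain x where x: "x \<in> fst c \<inter> S" "y = snd c x" using assms(2) by blast
  have "inj_on (snd c) (fst c \<inter> S)" using chart_inj[OF assms(1)] by (rule inj_on_subset) simp
  then have "chart_inv (restrict_chart S c) y = x"
    using x by (simp add: chart_inv_def inv_into_f_f)
  then show ?thesis using x chart_inv_left[OF assms(1)] by simp
qed

lemma is_chart_restrict:
  assumes s: "slice_chart M S K c" and ne: "fst c \<inter> S \<noteq> {}"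
  shows "is_chart (subtopology (topo M) S) (restrict_chart S c)" "model_space (restrict_chart S c) = K"
proof -
  note c = slice_chartD[OF s]
  have "openin (top_of_set (model_space c)) (snd c ` fst c)" using c(2) by (simp add: is_chart_def)
  then have img: "openin (top_of_set K) (snd c ` (fst c \<inter> S))"
    unfolding c(5) using c(4) by (auto simp: openin_open)
  have op: "openin (subtopology (topo M) S) (fst c \<inter> S)"
    using c(2) by (auto simp: is_chart_def openin_subtopology)
  have cont: "continuous_map (subtopology (subtopology (topo M) S) (fst c \<inter> S)) euclidean (snd c)"
    unfolding subtopology_subtopology
    by (rule continuous_map_from_subtopology_mono[OF chart_continuous[OF c(2)]]) auto
  have inv: "continuous_map (top_of_set (snd c ` (fst c \<inter> S))) (subtopology (topo M) S) (chart_inv c)"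
    unfolding continuous_map_in_subtopology
    using continuous_map_from_subtopology_mono[OF chart_inv_continuous[OF c(2)], of "snd c ` (fst c \<inter> S)"]
      chart_inv_left[OF c(2)] by auto
  note I = is_chartI[OF ne op c(3) img cont inv]
  show "is_chart (subtopology (topo M) S) (restrict_chart S c)" "model_space (restrict_chart S c) = K"
    unfolding restrict_chart_def by (rule I, use chart_inv_left[OF c(2)] in blast)+
qed

lemma smooth_rep_restrict_domain:
  assumes F: "smooth_rep T T' c d F" and c: "is_chart (subtopology T S) (restrict_chart S c)"
  shows "smooth_rep (subtopology T S) T' (restrict_chart S c) d F"
  unfolding smooth_rep_def
proof (intro conjI c smooth_repD(2)[OF F])
  show "continuous_map (subtopology T S) T' F"
    using smooth_repD(3)[OF F] by (rule continuous_map_from_subtopology)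
  show "smooth_on (rep_dom (restrict_chart S c) d F) (rep (restrict_chart S c) d F)"
    using smooth_repD(5)[OF F]
  proof (rule smooth_on_subset_eq)
    show "rep_dom (restrict_chart S c) d F \<subseteq> rep_dom c d F" by (auto simp: rep_dom_def)
    fix y assume "y \<in> rep_dom (restrict_chart S c) d F"
    then have "y \<in> snd c ` (fst c \<inter> S)" by (auto simp: rep_dom_def)
    then show "rep c d F y = rep (restrict_chart S c) d F y"
      by (simp add: rep_def restrict_chart_inv[OF smooth_repD(1)[OF F]])
  qed
qed

lemma smooth_rep_restrict_codomain:
  assumes F: "smooth_rep T T' c d F" and d: "is_chart (subtopology T' S) (restrict_chart S d)"
    and FS: "F ` topspace T \<subseteq> S"
  shows "smooth_rep T (subtopology T' S) c (restrict_chart S d) F"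
  unfolding smooth_rep_def
proof (intro conjI d smooth_repD(1)[OF F])
  show "continuous_map T (subtopology T' S) F"
    using smooth_repD(3)[OF F] FS by (auto simp: continuous_map_in_subtopology)
  show "smooth_on (rep_dom c (restrict_chart S d) F) (rep c (restrict_chart S d) F)"
    using smooth_repD(5)[OF F] by (rule smooth_on_subset_eq) (auto simp: rep_dom_def rep_def)
qed

lemma smooth_atlas_sub_mfd:
  assumes M: "smooth_atlas M" and S: "submanifold M S"
  shows "smooth_atlas (sub_mfd M S)"
proof -
  have chart: "is_chart (topo (sub_mfd M S)) e" if "e \<in> atlas (sub_mfd M S)" for e
    using that is_chart_restrict(1) unfolding topo_sub_mfd by (metis atlas_sub_mfdE)
  have rep: "smooth_rep (topo (sub_mfd M S)) (topo (sub_mfd M S)) e e' (\<lambda>x. x)"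
    if e_in: "e \<in> atlas (sub_mfd M S)" and e'_in: "e' \<in> atlas (sub_mfd M S)" for e e'
  proof -
    obtain c K where e: "e = restrict_chart S c" "slice_chart M S K c" by (rule atlas_sub_mfdE[OF e_in])
    obtain c' K' where e': "e' = restrict_chart S c'" "slice_chart M S K' c'" by (rule atlas_sub_mfdE[OF e'_in])
    have "smooth_rep (subtopology (topo M) S) (topo M) e c' (\<lambda>x. x)"
      unfolding e(1) using chart[OF e_in] e(1)
      by (intro smooth_rep_restrict_domain smooth_rep_id[OF M] slice_chartD(1)[OF e(2)] slice_chartD(1)[OF e'(2)])
        (simp add: topo_sub_mfd)
    then show ?thesis
      unfolding e'(1) topo_sub_mfd using chart[OF e'_in] e'(1)
      by (intro smooth_rep_restrict_codomain) (simp_all add: topo_sub_mfd)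
  qed
  have "(\<Union>e\<in>atlas (sub_mfd M S). fst e) = points (sub_mfd M S)"
  proof
    show "(\<Union>e\<in>atlas (sub_mfd M S). fst e) \<subseteq> points (sub_mfd M S)"
      using chart chart_subset by blast
    show "points (sub_mfd M S) \<subseteq> (\<Union>e\<in>atlas (sub_mfd M S). fst e)"
    proof
      fix x assume x: "x \<in> points (sub_mfd M S)"
      then obtain K c where c: "slice_chart M S K c" "x \<in> fst c"
        using S unfolding submanifold_def by auto
      then show "x \<in> (\<Union>e\<in>atlas (sub_mfd M S). fst e)"
        using x by (intro UN_I[OF restrict_chart_in_atlas[OF c(1)]]) auto
    qed
  qed
  moreover have "compatible e e'" if "e \<in> atlas (sub_mfd M S)" "e' \<in> atlas (sub_mfd M S)" for e e'
    using compatible_smooth_rep[OF chart[OF that(1)] chart[OF that(2)]] rep that by blast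
  ultimately show ?thesis using chart by (simp add: smooth_atlas_def)
qed

lemma smooth_map_inclusion:
  assumes M: "smooth_atlas M"
  shows "smooth_map (sub_mfd M S) M (\<lambda>x. x)"
proof (rule smooth_mapI)
  show "continuous_map (topo (sub_mfd M S)) (topo M) (\<lambda>x. x)"
    using continuous_map_from_subtopology[OF continuous_map_id, of "topo M" S] by (simp add: topo_sub_mfd id_def)
  fix e d assume e: "e \<in> atlas (sub_mfd M S)" and d: "d \<in> atlas M"
  obtain c K where c: "e = restrict_chart S c" "slice_chart M S K c" "fst c \<inter> S \<noteq> {}"
    by (rule atlas_sub_mfdE[OF e])
  show "smooth_rep (topo (sub_mfd M S)) (topo M) e d (\<lambda>x. x)"
    unfolding c(1) topo_sub_mfd
    by (intro smooth_rep_restrict_domain smooth_rep_id[OF M] slice_chartD(1)[OF c(2)]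
        atlas_subset_maximal[OF M d] is_chart_restrict[OF c(2,3)])
qed

text \<open>
  A slice chart and its restriction represent a map into \<open>S\<close> by the same function. Since slice charts
  belong to the maximal atlas of \<open>M\<close>, smoothness into \<open>M\<close> is all that is needed.
\<close>

lemma smooth_map_into_sub_mfd:
  assumes N: "smooth_atlas N" and M: "smooth_atlas M" and F: "smooth_map N M F"
    and FS: "\<And>x. x \<in> points N \<Longrightarrow> F x \<in> S"
  shows "smooth_map N (sub_mfd M S) F"
proof (rule smooth_mapI)
  show "continuous_map (topo N) (topo (sub_mfd M S)) F"
    using smooth_map_continuous[OF F] FS by (auto simp: topo_sub_mfd continuous_map_in_subtopology)
  fix c e assume c: "c \<in> atlas N" and e: "e \<in> atlas (sub_mfd M S)"
  obtain d K where d: "e = restrict_chart S d" "slice_chart M S K d" "fst d \<inter> S \<noteq> {}"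
    by (rule atlas_sub_mfdE[OF e])
  show "smooth_rep (topo N) (topo (sub_mfd M S)) c e F"
    unfolding d(1) topo_sub_mfd using FS
    by (intro smooth_rep_restrict_codomain smooth_map_rep[OF N M F] slice_chartD(1)[OF d(2)]
        atlas_subset_maximal[OF N c] is_chart_restrict[OF d(2,3)]) auto
qed

text \<open>
  The atlas of \<open>sub_mfd M S\<close> consists of all slice charts, whereas \<open>submanifold\<close> fixes the dimension for one
  slice chart around each point only; the others agree with it by \<open>dim_model_space_eq\<close>.
\<close>

lemma smooth_manifold_sub_mfd:
  assumes M: "smooth_manifold M" and S: "submanifold M S"
  shows "smooth_manifold (sub_mfd M S)"
proof -
  have M': "smooth_atlas M" using M by (simp add: smooth_manifold_iff)
  note L = smooth_atlas_sub_mfd[OF M' S]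
  obtain k where k: "\<And>x. x \<in> S \<Longrightarrow> \<exists>K c. slice_chart M S K c \<and> dim K = k \<and> x \<in> fst c"
    using S unfolding submanifold_def by blast
  have "dim (model_space e) = k" if e: "e \<in> atlas (sub_mfd M S)" for e
  proof -
    obtain d K where d: "e = restrict_chart S d" "slice_chart M S K d" "fst d \<inter> S \<noteq> {}"
      by (rule atlas_sub_mfdE[OF e])
    obtain x where x: "x \<in> fst d" "x \<in> S" using d(3) by blast
    obtain K' c where c: "slice_chart M S K' c" "dim K' = k" "x \<in> fst c" using k[OF x(2)] by (elim exE conjE)
    have ne: "fst c \<inter> S \<noteq> {}" using c(3) x(2) by blast
    have "dim (model_space e) = dim (model_space (restrict_chart S c))"
      using x c(3) d(1)
      by (intro dim_model_space_eq[OF L atlas_subset_maximal[OF L e] _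
            atlas_subset_maximal[OF L restrict_chart_in_atlas[OF c(1) ne]], of x]) auto
    then show ?thesis using is_chart_restrict(2)[OF c(1) ne] c(2) by simp
  qed
  then show ?thesis
    using M L unfolding smooth_manifold_iff topo_sub_mfd
    by (auto intro: second_countable_subtopology Hausdorff_space_subtopology)
qed

section \<open>Regular level sets\<close>

text \<open>
  If \<open>G\<close> increases in the direction of the unit vector \<open>e\<close>, then replacing the \<open>e\<close>-coordinate of \<open>y\<close> by
  \<open>G y\<close> is a local diffeomorphism. The inverse function theorem provides the inverse with a first
  derivative. As the inverse of \<open>D \<psi> y\<close> is given explicitly by the derivative of \<open>G\<close> at \<open>y\<close>, the derivative
  of \<open>\<phi>\<close> is a smooth expression in \<open>\<phi>\<close>, and smoothness of \<open>\<phi>\<close> follows by induction on its order.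
\<close>

lemma straighten_function:
  fixes G :: "'e::euclidean_space \<Rightarrow> real" and e :: 'e
  assumes U: "open U" "y0 \<in> U" and G: "\<And>k. Ck_on k U G" and e: "e \<bullet> e = 1"
    and pos: "frechet_derivative G (at y0) e > 0"
  defines "\<psi> \<equiv> \<lambda>y. y + (G y - e \<bullet> y) *\<^sub>R e"
  obtains W W' \<phi> where "open W" "y0 \<in> W" "W \<subseteq> U" "open W'" "\<psi> ` W = W'"
    "\<And>y. y \<in> W \<Longrightarrow> \<phi> (\<psi> y) = y" "\<And>z. z \<in> W' \<Longrightarrow> \<phi> z \<in> W \<and> \<psi> (\<phi> z) = z"
    "\<And>k. Ck_on k W \<psi>" "\<And>k. Ck_on k W' \<phi>"
proof -
  define D where "D = (\<lambda>y. frechet_derivative G (at y))"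
  have DG: "(G has_derivative D y) (at y)" if "y \<in> U" for y
    unfolding D_def using Ck_on_Suc_has_derivative[OF G that] .
  have CD: "Ck_on k U (\<lambda>y. D y w)" for k w
    using G[of "Suc k"] by (simp add: D_def)
  have lin: "linear (D y)" if "y \<in> U" for y using DG[OF that] by (rule has_derivative_linear)
  define U1 where "U1 = U \<inter> (\<lambda>y. D y e) -` {0<..}"
  have contD: "continuous_on U (\<lambda>y. D y w)" for w using CD[of 0 w] by simp
  have U1: "open U1" "y0 \<in> U1" "U1 \<subseteq> U"
    unfolding U1_def using U pos contD[of e] by (auto intro: continuous_open_preimage simp: D_def)
  define h where "h = (\<lambda>y w. D y w - e \<bullet> w)"
  define f' where "f' = (\<lambda>y. Blinfun (\<lambda>w. w + h y w *\<^sub>R e))"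
  have blf: "bounded_linear (\<lambda>w. w + h y w *\<^sub>R e)" if "y \<in> U1" for y
  proof -
    have "bounded_linear (D y)" using lin U1(3) that by (auto simp: linear_conv_bounded_linear)
    then show ?thesis unfolding h_def
      by (intro bounded_linear_add bounded_linear_ident bounded_linear_scaleR_const bounded_linear_sub
          bounded_linear_inner_right)
  qed
  have f'_apply: "blinfun_apply (f' y) w = w + h y w *\<^sub>R e" if "y \<in> U1" for y w
    unfolding f'_def using bounded_linear_Blinfun_apply[OF blf[OF that]] by simp
  have der: "(\<psi> has_derivative blinfun_apply (f' y)) (at y)" if "y \<in> U1" for y
  proof -
    have "(\<psi> has_derivative (\<lambda>w. w + (D y w - e \<bullet> w) *\<^sub>R e)) (at y)"
      unfolding \<psi>_def using U1(3) that
      by (auto intro!: derivative_eq_intros DG)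
    then show ?thesis by (rule has_derivative_eq_rhs) (rule ext, simp add: f'_apply[OF that] h_def)
  qed
  have cont: "continuous_on U1 f'"
  proof (rule continuous_on_blinfun_componentwise)
    fix i :: 'e
    have "continuous_on U1 (\<lambda>y. i + (D y i - e \<bullet> i) *\<^sub>R e)"
      using contD[of i] U1(3) by (intro continuous_intros) (rule continuous_on_subset)
    then show "continuous_on U1 (\<lambda>y. blinfun_apply (f' y) i)"
      by (rule continuous_on_eq) (simp add: f'_apply h_def)
  qed
  define inverse_deriv where "inverse_deriv = (\<lambda>y u. u + (- (h y u * (D y e) powr (-1))) *\<^sub>R e)"
  \<comment> \<open>The derivative of \<open>\<psi>\<close> adds a multiple of \<open>e\<close>, so it can be inverted by hand.\<close>
  have left: "inverse_deriv y (w + h y w *\<^sub>R e) = w" if "y \<in> U1" for y w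
  proof -
    have a: "D y e > 0" "linear (D y)" using that lin U1(3) by (auto simp: U1_def)
    have "h y (w + h y w *\<^sub>R e) = D y e * h y w"
    proof -
      have "D y (w + h y w *\<^sub>R e) = D y w + h y w * D y e"
        using a(2) by (simp add: linear_add linear_cmul)
      then show ?thesis using e by (simp add: h_def inner_add_right algebra_simps)
    qed
    then show ?thesis using a(1) by (simp add: inverse_deriv_def powr_minus)
  qed
  have bl_inv: "bounded_linear (inverse_deriv y0)"
  proof -
    have "bounded_linear (D y0)" using lin U by (auto simp: linear_conv_bounded_linear)
    then show ?thesis unfolding inverse_deriv_def h_def
      by (intro bounded_linear_add bounded_linear_ident bounded_linear_scaleR_const bounded_linear_minus
          bounded_linear_mult_const bounded_linear_sub bounded_linear_inner_right)
  qed
  have "Blinfun (inverse_deriv y0) o\<^sub>L f' y0 = id_blinfun"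
    by (rule blinfun_eqI) (simp add: bounded_linear_Blinfun_apply[OF bl_inv] f'_apply[OF U1(2)] left[OF U1(2)])
  from inverse_function_theorem[OF U1(1) der cont U1(2) this]
  obtain W W' \<phi> g' where W: "open W" "W \<subseteq> U1" "y0 \<in> W" "open W'" "\<psi> y0 \<in> W'"
    and hom: "homeomorphism W W' \<psi> \<phi>"
    and d\<phi>: "\<And>z. z \<in> W' \<Longrightarrow> (\<phi> has_derivative g' z) (at z)"
    and g': "\<And>z. z \<in> W' \<Longrightarrow> g' z = inv (blinfun_apply (f' (\<phi> z)))"
    and bij: "\<And>z. z \<in> W' \<Longrightarrow> bij (blinfun_apply (f' (\<phi> z)))"
    by metis
  have WU: "W \<subseteq> U" using W(2) U1(3) by blast
  have \<phi>W: "\<phi> z \<in> W" if "z \<in> W'" for z using hom that by (auto simp: homeomorphism_def)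
  have g'_eq: "g' z u = inverse_deriv (\<phi> z) u" if "z \<in> W'" for z u
  proof -
    have p: "\<phi> z \<in> U1" using \<phi>W[OF that] W(2) by blast
    have "u \<in> range (blinfun_apply (f' (\<phi> z)))" using bij[OF that] by (simp add: bij_is_surj)
    then obtain w where "u = blinfun_apply (f' (\<phi> z)) w" by blast
    then show ?thesis
      using g'[OF that] left[OF p, of w] f'_apply[OF p, of w] inv_f_f[OF bij_is_inj[OF bij[OF that]], of w]
      by metis
  qed
  have C\<phi>: "Ck_on k W' \<phi>" for k
  proof (induction k)
    case 0 show ?case using hom by (simp add: homeomorphism_def)
  next
    case (Suc k)
    show ?case
    proof (rule Ck_on_SucI[OF _ _ W(4)])
      show "(\<phi> has_derivative inverse_deriv (\<phi> z)) (at z)" if "z \<in> W'" for z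
        using d\<phi>[OF that] by (rule has_derivative_eq_rhs) (rule ext, rule g'_eq[OF that])
      fix u
      have comp: "Ck_on k W' (\<lambda>z. D (\<phi> z) w)" for w
        by (rule Ck_on_compose[OF W(4) CD Suc]) (use \<phi>W WU in blast)
      have "Ck_on k W' (\<lambda>z. 1 * (D (\<phi> z) e) powr (-1))"
        by (rule Ck_on_compose[OF W(4) Ck_on_powr comp]) (use \<phi>W W(2) in \<open>auto simp: U1_def\<close>)
      then have "Ck_on k W' (\<lambda>z. (D (\<phi> z) u + - (e \<bullet> u)) *\<^sub>R ((D (\<phi> z) e) powr (-1)))"
        by (intro Ck_on_scaleR[OF W(4)] Ck_on_add[OF W(4)] comp Ck_on_const) simp
      then have coeff: "Ck_on k W' (\<lambda>z. (-1) *\<^sub>R ((D (\<phi> z) u + - (e \<bullet> u)) *\<^sub>R ((D (\<phi> z) e) powr (-1))))"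
        by (rule Ck_on_scaleR[OF W(4) Ck_on_const])
      show "Ck_on k W' (\<lambda>z. inverse_deriv (\<phi> z) u)"
        using Ck_on_add[OF W(4) Ck_on_const Ck_on_scaleR[OF W(4) coeff Ck_on_const], of u e]
        by (simp only: inverse_deriv_def h_def real_scaleR_def mult_minus1 diff_conv_add_uminus)
    qed
  qed
  have C\<psi>: "Ck_on k W \<psi>" for k
  proof -
    have neg: "Ck_on k W (\<lambda>y. (-1) *\<^sub>R (e \<bullet> y))"
      by (intro Ck_on_bounded_linear bounded_linear_intros)
    have "Ck_on k W (\<lambda>y. y + (G y + (-1) *\<^sub>R (e \<bullet> y)) *\<^sub>R e)"
      by (rule Ck_on_add[OF W(1) Ck_on_bounded_linear[OF bounded_linear_ident]
            Ck_on_scaleR[OF W(1) Ck_on_add[OF W(1) Ck_on_subset[OF G WU] neg] Ck_on_const]])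
    then show ?thesis by (simp add: \<psi>_def)
  qed
  show ?thesis
    using hom W WU \<phi>W by (intro that[OF W(1,3) WU W(4) _ _ _ C\<psi> C\<phi>]) (auto simp: homeomorphism_def)
qed

text \<open>
  A chart may be composed with a diffeomorphism between open sets of the ambient coordinate space,
  provided that the diffeomorphism respects the model space of the chart.
\<close>

lemma recoordinate_chart:
  fixes M :: "('a, 'e::euclidean_space) mfd" and \<psi> \<phi> :: "'e \<Rightarrow> 'e"
  assumes M: "smooth_atlas M" and c: "c \<in> maximal_atlas M"
    and W: "open W" "open W'" "\<psi> ` W = W'"
    and \<phi>\<psi>: "\<And>y. y \<in> W \<Longrightarrow> \<phi> (\<psi> y) = y" and \<psi>\<phi>: "\<And>z. z \<in> W' \<Longrightarrow> \<phi> z \<in> W \<and> \<psi> (\<phi> z) = z"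
    and C: "\<And>k. Ck_on k W \<psi>" "\<And>k. Ck_on k W' \<phi>"
    and \<psi>V: "\<And>y. \<psi> y \<in> model_space c \<longleftrightarrow> y \<in> model_space c"
    and ne: "fst c \<inter> snd c -` W \<noteq> {}"
  shows "(fst c \<inter> snd c -` W, \<lambda>p. \<psi> (snd c p)) \<in> maximal_atlas M" (is "?c \<in> _")
    and "model_space (fst c \<inter> snd c -` W, \<lambda>p. \<psi> (snd c p)) = model_space c"
proof -
  define V where "V = model_space c"
  define S where "S = snd c ` fst c"
  note cc = maximal_atlas_chart[OF c]
  have V: "subspace V" "openin (top_of_set V) S"
    using cc by (auto simp: V_def S_def is_chart_def subspace_model_space)
  define Uc where "Uc = fst c \<inter> snd c -` W"
  define c' where "c' = (Uc, \<lambda>p. \<psi> (snd c p))"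
  have Ucc: "Uc \<subseteq> fst c" by (auto simp: Uc_def)
  have imgS: "snd c ` Uc = S \<inter> W" by (auto simp: Uc_def S_def)
  have img: "snd c' ` fst c' = \<psi> ` (S \<inter> W)" by (simp add: c'_def imgS[symmetric] image_image)
  obtain O' where O': "open O'" "S = V \<inter> O'" using V(2) by (auto simp: openin_open)
  have cont\<phi>: "continuous_on W' \<phi>" using C(2)[of 0] by simp
  have cont\<psi>: "continuous_on W \<psi>" using C(1)[of 0] by simp
  have img': "\<psi> ` (S \<inter> W) = V \<inter> (W' \<inter> \<phi> -` O')"
  proof
    show "\<psi> ` (S \<inter> W) \<subseteq> V \<inter> (W' \<inter> \<phi> -` O')" using O'(2) \<psi>V \<phi>\<psi> W(3) by (auto simp: V_def)
    show "V \<inter> (W' \<inter> \<phi> -` O') \<subseteq> \<psi> ` (S \<inter> W)"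
    proof
      fix z assume z: "z \<in> V \<inter> (W' \<inter> \<phi> -` O')"
      then have "\<phi> z \<in> S \<inter> W" using \<psi>\<phi>[of z] \<psi>V[of "\<phi> z"] O'(2) by (auto simp: V_def)
      then show "z \<in> \<psi> ` (S \<inter> W)" using \<psi>\<phi>[of z] z by (metis IntD1 IntD2 imageI)
    qed
  qed
  have img_open: "openin (top_of_set V) (snd c' ` fst c')"
    unfolding img img' using cont\<phi> W(2) O'(1) by (intro openin_open_Int continuous_open_preimage)
  have Uc_open: "openin (topo M) Uc"
  proof -
    have "openin (subtopology (topo M) (fst c)) {p \<in> topspace (subtopology (topo M) (fst c)). snd c p \<in> W}"
      using chart_continuous[OF cc] W(1) by (auto simp: continuous_map_def)
    moreover have "{p \<in> topspace (subtopology (topo M) (fst c)). snd c p \<in> W} = Uc"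
      using chart_subset[OF cc] by (auto simp: Uc_def)
    ultimately show ?thesis using cc openin_trans_full by (auto simp: is_chart_def)
  qed
  have cont: "continuous_map (subtopology (topo M) Uc) euclidean (\<lambda>p. \<psi> (snd c p))"
  proof -
    have "continuous_map (subtopology (topo M) Uc) (top_of_set W) (snd c)"
      using continuous_map_from_subtopology_mono[OF chart_continuous[OF cc] Ucc]
      by (auto simp: continuous_map_in_subtopology Uc_def)
    from continuous_map_compose[OF this, of euclidean \<psi>] cont\<psi> show ?thesis by (simp add: comp_def)
  qed
  have inv: "continuous_map (top_of_set ((\<lambda>p. \<psi> (snd c p)) ` Uc)) (topo M) (\<lambda>z. chart_inv c (\<phi> z))"
  proof -
    have "(\<lambda>p. \<psi> (snd c p)) ` Uc = \<psi> ` (S \<inter> W)" by (simp add: imgS[symmetric] image_image)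
    moreover have "continuous_map (top_of_set (\<psi> ` (S \<inter> W))) (top_of_set (snd c ` fst c)) \<phi>"
      using cont\<phi> W(3) by (auto simp: continuous_map_in_subtopology S_def \<phi>\<psi> intro: continuous_on_subset)
    ultimately show ?thesis
      using continuous_map_compose[of "top_of_set (\<psi> ` (S \<inter> W))" _ \<phi>, OF _ chart_inv_continuous[OF cc]]
      by (simp add: comp_def)
  qed
  have left: "chart_inv c (\<phi> (\<psi> (snd c p))) = p" if "p \<in> Uc" for p
    using that \<phi>\<psi> chart_inv_left[OF cc] by (auto simp: Uc_def)
  note I = is_chartI[OF _ Uc_open V(1) img_open[unfolded c'_def fst_conv snd_conv] cont inv left]
  have c': "is_chart (topo M) c'" "model_space c' = V"
    using I ne by (auto simp: c'_def Uc_def)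
  have c'_inv: "chart_inv c' (\<psi> (snd c p)) = p" if "p \<in> Uc" for p
    using chart_inv_left[OF c'(1), of p] that by (simp add: c'_def)
  have "c' \<in> maximal_atlas M"
    unfolding maximal_atlas_iff[OF M]
  proof (intro conjI ballI c'(1))
    fix d assume d: "d \<in> atlas M"
    note cd = smooth_rep_id[OF M c atlas_subset_maximal[OF M d]]
      and dc = smooth_rep_id[OF M atlas_subset_maximal[OF M d] c]
    note cm = smooth_map_continuous[OF smooth_map_id[OF M]]
    show "smooth_rep (topo M) (topo M) c' d (\<lambda>x. x)"
      unfolding smooth_rep_def
    proof (intro conjI c'(1) smooth_repD(2)[OF cd] cm)
      have dom: "rep_dom c' d (\<lambda>x. x) = \<psi> ` (snd c ` (Uc \<inter> fst d))"
        by (auto simp: rep_dom_def c'_def)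
      have "smooth_on (rep_dom c' d (\<lambda>x. x)) (rep c d (\<lambda>x. x) \<circ> \<phi>)"
      proof (rule smooth_on_compose[OF smooth_repD(5)[OF cd]])
        show "smooth_on (rep_dom c' d (\<lambda>x. x)) \<phi>"
          by (rule smooth_on_subset[OF smooth_on_openI[OF W(2) C(2)]]) (use W(3) in \<open>auto simp: dom Uc_def\<close>)
        show "\<phi> ` rep_dom c' d (\<lambda>x. x) \<subseteq> rep_dom c d (\<lambda>x. x)"
          using \<phi>\<psi> unfolding dom by (auto simp: Uc_def rep_dom_def)
      qed
      then show "smooth_on (rep_dom c' d (\<lambda>x. x)) (rep c' d (\<lambda>x. x))"
        by (rule smooth_on_eq) (auto simp: dom rep_def c'_inv left)
    qed
    show "smooth_rep (topo M) (topo M) d c' (\<lambda>x. x)"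
      unfolding smooth_rep_def
    proof (intro conjI c'(1) smooth_repD(1)[OF dc] cm)
      have dom: "rep_dom d c' (\<lambda>x. x) = snd d ` (Uc \<inter> fst d)"
        by (auto simp: rep_dom_def c'_def)
      have "smooth_on (rep_dom d c' (\<lambda>x. x)) (\<psi> \<circ> rep d c (\<lambda>x. x))"
      proof (rule smooth_on_compose[OF smooth_on_openI[OF W(1) C(1)]])
        show "smooth_on (rep_dom d c' (\<lambda>x. x)) (rep d c (\<lambda>x. x))"
          by (rule smooth_on_subset[OF smooth_repD(5)[OF dc]]) (auto simp: rep_dom_def c'_def Uc_def)
        show "rep d c (\<lambda>x. x) ` rep_dom d c' (\<lambda>x. x) \<subseteq> W"
          using chart_inv_left[OF smooth_repD(1)[OF dc]] by (auto simp: dom rep_def Uc_def)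
      qed
      then show "smooth_on (rep_dom d c' (\<lambda>x. x)) (rep d c' (\<lambda>x. x))"
        by (rule smooth_on_eq) (simp add: rep_def c'_def)
    qed
  qed
  then show "?c \<in> maximal_atlas M" "model_space ?c = model_space c"
    using c'(2) by (simp_all add: c'_def Uc_def V_def)
qed

text \<open>
  In a chart around a point of the level set, choose \<open>e\<close> in the model space such that the function increases
  along \<open>e\<close>. Replacing the \<open>e\<close>-coordinate by the difference of the function and \<open>l\<close> gives a slice chart, in which
  the level set becomes the orthogonal complement of \<open>e\<close> in the model space.
\<close>

lemma submanifold_regular_level_set:
  assumes M: "smooth_manifold M" and f: "smooth_map M pos_reals f"
    and reg: "\<And>x. x \<in> points M \<Longrightarrow> f x = l \<Longrightarrow> \<exists>X\<in>tangent_space M x. differential M f x X \<noteq> 0"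
  shows "submanifold M (level_set M f l)"
proof -
  define L where "L = level_set M f l"
  have M': "smooth_atlas M" using M by (simp add: smooth_manifold_iff)
  obtain n where n: "\<And>c. c \<in> atlas M \<Longrightarrow> dim (model_space c) = n"
    using M by (auto simp: smooth_manifold_iff)
  have "\<exists>K c'. slice_chart M L K c' \<and> dim K = n - 1 \<and> x \<in> fst c'" if xL: "x \<in> L" for x
  proof -
    have x: "x \<in> points M" "f x = l" using xL by (auto simp: L_def level_set_def)
    obtain c where c: "c \<in> atlas M" "x \<in> fst c" "c \<in> charts_at M x" "c \<in> maximal_atlas M" "is_chart (topo M) c"
      by (rule smooth_atlas_obtain[OF M' x(1)])
    define V where "V = model_space c"
    define S where "S = snd c ` fst c"
    define y0 where "y0 = snd c x"
    have V: "subspace V" "openin (top_of_set V) S" "y0 \<in> S"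
      using c(2,5) by (auto simp: V_def S_def y0_def is_chart_def subspace_model_space)
    define G0 where "G0 = (\<lambda>y. f (chart_inv c y) - l)"
    have smG0: "smooth_on S G0"
      using smooth_on_add[OF smooth_map_pos_realsD[OF M' f c(4)] smooth_on_const[of _ "- l"]]
      by (simp add: S_def G0_def)
    obtain U G where U: "open U" "y0 \<in> U" "\<And>k. Ck_on k U G" "\<And>z. z \<in> S \<Longrightarrow> z \<in> U \<Longrightarrow> G z = G0 z"
      by (rule smooth_onE[OF smG0 V(3)]) (rule that)
    define D where "D = frechet_derivative G (at y0)"
    have DG: "(G has_derivative D) (at y0)" unfolding D_def by (rule Ck_on_Suc_has_derivative[OF U(3) U(2)])
    have dirD: "dir_deriv (f \<circ> chart_inv c) y0 w = D w" if "w \<in> V" for w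
    proof (rule dir_deriv_eq[OF V that])
      have "(G0 has_derivative D) (at y0 within S)"
        using has_derivative_at_withinI[OF DG] by (rule has_derivative_within_eq_on_open) (use U V in auto)
      from has_derivative_add_const[OF this, of l]
      show "(f \<circ> chart_inv c has_derivative D) (at y0 within S)" by (simp add: G0_def comp_def)
    qed
    \<comment> \<open>A unit vector along which the function increases.\<close>
    obtain e where e: "e \<in> V" "e \<bullet> e = 1" "D e > 0"
    proof -
      obtain X where X: "X \<in> tangent_space M x" "differential M f x X \<noteq> 0" using reg[OF x] by blast
      have fx: "f x > 0" using smooth_map_points[OF f x(1)] by simp
      have "tangent_map M pos_reals f x X pos_chart = chart_deriv c pos_chart f x (X c)"
        using fx by (intro tangent_map_chart[OF M' smooth_atlas_pos_reals f X(1) c(3)]) (simp add: charts_at_pos_reals)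
      then have "D (X c) \<noteq> 0"
        using X(2) fx dirD[of "X c"] tangent_space_chart[OF X(1) c(3)]
        by (simp add: differential_eq_tangent_map chart_deriv_def rep_def comp_def y0_def V_def)
      moreover have lin: "linear D" using DG by (rule has_derivative_linear)
      ultimately have ne: "X c \<noteq> 0" by (auto simp: linear_0)
      define a where "a = sgn (D (X c)) / norm (X c)"
      show ?thesis
      proof (rule that[of "a *\<^sub>R X c"])
        show "a *\<^sub>R X c \<in> V" using tangent_space_chart[OF X(1) c(3)] V(1) by (simp add: V_def subspace_scale)
        show "(a *\<^sub>R X c) \<bullet> (a *\<^sub>R X c) = 1"
          using ne \<open>D (X c) \<noteq> 0\<close> by (simp add: a_def dot_square_norm power2_eq_square sgn_if)
        have "D (a *\<^sub>R X c) = \<bar>D (X c)\<bar> / norm (X c)"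
          using lin by (simp add: linear_cmul a_def sgn_if)
        then show "D (a *\<^sub>R X c) > 0" using ne \<open>D (X c) \<noteq> 0\<close> by simp
      qed
    qed
    define \<psi> where "\<psi> = (\<lambda>y. y + (G y - e \<bullet> y) *\<^sub>R e)"
    obtain W W' \<phi> where W: "open W" "y0 \<in> W" "W \<subseteq> U" "open W'" "\<psi> ` W = W'"
      and \<phi>\<psi>: "\<And>y. y \<in> W \<Longrightarrow> \<phi> (\<psi> y) = y" and \<psi>\<phi>: "\<And>z. z \<in> W' \<Longrightarrow> \<phi> z \<in> W \<and> \<psi> (\<phi> z) = z"
      and C: "\<And>k. Ck_on k W \<psi>" "\<And>k. Ck_on k W' \<phi>"
      using straighten_function[OF U(1,2) U(3) e(2) e(3)[unfolded D_def]] unfolding \<psi>_def by blast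
    \<comment> \<open>Both \<open>\<psi>\<close> and its inverse move points along \<open>e \<in> V\<close> only, so they preserve \<open>V\<close>.\<close>
    have \<psi>V: "\<psi> y \<in> V \<longleftrightarrow> y \<in> V" for y
    proof
      assume "\<psi> y \<in> V"
      then have "\<psi> y - (G y - e \<bullet> y) *\<^sub>R e \<in> V" by (intro subspace_diff subspace_scale V(1) e(1))
      then show "y \<in> V" by (simp add: \<psi>_def)
    next
      assume "y \<in> V"
      then show "\<psi> y \<in> V" unfolding \<psi>_def by (intro subspace_add subspace_scale V(1) e(1))
    qed
    have \<psi>e: "e \<bullet> \<psi> y = G y" for y using e(2) by (simp add: \<psi>_def inner_add_right)
    define Uc where "Uc = fst c \<inter> snd c -` W"
    define c' where "c' = (Uc, \<lambda>p. \<psi> (snd c p))"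
    have xUc: "x \<in> Uc" using c(2) W(2) by (simp add: Uc_def y0_def)
    have c': "c' \<in> maximal_atlas M" "model_space c' = V"
      using recoordinate_chart[OF M' c(4) W(1,4,5) \<phi>\<psi> \<psi>\<phi> C \<psi>V[unfolded V_def]] xUc
      by (auto simp: c'_def Uc_def V_def)
    define K where "K = {z \<in> V. \<forall>u\<in>span {e}. orthogonal u z}"
    have K: "K = {z \<in> V. e \<bullet> z = 0}"
      unfolding K_def by (auto simp: span_singleton orthogonal_def intro: span_base)
    have subK: "subspace K" unfolding K using V(1)
      by (auto simp: subspace_def inner_add_right)
    have dimK: "dim K = n - 1"
    proof -
      have "dim K + dim (span {e}) = dim V" unfolding K_def
        using e(1) V(1) by (intro dim_subspace_orthogonal_to_vectors subspace_span span_minimal) auto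
      moreover have "dim (span {e}) = 1" using e(2) by (auto simp: dim_singleton)
      ultimately show ?thesis using n[OF c(1)] by (simp add: V_def)
    qed
    have slice: "snd c' ` (fst c' \<inter> L) = snd c' ` fst c' \<inter> K"
    proof -
      have "p \<in> L \<longleftrightarrow> snd c' p \<in> K" if "p \<in> Uc" for p
      proof -
        have p: "p \<in> points M" "snd c p \<in> S" "snd c p \<in> U" "chart_inv c (snd c p) = p"
          using that chart_subset[OF c(5)] W(3) chart_inv_left[OF c(5)] by (auto simp: Uc_def S_def)
        have "e \<bullet> \<psi> (snd c p) = f p - l" using U(4)[OF p(2,3)] p(4) by (simp add: \<psi>e G0_def)
        moreover have "\<psi> (snd c p) \<in> V" using \<psi>V p(2) openin_imp_subset[OF V(2)] by auto
        ultimately show ?thesis using p(1) by (auto simp: K c'_def L_def level_set_def)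
      qed
      then show ?thesis by (auto simp: c'_def)
    qed
    have "slice_chart M L K c'" using c' subK slice by (auto simp: slice_chart_def K)
    then show ?thesis using dimK xUc by (intro exI[of _ K] exI[of _ c']) (simp add: c'_def)
  qed
  then show ?thesis unfolding submanifold_def L_def[symmetric]
    by (intro conjI exI[of _ "n - 1"]) (auto simp: L_def level_set_def)
qed

section \<open>Symmetric forms and their index\<close>

text \<open>
  Symmetry and bilinearity are only required on \<open>V\<close>, since nothing is known about the value of a tensor in
  coordinates off the model space.
\<close>

definition sym_form :: "'e::euclidean_space set \<Rightarrow> ('e \<Rightarrow> 'e \<Rightarrow> real) \<Rightarrow> bool" where
  "sym_form V B \<longleftrightarrow> (\<forall>u\<in>V. \<forall>w\<in>V. B u w = B w u \<and>
     (\<forall>z\<in>V. \<forall>a b. B (a *\<^sub>R u + b *\<^sub>R w) z = a * B u z + b * B w z))"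

definition negative_subspace :: "'e::euclidean_space set \<Rightarrow> ('e \<Rightarrow> 'e \<Rightarrow> real) \<Rightarrow> 'e set \<Rightarrow> bool" where
  "negative_subspace V B S \<longleftrightarrow> subspace S \<and> S \<subseteq> V \<and> (\<forall>w\<in>S - {0}. B w w < 0)"

definition neg_index :: "'e::euclidean_space set \<Rightarrow> ('e \<Rightarrow> 'e \<Rightarrow> real) \<Rightarrow> nat" where
  "neg_index V B = Max {dim S |S. negative_subspace V B S}"

lemma sym_formD:
  assumes "sym_form V B" "u \<in> V" "w \<in> V"
  shows "B u w = B w u"
    and "z \<in> V \<Longrightarrow> B (a *\<^sub>R u + b *\<^sub>R w) z = a * B u z + b * B w z"
  using assms unfolding sym_form_def by blast+

lemma sym_form_sum:
  assumes B: "sym_form V B" "subspace V" "finite I" "\<And>i. i \<in> I \<Longrightarrow> u i \<in> V" "z \<in> V"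
  shows "B (\<Sum>i\<in>I. a i *\<^sub>R u i) z = (\<Sum>i\<in>I. a i * B (u i) z)"
  using assms(3,4)
proof (induction I)
  case empty
  have "B (0 *\<^sub>R z + 0 *\<^sub>R z) z = 0 * B z z + 0 * B z z" using sym_formD(2)[OF B(1,5,5,5)] .
  then show ?case by simp
next
  case (insert i I)
  have "(\<Sum>i\<in>I. a i *\<^sub>R u i) \<in> V"
    using insert by (intro subspace_sum subspace_scale B(2)) auto
  then have "B (a i *\<^sub>R u i + 1 *\<^sub>R (\<Sum>i\<in>I. a i *\<^sub>R u i)) z = a i * B (u i) z + 1 * B (\<Sum>i\<in>I. a i *\<^sub>R u i) z"
    using insert.prems by (intro sym_formD(2)[OF B(1) _ _ B(5)]) auto
  then show ?case using insert by simp
qed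

lemma negative_subspace_dims:
  "finite {dim S |S. negative_subspace V B S}" "{dim S |S. negative_subspace V B S} \<noteq> {}"
  if "subspace V"
proof -
  have "{dim S |S. negative_subspace V B S} \<subseteq> {..dim V}"
    by (auto simp: negative_subspace_def dim_subset)
  then show "finite {dim S |S. negative_subspace V B S}" by (rule finite_subset) simp
  have "negative_subspace V B {0}" using that by (auto simp: negative_subspace_def subspace_0)
  then show "{dim S |S. negative_subspace V B S} \<noteq> {}" by blast
qed

lemma neg_index_ge: "subspace V \<Longrightarrow> negative_subspace V B S \<Longrightarrow> dim S \<le> neg_index V B"
  unfolding neg_index_def by (rule Max_ge[OF negative_subspace_dims(1)]) auto

lemma neg_index_obtain:
  assumes "subspace V"
  obtains S where "negative_subspace V B S" "dim S = neg_index V B"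
  using Max_in[OF negative_subspace_dims[OF assms], of B] unfolding neg_index_def by auto

lemma neg_index_le:
  assumes "subspace V" "\<And>S. negative_subspace V B S \<Longrightarrow> dim S \<le> n"
  shows "neg_index V B \<le> n"
  using neg_index_obtain[OF assms(1), of B] assms(2) by metis

lemma neg_index_cong:
  assumes "\<And>w. w \<in> V \<Longrightarrow> B w w < 0 \<longleftrightarrow> B' w w < 0"
  shows "neg_index V B = neg_index V B'"
proof -
  have "negative_subspace V B S = negative_subspace V B' S" for S
    using assms by (auto simp: negative_subspace_def subset_iff)
  then show ?thesis by (simp add: neg_index_def)
qed

text \<open>
  Negative definite subspaces correspond under images in one direction and under preimages in the other.
\<close>

lemma neg_index_iso:
  fixes A :: "'e::euclidean_space \<Rightarrow> 'f::euclidean_space"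
  assumes A: "linear A" "inj_on A V" and V: "subspace V"
    and B: "\<And>w. w \<in> V \<Longrightarrow> B' (A w) (A w) = B w w"
  shows "neg_index (A ` V) B' = neg_index V B"
proof (rule antisym)
  have V': "subspace (A ` V)" using A V by (simp add: linear_subspace_image)
  have A0: "A 0 = 0" using A(1) by (rule linear_0)
  show "neg_index V B \<le> neg_index (A ` V) B'"
  proof (rule neg_index_le[OF V])
    fix S assume S: "negative_subspace V B S"
    have "negative_subspace (A ` V) B' (A ` S)"
      unfolding negative_subspace_def
    proof (intro conjI ballI)
      show "subspace (A ` S)" using S A by (simp add: negative_subspace_def linear_subspace_image)
      show "A ` S \<subseteq> A ` V" using S by (auto simp: negative_subspace_def)
      fix z assume "z \<in> A ` S - {0}"
      then obtain w where "w \<in> S" "z = A w" "w \<noteq> 0" using A0 by auto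
      then show "B' z z < 0" using S B by (auto simp: negative_subspace_def subset_iff)
    qed
    moreover have "dim (A ` S) = dim S"
      using S A by (intro dim_linear_image_eq) (auto simp: negative_subspace_def intro: inj_on_subset)
    ultimately show "dim S \<le> neg_index (A ` V) B'" using neg_index_ge[OF V'] by metis
  qed
  show "neg_index (A ` V) B' \<le> neg_index V B"
  proof (rule neg_index_le[OF V'])
    fix S' assume S': "negative_subspace (A ` V) B' S'"
    define S where "S = {w \<in> V. A w \<in> S'}"
    have "subspace S"
      using V S' A(1) unfolding S_def negative_subspace_def
      by (auto simp: subspace_def linear_0 linear_add linear_cmul)
    moreover have "B w w < 0" if "w \<in> S - {0}" for w
    proof -
      have w: "w \<in> V" "A w \<in> S'" "w \<noteq> 0" using that by (auto simp: S_def)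
      then have "A w \<noteq> A 0" using A(2) V by (metis inj_onD subspace_0)
      then have "A w \<in> S' - {0}" using w(2) A0 by simp
      then have "B' (A w) (A w) < 0" using S' unfolding negative_subspace_def by blast
      then show ?thesis using B[OF w(1)] by simp
    qed
    ultimately have "negative_subspace V B S" by (auto simp: negative_subspace_def S_def)
    moreover have "A ` S = S'" using S' by (auto simp: S_def negative_subspace_def)
    then have "dim S' = dim S"
      using dim_linear_image_eq[OF A(1) _ \<open>subspace S\<close>] A(2) by (metis (no_types, lifting) S_def inj_on_subset mem_Collect_eq subsetI)
    ultimately show "dim S' \<le> neg_index V B" using neg_index_ge[OF V] by metis
  qed
qed

text \<open>
  Splitting off an orthogonal line. A negative definite subspace \<open>S\<close> that is not contained in \<open>W\<close> is
  spanned by \<open>S \<inter> W\<close> and one further vector \<open>s = a p + w\<close>. If \<open>p\<close> is positive, then replacing \<open>s\<close> by \<open>w\<close> keeps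
  the span negative definite; if \<open>p\<close> is negative, then it can be added to any negative subspace of \<open>W\<close>.
\<close>

lemma
  assumes B: "sym_form V B" and V: "subspace V" and W: "subspace W" "W \<subseteq> V" and p: "p \<in> V"
    and orth: "\<And>w. w \<in> W \<Longrightarrow> B p w = 0"
    and split: "\<And>v. v \<in> V \<Longrightarrow> \<exists>a. \<exists>w\<in>W. v = a *\<^sub>R p + w"
  shows neg_index_split_pos: "B p p > 0 \<Longrightarrow> neg_index V B = neg_index W B"
    and neg_index_split_neg: "B p p < 0 \<Longrightarrow> neg_index V B = Suc (neg_index W B)"
proof -
  have pyth: "B (a *\<^sub>R p + w) (a *\<^sub>R p + w) = a\<^sup>2 * B p p + B w w" if w: "w \<in> W" for a w
  proof -
    have wV: "w \<in> V" using w W by blast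
    have lin: "B (a *\<^sub>R p + 1 *\<^sub>R w) z = a * B p z + 1 * B w z" if "z \<in> V" for z
      by (rule sym_formD(2)[OF B p wV that])
    have z: "a *\<^sub>R p + w \<in> V" by (intro subspace_add subspace_scale V p wV)
    have "B p (a *\<^sub>R p + w) = a * B p p" "B w (a *\<^sub>R p + w) = B w w"
      using sym_formD(1)[OF B p z] sym_formD(1)[OF B wV z] lin[OF p] lin[OF wV] orth[OF w]
        sym_formD(1)[OF B wV p] by auto
    then show ?thesis using lin[OF z] by (simp add: power2_eq_square)
  qed
  have ge: "negative_subspace V B S" if "negative_subspace W B S" for S
    using that W by (auto simp: negative_subspace_def)
  have pW: "p \<notin> W" if "B p p \<noteq> 0" using orth that by blast
  have bound: "\<exists>s0 a0 w0. s0 \<in> S \<and> a0 \<noteq> 0 \<and> w0 \<in> W \<and> s0 = a0 *\<^sub>R p + w0 \<and> dim S \<le> Suc (dim (S \<inter> W))"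
    if S: "subspace S" "S \<subseteq> V" "\<not> S \<subseteq> W" for S
  proof -
    obtain s0 where s0: "s0 \<in> S" "s0 \<notin> W" using S by blast
    obtain a0 w0 where s0_eq: "w0 \<in> W" "s0 = a0 *\<^sub>R p + w0" using split S(2) s0(1) by blast
    have a0: "a0 \<noteq> 0" using s0 s0_eq by auto
    have "S \<subseteq> span (insert s0 (S \<inter> W))"
    proof
      fix v assume v: "v \<in> S"
      obtain a w where vw: "w \<in> W" "v = a *\<^sub>R p + w" using split S(2) v by blast
      have "v - (a / a0) *\<^sub>R s0 = w - (a / a0) *\<^sub>R w0"
        using a0 by (simp add: vw(2) s0_eq(2) algebra_simps)
      moreover have "w - (a / a0) *\<^sub>R w0 \<in> W" by (intro subspace_diff subspace_scale W vw s0_eq)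
      moreover have "v - (a / a0) *\<^sub>R s0 \<in> S" by (intro subspace_diff subspace_scale S v s0)
      ultimately have "v - (a / a0) *\<^sub>R s0 \<in> S \<inter> W" by simp
      then have "(a / a0) *\<^sub>R s0 + (v - (a / a0) *\<^sub>R s0) \<in> span (insert s0 (S \<inter> W))"
        by (intro span_add span_scale) (auto intro: span_base)
      then show "v \<in> span (insert s0 (S \<inter> W))" by simp
    qed
    then have "dim S \<le> dim (insert s0 (S \<inter> W))" by (metis dim_span dim_subset)
    also have "\<dots> \<le> Suc (dim (S \<inter> W))" by (simp add: dim_insert)
    finally show ?thesis using s0(1) a0 s0_eq by blast
  qed
  show "neg_index V B = neg_index W B" if pos: "B p p > 0"
  proof (rule antisym)
    show "neg_index W B \<le> neg_index V B"
      using ge by (intro neg_index_le[OF W(1)] neg_index_ge[OF V])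
    show "neg_index V B \<le> neg_index W B"
    proof (rule neg_index_le[OF V])
      fix S assume S: "negative_subspace V B S"
      then have S': "subspace S" "S \<subseteq> V" "\<And>w. w \<in> S \<Longrightarrow> w \<noteq> 0 \<Longrightarrow> B w w < 0"
        by (auto simp: negative_subspace_def)
      show "dim S \<le> neg_index W B"
      proof (cases "S \<subseteq> W")
        case True
        then have "negative_subspace W B S" using S by (simp add: negative_subspace_def)
        then show ?thesis by (rule neg_index_ge[OF W(1)])
      next
        case False
        obtain s0 a0 w0 where s0: "s0 \<in> S" "a0 \<noteq> 0" "w0 \<in> W" "s0 = a0 *\<^sub>R p + w0" "dim S \<le> Suc (dim (S \<inter> W))"
          using bound[OF S'(1,2) False] by (elim exE conjE)
        have SW: "subspace (S \<inter> W)" using S'(1) W(1) by (rule subspace_inter)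
        have "w0 \<notin> S"
        proof
          assume "w0 \<in> S"
          then have "s0 - w0 \<in> S" by (intro subspace_diff S' s0(1))
          then have ap: "a0 *\<^sub>R p + 0 \<in> S" using s0(4) by simp
          have "p \<noteq> 0" using pW pos W(1) subspace_0 by fastforce
          then have "a0 *\<^sub>R p + 0 \<noteq> 0" using s0(2) by simp
          then have "B (a0 *\<^sub>R p + 0) (a0 *\<^sub>R p + 0) < 0" using S'(3)[OF ap] by blast
          moreover have "B (a0 *\<^sub>R p + 0) (a0 *\<^sub>R p + 0) = a0\<^sup>2 * B p p + B 0 0"
            by (rule pyth[OF subspace_0[OF W(1)]])
          moreover have "B (0 *\<^sub>R p + 0) (0 *\<^sub>R p + 0) = 0\<^sup>2 * B p p + B 0 0"
            by (rule pyth[OF subspace_0[OF W(1)]])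
          moreover have "B (0 *\<^sub>R p + 0 *\<^sub>R p) 0 = 0 * B p 0 + 0 * B p 0"
            by (rule sym_formD(2)[OF B p p subspace_0[OF V]])
          ultimately show False using pos s0(2) by (simp add: mult_less_0_iff)
        qed
        then have "w0 \<notin> span (S \<inter> W)" unfolding span_eq_iff[THEN iffD2, OF SW] by simp
        then have dim: "dim (span (insert w0 (S \<inter> W))) = Suc (dim (S \<inter> W))"
          by (simp add: dim_insert)
        have "negative_subspace W B (span (insert w0 (S \<inter> W)))"
          unfolding negative_subspace_def
        proof (intro conjI ballI subspace_span)
          show "span (insert w0 (S \<inter> W)) \<subseteq> W" using s0(3) by (intro span_minimal W(1)) auto
          fix z assume z: "z \<in> span (insert w0 (S \<inter> W)) - {0}"
          then obtain k where "z - k *\<^sub>R w0 \<in> span (S \<inter> W)" by (auto simp: span_breakdown_eq)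
          then have u: "z - k *\<^sub>R w0 \<in> S \<inter> W" using span_eq_iff[THEN iffD2, OF SW] by simp
          have "(z - k *\<^sub>R w0) + k *\<^sub>R w0 \<in> W"
            using u s0(3) by (intro subspace_add subspace_scale W(1)) auto
          then have zW: "z \<in> W" by simp
          have "k *\<^sub>R s0 + (z - k *\<^sub>R w0) \<in> S" using u by (intro subspace_add subspace_scale S' s0(1)) auto
          moreover have eq: "k *\<^sub>R s0 + (z - k *\<^sub>R w0) = (k * a0) *\<^sub>R p + z" by (simp add: s0(4) algebra_simps)
          moreover have "(k * a0) *\<^sub>R p + z \<noteq> 0"
          proof
            assume 0: "(k * a0) *\<^sub>R p + z = 0"
            then have "(k * a0) *\<^sub>R p = - z" by (simp add: eq_neg_iff_add_eq_0)
            then have kp: "(k * a0) *\<^sub>R p \<in> W" using subspace_neg[OF W(1) zW] by simp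
            have "k * a0 = 0"
            proof (rule ccontr)
              assume ne: "k * a0 \<noteq> 0"
              have "inverse (k * a0) *\<^sub>R ((k * a0) *\<^sub>R p) \<in> W" by (rule subspace_scale[OF W(1) kp])
              moreover have "inverse (k * a0) *\<^sub>R ((k * a0) *\<^sub>R p) = p"
                unfolding scaleR_scaleR left_inverse[OF ne] by simp
              ultimately show False using pW pos by simp
            qed
            then show False using 0 z by auto
          qed
          ultimately have "B ((k * a0) *\<^sub>R p + z) ((k * a0) *\<^sub>R p + z) < 0" using S'(3) by metis
          then have "(k * a0)\<^sup>2 * B p p + B z z < 0" using pyth[OF zW] by simp
          moreover have "(k * a0)\<^sup>2 * B p p \<ge> 0" using pos by simp
          ultimately show "B z z < 0" by linarith
        qed
        then have "Suc (dim (S \<inter> W)) \<le> neg_index W B" using neg_index_ge[OF W(1)] dim by metis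
        then show ?thesis using s0(5) by simp
      qed
    qed
  qed
  show "neg_index V B = Suc (neg_index W B)" if neg: "B p p < 0"
  proof (rule antisym)
    show "neg_index V B \<le> Suc (neg_index W B)"
    proof (rule neg_index_le[OF V])
      fix S assume S: "negative_subspace V B S"
      then have "negative_subspace W B (S \<inter> W)"
        using W(1) by (auto simp: negative_subspace_def subspace_inter)
      then have le: "dim (S \<inter> W) \<le> neg_index W B" by (rule neg_index_ge[OF W(1)])
      show "dim S \<le> Suc (neg_index W B)"
      proof (cases "S \<subseteq> W")
        case True then show ?thesis using le by (simp add: Int_absorb2)
      next
        case False
        then have "dim S \<le> Suc (dim (S \<inter> W))" using bound S unfolding negative_subspace_def by blast
        then show ?thesis using le by simp
      qed
    qed
    obtain S where S: "negative_subspace W B S" "dim S = neg_index W B" by (rule neg_index_obtain[OF W(1)])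
    have S': "subspace S" "S \<subseteq> W" using S(1) by (auto simp: negative_subspace_def)
    have "negative_subspace V B (span (insert p S))"
      unfolding negative_subspace_def
    proof (intro conjI ballI subspace_span)
      show "span (insert p S) \<subseteq> V" using S' W p by (intro span_minimal V) auto
      fix z assume z: "z \<in> span (insert p S) - {0}"
      then obtain k where "z - k *\<^sub>R p \<in> span S" by (auto simp: span_breakdown_eq)
      then have u: "z - k *\<^sub>R p \<in> S" using span_eq_iff[THEN iffD2, OF S'(1)] by simp
      have "B (k *\<^sub>R p + (z - k *\<^sub>R p)) (k *\<^sub>R p + (z - k *\<^sub>R p)) = k\<^sup>2 * B p p + B (z - k *\<^sub>R p) (z - k *\<^sub>R p)"
        using u S'(2) by (intro pyth) auto
      then have eq: "B z z = k\<^sup>2 * B p p + B (z - k *\<^sub>R p) (z - k *\<^sub>R p)" by simp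
      show "B z z < 0"
      proof (cases "z - k *\<^sub>R p = 0")
        case True
        then have "k \<noteq> 0" using z by auto
        have "B (0 *\<^sub>R p + 0 *\<^sub>R p) 0 = 0 * B p 0 + 0 * B p 0"
          by (rule sym_formD(2)[OF B p p subspace_0[OF V]])
        then show ?thesis using eq True neg \<open>k \<noteq> 0\<close> by (simp add: mult_pos_neg)
      next
        case False
        then have "B (z - k *\<^sub>R p) (z - k *\<^sub>R p) < 0" using S(1) u by (auto simp: negative_subspace_def)
        moreover have "k\<^sup>2 * B p p \<le> 0" using neg by (simp add: mult_nonneg_nonpos)
        ultimately show ?thesis using eq by linarith
      qed
    qed
    moreover have "dim (span (insert p S)) = Suc (dim S)"
    proof -
      have "p \<notin> span S" unfolding span_eq_iff[THEN iffD2, OF S'(1)] using pW neg S'(2) by auto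
      then show ?thesis by (simp add: dim_insert)
    qed
    ultimately show "Suc (neg_index W B) \<le> neg_index V B" using neg_index_ge[OF V] S(2) by metis
  qed
qed

section \<open>Tensors and their pullbacks\<close>

text \<open>
  The matrix of \<open>g\<close> at \<open>x\<close> in the chart \<open>c\<close>, as a form on the model space.
\<close>

definition coord_form ::
  "('a, 'e::euclidean_space) mfd \<Rightarrow> ('a, 'e) tensor2 \<Rightarrow> ('a, 'e) chart \<Rightarrow> 'a \<Rightarrow> 'e \<Rightarrow> 'e \<Rightarrow> real" where
  "coord_form M g c x u w = g x (coord_vec M c x u) (coord_vec M c x w)"

lemma index_eq_neg_index: "index M g c x = neg_index (model_space c) (coord_form M g c x)"
  by (simp add: index_def neg_index_def negative_subspace_def coord_form_def)

lemma smooth_tensor_iff: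
  "smooth_tensor M g \<longleftrightarrow> (\<forall>c\<in>atlas M. \<forall>w\<in>model_space c. \<forall>w'\<in>model_space c.
     smooth_on (snd c ` fst c) (\<lambda>y. coord_form M g c (chart_inv c y) w w'))"
  by (simp add: smooth_tensor_def coord_form_def Let_def)

lemma symmetric_bilinearD:
  assumes "symmetric_bilinear M g" "x \<in> points M" "X \<in> tangent_space M x" "Y \<in> tangent_space M x"
  shows "g x X Y = g x Y X"
    and "Z \<in> tangent_space M x \<Longrightarrow> g x (\<lambda>c. a *\<^sub>R X c + b *\<^sub>R Y c) Z = a * g x X Z + b * g x Y Z"
  using assms unfolding symmetric_bilinear_def by blast+

lemma symmetric_bilinear_right:
  assumes "smooth_atlas M" "symmetric_bilinear M g" "x \<in> points M"
    "X \<in> tangent_space M x" "Y \<in> tangent_space M x" "Z \<in> tangent_space M x"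
  shows "g x Z (\<lambda>c. a *\<^sub>R X c + b *\<^sub>R Y c) = a * g x Z X + b * g x Z Y"
proof -
  note XY = tangent_space_lincomb[OF assms(1,3-5), of a b]
  show ?thesis
    unfolding symmetric_bilinearD(1)[OF assms(2,3,6) XY] symmetric_bilinearD(1)[OF assms(2,3,6,4)]
      symmetric_bilinearD(1)[OF assms(2,3,6,5)]
    by (rule symmetric_bilinearD(2)[OF assms(2-6)])
qed

lemma pseudo_riemannian_metricI:
  assumes "symmetric_bilinear M g" "smooth_tensor M g" "nondegenerate M g"
    and "\<And>c x. c \<in> atlas M \<Longrightarrow> x \<in> fst c \<Longrightarrow> index M g c x = \<nu>"
  shows "pseudo_riemannian_metric M g"
  using assms unfolding pseudo_riemannian_metric_def by (intro conjI exI[of _ \<nu>] ballI)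

lemma pseudo_riemannian_metricE:
  assumes "pseudo_riemannian_metric M g"
  obtains \<nu> where "symmetric_bilinear M g" "smooth_tensor M g" "nondegenerate M g"
    "\<And>c x. c \<in> atlas M \<Longrightarrow> x \<in> fst c \<Longrightarrow> index M g c x = \<nu>"
proof -
  from assms obtain \<nu> where "\<forall>c\<in>atlas M. \<forall>x\<in>fst c. index M g c x = \<nu>"
    unfolding pseudo_riemannian_metric_def by (elim conjE exE)
  with assms show ?thesis by (intro that[of \<nu>]) (auto simp: pseudo_riemannian_metric_def)
qed

lemma nondegenerateD:
  "nondegenerate M g \<Longrightarrow> x \<in> points M \<Longrightarrow> X \<in> tangent_space M x \<Longrightarrow>
    (\<And>Y. Y \<in> tangent_space M x \<Longrightarrow> g x X Y = 0) \<Longrightarrow> X = (\<lambda>_. 0)"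
  by (simp add: nondegenerate_def)

lemma sym_form_coord_form:
  assumes M: "smooth_atlas M" and g: "symmetric_bilinear M g" and c: "c \<in> maximal_atlas M" "x \<in> fst c"
  shows "sym_form (model_space c) (coord_form M g c x)"
proof -
  have x: "x \<in> points M" using c chart_subset[OF maximal_atlas_chart] by blast
  note T = coord_vec_tangent[OF M c]
  show ?thesis unfolding sym_form_def coord_form_def
  proof (intro ballI conjI allI)
    fix u w z and a b :: real
    assume uw: "u \<in> model_space c" "w \<in> model_space c"
    show "g x (coord_vec M c x u) (coord_vec M c x w) = g x (coord_vec M c x w) (coord_vec M c x u)"
      by (rule symmetric_bilinearD(1)[OF g x T[OF uw(1)] T[OF uw(2)]])
    assume "z \<in> model_space c"
    from symmetric_bilinearD(2)[OF g x T[OF uw(1)] T[OF uw(2)] T[OF this]]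
    show "g x (coord_vec M c x (a *\<^sub>R u + b *\<^sub>R w)) (coord_vec M c x z) =
        a * g x (coord_vec M c x u) (coord_vec M c x z) + b * g x (coord_vec M c x w) (coord_vec M c x z)"
      by (simp only: coord_vec_linear[OF M c uw])
  qed
qed

lemma tangent_map_of_coord_vec:
  assumes N: "smooth_atlas N" and M: "smooth_atlas M" and F: "smooth_map N M F"
    and c: "c \<in> charts_at N x" and d: "d \<in> charts_at M (F x)" and w: "w \<in> model_space c"
  shows "tangent_map N M F x (coord_vec N c x w) = coord_vec M d (F x) (chart_deriv c d F x w)"
  using tangent_map_coord_vec[OF N M F coord_vec_tangent[OF N charts_at_maximal[OF N c] charts_at_in[OF c] w] c d]
    coord_vec_chart[OF N c w] by simp

lemma coord_form_pullback:
  assumes "smooth_atlas N" "smooth_atlas M" "smooth_map N M F"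
    "c \<in> charts_at N x" "d \<in> charts_at M (F x)" "u \<in> model_space c" "w \<in> model_space c"
  shows "coord_form N (pullback N M F h) c x u w =
    coord_form M h d (F x) (chart_deriv c d F x u) (chart_deriv c d F x w)"
  by (simp add: coord_form_def pullback_def tangent_map_of_coord_vec[OF assms(1-5)] assms(6,7))

lemma symmetric_bilinear_pullback:
  assumes N: "smooth_atlas N" and M: "smooth_atlas M" and F: "smooth_map N M F" and h: "symmetric_bilinear M h"
  shows "symmetric_bilinear N (pullback N M F h)"
  unfolding symmetric_bilinear_def pullback_def
  using symmetric_bilinearD[OF h] smooth_map_points[OF F] tangent_map_in[OF N M F]
  by (simp add: tangent_map_linear[OF N M F])

text \<open>
  In charts, the components of a pullback are obtained from those of the tensor by contracting with the
  derivatives of the map, expanded in an orthonormal basis of the model space.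
\<close>

lemma smooth_tensor_pullback:
  assumes N: "smooth_atlas N" and M: "smooth_atlas M" and F: "smooth_map N M F"
    and h: "symmetric_bilinear M h" "smooth_tensor M h"
  shows "smooth_tensor N (pullback N M F h)"
  unfolding smooth_tensor_iff
proof (intro ballI smooth_onI_local)
  fix c w w' y assume c: "c \<in> atlas N" and w: "w \<in> model_space c" "w' \<in> model_space c" and "y \<in> snd c ` fst c"
  then obtain x where x: "x \<in> fst c" "y = snd c x" by blast
  note cc = smooth_atlas_chart[OF N c] and cm = atlas_subset_maximal[OF N c]
  have "x \<in> points N" using chart_subset[OF cc] x by blast
  then obtain d where d: "d \<in> atlas M" "F x \<in> fst d" "d \<in> maximal_atlas M" "is_chart (topo M) d"
    using smooth_atlas_obtain[OF M smooth_map_points[OF F]] by metis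
  note r = smooth_map_rep[OF N M F cm d(3)]
  note r' = smooth_repD[OF r]
  obtain U where U: "open U" "rep_dom c d F = model_space c \<inter> U"
    using r'(4) unfolding openin_open by blast
  obtain E where E: "E \<subseteq> model_space d" "pairwise orthogonal E" "\<And>b. b \<in> E \<Longrightarrow> norm b = 1"
      "independent E" "span E = model_space d"
    using orthonormal_basis_subspace[OF subspace_model_space[of d]] by metis
  have finE: "finite E" using E(4) by (rule independent_imp_finite)
  define D where "D = (\<lambda>w y. dir_deriv (rep c d F) y w)"
  have smD: "smooth_on (rep_dom c d F) (\<lambda>y. b \<bullet> D w y)" if "w \<in> model_space c" for w b
    using smooth_on_compose[OF smooth_on_bounded_linear[OF bounded_linear_inner_right[of b]]
        smooth_on_dir_deriv[OF subspace_model_space r'(4) that r'(5)] subset_UNIV]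
    by (simp add: D_def comp_def)
  have smh: "smooth_on (rep_dom c d F) (\<lambda>y. coord_form M h d (chart_inv d (rep c d F y)) b b')"
    if "b \<in> E" "b' \<in> E" for b b'
  proof -
    have "smooth_on (snd d ` fst d) (\<lambda>z. coord_form M h d (chart_inv d z) b b')"
      using h(2) d(1) that E(1) by (auto simp: smooth_tensor_iff)
    from smooth_on_compose[OF this r'(5,6)] show ?thesis by (simp add: comp_def)
  qed
  have "smooth_on (rep_dom c d F)
      (\<lambda>y. \<Sum>b\<in>E. \<Sum>b'\<in>E. (b \<bullet> D w y) * ((b' \<bullet> D w' y) * coord_form M h d (chart_inv d (rep c d F y)) b b'))"
    by (intro smooth_on_sum smooth_on_mult smD w smh)
  then have "smooth_on (rep_dom c d F) (\<lambda>y. coord_form N (pullback N M F h) c (chart_inv c y) w w')"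
  proof (rule smooth_on_eq)
    fix z assume "z \<in> rep_dom c d F"
    then obtain q where q: "q \<in> fst c" "F q \<in> fst d" "z = snd c q" "chart_inv c z = q"
      using cc by (rule rep_domE)
    have cq: "c \<in> charts_at N q" "d \<in> charts_at M (F q)" using c d q by (auto simp: charts_at_def)
    have q': "chart_inv d (rep c d F z) = F q" using q by (simp add: rep_def chart_inv_left[OF d(4)])
    have Dw: "chart_deriv c d F q u = D u z" for u using q by (simp add: chart_deriv_def D_def)
    have DV: "D u z \<in> model_space d" if "u \<in> model_space c" for u
      using chart_deriv_in[OF r q(1,2) that] Dw by simp
    have exp: "(\<Sum>b\<in>E. (b \<bullet> u) *\<^sub>R b) = u" if "u \<in> model_space d" for u
      using orthonormal_basis_expand[OF E(2,3) _ finE, of u] that E(5) by (simp add: inner_commute)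
    note B = sym_form_coord_form[OF M h(1) d(3) q(2)]
    note S = sym_form_sum[OF B subspace_model_space finE, of "\<lambda>b. b"]
    have left: "coord_form M h d (F q) u u' = (\<Sum>b\<in>E. (b \<bullet> u) * coord_form M h d (F q) b u')"
      if "u \<in> model_space d" "u' \<in> model_space d" for u u'
      using S[of u' "\<lambda>b. b \<bullet> u"] E(1) that exp[of u] by (simp add: subset_iff)
    have "coord_form M h d (F q) (D w z) (D w' z) =
        (\<Sum>b\<in>E. (b \<bullet> D w z) * (\<Sum>b'\<in>E. (b' \<bullet> D w' z) * coord_form M h d (F q) b b'))"
    proof (subst left[OF DV[OF w(1)] DV[OF w(2)]], rule sum.cong[OF refl])
      fix b assume b: "b \<in> E"
      have "coord_form M h d (F q) b (D w' z) = coord_form M h d (F q) (D w' z) b"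
        using b E(1) DV[OF w(2)] by (intro sym_formD(1)[OF B]) auto
      also have "\<dots> = (\<Sum>b'\<in>E. (b' \<bullet> D w' z) * coord_form M h d (F q) b' b)"
        using b E(1) DV[OF w(2)] by (intro left) auto
      also have "\<dots> = (\<Sum>b'\<in>E. (b' \<bullet> D w' z) * coord_form M h d (F q) b b')"
        using b E(1) sym_formD(1)[OF B] by (intro sum.cong refl arg_cong2[where f = "(*)"]) (auto simp: subset_iff)
      finally show "(b \<bullet> D w z) * coord_form M h d (F q) b (D w' z) =
          (b \<bullet> D w z) * (\<Sum>b'\<in>E. (b' \<bullet> D w' z) * coord_form M h d (F q) b b')" by simp
    qed
    then show "(\<Sum>b\<in>E. \<Sum>b'\<in>E. (b \<bullet> D w z) * ((b' \<bullet> D w' z) * coord_form M h d (chart_inv d (rep c d F z)) b b'))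
        = coord_form N (pullback N M F h) c (chart_inv c z) w w'"
      unfolding q(4) coord_form_pullback[OF N M F cq w] Dw q' by (simp add: sum_distrib_left)
  qed
  then have "smooth_on (snd c ` fst c \<inter> U) (\<lambda>y. coord_form N (pullback N M F h) c (chart_inv c y) w w')"
    by (rule smooth_on_subset) (use U(2) chart_image_subset[of c] in auto)
  moreover have "y \<in> U" using rep_domI[of x c F d] x d(2) U(2) by auto
  ultimately show "\<exists>U. open U \<and> y \<in> U \<and>
      smooth_on (snd c ` fst c \<inter> U) (\<lambda>y. coord_form N (pullback N M F h) c (chart_inv c y) w w')"
    using U(1) by blast
qed

lemma tangent_map_zero:
  assumes "smooth_atlas M" "smooth_atlas N" "smooth_map M N F" "x \<in> points M"
  shows "tangent_map M N F x (\<lambda>_. 0) = (\<lambda>_. 0)"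
  using tangent_map_linear[OF assms zero_tangent[OF assms(1,4)] zero_tangent[OF assms(1,4)], of 0 0] by simp

lemma tangent_map_left_inverse:
  assumes M: "smooth_atlas M" and N: "smooth_atlas N" and F: "smooth_map M N F" and G: "smooth_map N M G"
    and GF: "\<And>x. x \<in> points M \<Longrightarrow> G (F x) = x" and x: "x \<in> points M" and X: "X \<in> tangent_space M x"
  shows "tangent_map N M G (F x) (tangent_map M N F x X) = X"
proof -
  have "tangent_map N M G (F x) (tangent_map M N F x X) = tangent_map M M (\<lambda>x. G (F x)) x X"
    by (rule tangent_map_compose[OF M N M F G x X, symmetric])
  also have "\<dots> = tangent_map M M (\<lambda>x. x) x X"
    by (rule tangent_map_cong[OF M M smooth_map_compose[OF M N M F G] x X GF])
  also have "\<dots> = X" by (rule tangent_map_id[OF M x X])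
  finally show ?thesis .
qed

text \<open>
  All conditions on a metric concern tangent vectors only, so tensors that agree on these can be exchanged.
\<close>

lemma pseudo_riemannian_metric_cong:
  assumes M: "smooth_atlas M" and g: "pseudo_riemannian_metric M g"
    and eq: "\<And>x X Y. x \<in> points M \<Longrightarrow> X \<in> tangent_space M x \<Longrightarrow> Y \<in> tangent_space M x \<Longrightarrow> g x X Y = g' x X Y"
  shows "pseudo_riemannian_metric M g'"
proof -
  obtain \<nu> where g': "symmetric_bilinear M g" "smooth_tensor M g" "nondegenerate M g"
    "\<And>c x. c \<in> atlas M \<Longrightarrow> x \<in> fst c \<Longrightarrow> index M g c x = \<nu>"
    by (rule pseudo_riemannian_metricE[OF g]) (rule that)
  have form: "coord_form M g c x u w = coord_form M g' c x u w"
    if "c \<in> atlas M" "x \<in> fst c" "u \<in> model_space c" "w \<in> model_space c" for c x u w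
    unfolding coord_form_def using that chart_subset[OF smooth_atlas_chart[OF M that(1)]]
    by (intro eq coord_vec_tangent[OF M atlas_subset_maximal[OF M]]) auto
  show ?thesis
  proof (rule pseudo_riemannian_metricI)
    show "symmetric_bilinear M g'"
      unfolding symmetric_bilinear_def
    proof (intro ballI conjI allI)
      fix x X Y Z and a b :: real
      assume T: "x \<in> points M" "X \<in> tangent_space M x" "Y \<in> tangent_space M x"
      show "g' x X Y = g' x Y X"
        using symmetric_bilinearD(1)[OF g'(1) T] eq[OF T] eq[OF T(1,3,2)] by simp
      assume Z: "Z \<in> tangent_space M x"
      show "g' x (\<lambda>c. a *\<^sub>R X c + b *\<^sub>R Y c) Z = a * g' x X Z + b * g' x Y Z"
        using symmetric_bilinearD(2)[OF g'(1) T Z] eq[OF T(1,2) Z] eq[OF T(1,3) Z]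
          eq[OF T(1) tangent_space_lincomb[OF M T] Z] by simp
    qed
    show "smooth_tensor M g'"
      unfolding smooth_tensor_iff
    proof (intro ballI)
      fix c w w' assume c: "c \<in> atlas M" "w \<in> model_space c" "w' \<in> model_space c"
      then have "smooth_on (snd c ` fst c) (\<lambda>y. coord_form M g c (chart_inv c y) w w')"
        using g'(2) by (simp add: smooth_tensor_iff)
      then show "smooth_on (snd c ` fst c) (\<lambda>y. coord_form M g' c (chart_inv c y) w w')"
        by (rule smooth_on_eq) (simp add: form[OF c(1) chart_inv_in c(2,3)])
    qed
    show "nondegenerate M g'"
      unfolding nondegenerate_def using eq by (auto intro!: nondegenerateD[OF g'(3)])
    show "index M g' c x = \<nu>" if "c \<in> atlas M" "x \<in> fst c" for c x
    proof -
      have "neg_index (model_space c) (coord_form M g c x) = neg_index (model_space c) (coord_form M g' c x)"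
        by (rule neg_index_cong) (simp add: form[OF that])
      then show ?thesis using g'(4)[OF that] by (simp add: index_eq_neg_index)
    qed
  qed
qed

text \<open>
  A diffeomorphism maps tangent spaces isomorphically, which preserves nondegeneracy, and its derivative in
  charts is an isomorphism of the forms in coordinates, which preserves the index.
\<close>

lemma pseudo_riemannian_metric_pullback_diffeo:
  assumes N: "smooth_atlas N" and M: "smooth_atlas M" and F: "smooth_map N M F" and G: "smooth_map M N G"
    and GF: "\<And>x. x \<in> points N \<Longrightarrow> G (F x) = x" and FG: "\<And>y. y \<in> points M \<Longrightarrow> F (G y) = y"
    and h: "pseudo_riemannian_metric M h"
  shows "pseudo_riemannian_metric N (pullback N M F h)"
proof -
  obtain \<nu> where h': "symmetric_bilinear M h" "smooth_tensor M h" "nondegenerate M h"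
    and \<nu>: "\<And>c x. c \<in> atlas M \<Longrightarrow> x \<in> fst c \<Longrightarrow> index M h c x = \<nu>"
    by (rule pseudo_riemannian_metricE[OF h]) (rule that)
  have nondeg: "nondegenerate N (pullback N M F h)"
    unfolding nondegenerate_def
  proof (intro ballI impI)
    fix x X assume x: "x \<in> points N" and X: "X \<in> tangent_space N x"
      and zero: "\<forall>Y\<in>tangent_space N x. pullback N M F h x X Y = 0"
    note Fx = smooth_map_points[OF F x] and TX = tangent_map_in[OF N M F x X]
    have "h (F x) (tangent_map N M F x X) Z = 0" if Z: "Z \<in> tangent_space M (F x)" for Z
    proof -
      have "tangent_map M N G (F x) Z \<in> tangent_space N x"
        using tangent_map_in[OF M N G Fx Z] GF[OF x] by simp
      moreover have "tangent_map N M F x (tangent_map M N G (F x) Z) = Z"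
        using tangent_map_left_inverse[OF M N G F FG Fx Z] GF[OF x] by simp
      ultimately show ?thesis using zero by (metis pullback_def)
    qed
    then have "tangent_map N M F x X = (\<lambda>_. 0)"
      by (rule nondegenerateD[OF h'(3) Fx TX])
    then show "X = (\<lambda>_. 0)"
      using tangent_map_left_inverse[OF N M F G GF x X] tangent_map_zero[OF M N G Fx] by simp
  qed
  have index: "index N (pullback N M F h) c x = \<nu>" if c: "c \<in> atlas N" "x \<in> fst c" for c x
  proof -
    note cm = atlas_subset_maximal[OF N c(1)]
    have cx: "c \<in> charts_at N x" using c by (simp add: charts_at_def)
    have x: "x \<in> points N" using chart_subset[OF smooth_atlas_chart[OF N c(1)]] c(2) by blast
    obtain d where d: "d \<in> atlas M" "F x \<in> fst d" "d \<in> charts_at M (F x)" "d \<in> maximal_atlas M"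
      using smooth_atlas_obtain[OF M smooth_map_points[OF F x]] by metis
    obtain D where D: "linear D" "\<And>w. w \<in> model_space c \<Longrightarrow> chart_deriv c d F x w = D w"
        "inj_on D (model_space c)" "D ` model_space c = model_space d"
      by (rule model_space_iso[OF N M F G GF FG cm c(2) d(4,2)]) (assumption, assumption, rule that)
    have "neg_index (D ` model_space c) (coord_form M h d (F x)) =
        neg_index (model_space c) (coord_form N (pullback N M F h) c x)"
      using D(2) coord_form_pullback[OF N M F cx d(3)] by (intro neg_index_iso D(1,3) subspace_model_space) simp
    then show ?thesis using \<nu>[OF d(1,2)] D(4) by (simp add: index_eq_neg_index)
  qed
  show ?thesis
    by (rule pseudo_riemannian_metricI[OF symmetric_bilinear_pullback[OF N M F h'(1)]
          smooth_tensor_pullback[OF N M F h'(1,2)] nondeg index])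
qed

lemma pseudo_riemannian_metric_conformal:
  assumes M: "smooth_atlas M" and g: "pseudo_riemannian_metric M g" and u: "smooth_map M pos_reals u"
  shows "pseudo_riemannian_metric M (\<lambda>x X Y. u x * g x X Y)"
proof -
  have pos: "u x > 0" if "x \<in> points M" for x using smooth_map_points[OF u that] by simp
  have form: "coord_form M (\<lambda>x X Y. u x * g x X Y) c x = (\<lambda>w w'. u x * coord_form M g c x w w')" for c x
    by (intro ext) (simp add: coord_form_def)
  obtain \<nu> where g': "symmetric_bilinear M g" "smooth_tensor M g" "nondegenerate M g"
    and \<nu>: "\<And>c x. c \<in> atlas M \<Longrightarrow> x \<in> fst c \<Longrightarrow> index M g c x = \<nu>"
    by (rule pseudo_riemannian_metricE[OF g]) (rule that)
  have sym: "symmetric_bilinear M (\<lambda>x X Y. u x * g x X Y)"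
    unfolding symmetric_bilinear_def
  proof (intro ballI conjI allI)
    fix x X Y Z and a b :: real
    assume T: "x \<in> points M" "X \<in> tangent_space M x" "Y \<in> tangent_space M x"
    show "u x * g x X Y = u x * g x Y X" using symmetric_bilinearD(1)[OF g'(1) T] by simp
    assume "Z \<in> tangent_space M x"
    from symmetric_bilinearD(2)[OF g'(1) T this]
    show "u x * g x (\<lambda>c. a *\<^sub>R X c + b *\<^sub>R Y c) Z = a * (u x * g x X Z) + b * (u x * g x Y Z)"
      by (simp add: distrib_left mult.left_commute)
  qed
  have smooth: "smooth_tensor M (\<lambda>x X Y. u x * g x X Y)"
    unfolding smooth_tensor_iff form
    using g'(2) smooth_map_pos_realsD[OF M u atlas_subset_maximal[OF M]]
    by (auto simp: smooth_tensor_iff intro!: smooth_on_mult)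
  have nondeg: "nondegenerate M (\<lambda>x X Y. u x * g x X Y)"
    unfolding nondegenerate_def
  proof (intro ballI impI)
    fix x X assume x: "x \<in> points M" and X: "X \<in> tangent_space M x"
      and 0: "\<forall>Y\<in>tangent_space M x. u x * g x X Y = 0"
    then show "X = (\<lambda>_. 0)" using pos[OF x] by (intro nondegenerateD[OF g'(3) x X]) simp
  qed
  have index: "index M (\<lambda>x X Y. u x * g x X Y) c x = \<nu>" if "c \<in> atlas M" "x \<in> fst c" for c x
  proof -
    have "u x > 0" using pos chart_subset[OF smooth_atlas_chart[OF M that(1)]] that(2) by blast
    then have "neg_index (model_space c) (\<lambda>w w'. u x * coord_form M g c x w w') = neg_index (model_space c) (coord_form M g c x)"
      by (intro neg_index_cong) (simp add: mult_less_0_iff)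
    then show ?thesis using \<nu>[OF that] by (simp add: index_eq_neg_index form)
  qed
  show ?thesis by (rule pseudo_riemannian_metricI[OF sym smooth nondeg index])
qed

section \<open>The level sets of a homogeneous pair\<close>

text \<open>
  The component in \<open>pos_chart\<close> identifies tangent vectors of the half-line with real numbers; the differential of
  a power is then multiplication by the usual derivative.
\<close>

lemma tangent_map_powr:
  assumes c: "c > 0" and r: "r > 0" and X: "X \<in> tangent_space pos_reals r"
  shows "tangent_map pos_reals pos_reals (\<lambda>r. c * r powr b) r X pos_chart = c * b * r powr (b - 1) * X pos_chart"
proof -
  define F where "F = (\<lambda>r::real. c * r powr b)"
  have F: "smooth_map pos_reals pos_reals F" using smooth_map_powr[OF c] by (simp add: F_def)
  have Fr: "F r > 0" using c r by (simp add: F_def)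
  have "tangent_map pos_reals pos_reals F r X pos_chart = chart_deriv pos_chart pos_chart F r (X pos_chart)"
    using r Fr by (intro tangent_map_chart[OF smooth_atlas_pos_reals smooth_atlas_pos_reals F X])
      (simp_all add: charts_at_pos_reals)
  also have "\<dots> = c * b * r powr (b - 1) * X pos_chart"
    unfolding chart_deriv_def
  proof (rule dir_deriv_eq[OF subspace_UNIV, of "{0<..}"])
    have "(F has_real_derivative c * (b * r powr (b - 1))) (at r)"
      unfolding F_def using r by (intro DERIV_cmult has_real_derivative_powr)
    then have "(F has_derivative (\<lambda>w. c * b * r powr (b - 1) * w)) (at r)"
      by (rule has_derivative_eq_rhs[OF has_field_derivative_imp_has_derivative]) (auto simp: mult_ac)
    then have "(F has_derivative (\<lambda>w. c * b * r powr (b - 1) * w)) (at r within {0<..})"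
      by (rule has_derivative_at_withinI)
    then have "(rep pos_chart pos_chart F has_derivative (\<lambda>w. c * b * r powr (b - 1) * w)) (at r within {0<..})"
      by (rule has_derivative_within_eq_on_open[of _ _ _ _ UNIV]) (use r in \<open>auto simp: rep_pos\<close>)
    then show "(rep pos_chart pos_chart F has_derivative (\<lambda>w. c * b * r powr (b - 1) * w))
        (at (snd pos_chart r) within {0<..})" by simp
  qed (use r in auto)
  finally show ?thesis by (simp add: F_def)
qed

lemma tangent_map_constant:
  assumes M: "smooth_atlas M" and u: "smooth_map M pos_reals u" and x: "x \<in> points M" and X: "X \<in> tangent_space M x"
    and const: "\<And>y. y \<in> points M \<Longrightarrow> u y = k"
  shows "tangent_map M pos_reals u x X pos_chart = 0"
proof -
  obtain c where c: "c \<in> charts_at M x" "is_chart (topo M) c" using smooth_atlas_obtain[OF M x] by blast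
  have p: "pos_chart \<in> charts_at pos_reals (u x)"
    using smooth_map_points[OF u x] by (simp add: charts_at_pos_reals)
  have "tangent_map M pos_reals u x X pos_chart = chart_deriv c pos_chart u x (X c)"
    by (rule tangent_map_chart[OF M smooth_atlas_pos_reals u X c(1) p])
  also have "\<dots> = 0"
  proof (rule chart_deriv_affine[OF c(2) is_chart_pos smooth_map_continuous[OF u] charts_at_in[OF c(1)]
        charts_at_in[OF p] tangent_space_chart[OF X c(1)] bounded_linear_zero])
    show "rep c pos_chart u y = 0 + k" if "y \<in> rep_dom c pos_chart u" for y
      using that const chart_subset[OF c(2)] chart_inv_left[OF c(2)] by (auto simp: rep_def rep_dom_def)
  qed
  finally show ?thesis .
qed

locale homogeneous_level =
  fixes M :: "('a, 'e::euclidean_space) mfd"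
    and g :: "('a, 'e) tensor2"
    and m :: "real \<Rightarrow> 'a \<Rightarrow> 'a"
    and f :: "'a \<Rightarrow> real"
    and \<alpha> l :: real
  assumes mfd: "pseudo_riemannian_manifold M g"
    and action: "free_smooth_action M m"
    and f: "smooth_map M pos_reals f"
    and \<alpha>: "\<alpha> \<noteq> 0"
    and pair: "homogeneous_pair M m \<alpha> g f"
    and l: "l > 0"
begin

abbreviation "P \<equiv> generator M m"
abbreviation "L \<equiv> sub_mfd M (level_set M f l)"
abbreviation "R \<equiv> pos_reals"
abbreviation "N \<equiv> prod_mfd R L"

lemma manifold: "smooth_manifold M" and metric: "pseudo_riemannian_metric M g"
  using mfd by (simp_all add: pseudo_riemannian_manifold_def)

lemma atlas: "smooth_atlas M"
  using manifold by (simp add: smooth_manifold_iff)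

lemma sym: "symmetric_bilinear M g" and tensor: "smooth_tensor M g" and nondeg: "nondegenerate M g"
  using metric by (simp_all add: pseudo_riemannian_metric_def)

lemma act_one: "x \<in> points M \<Longrightarrow> m 1 x = x"
  and act_mult: "a > 0 \<Longrightarrow> b > 0 \<Longrightarrow> x \<in> points M \<Longrightarrow> m a (m b x) = m (a * b) x"
  using action by (simp_all add: free_smooth_action_def)

lemma f_pos: "x \<in> points M \<Longrightarrow> f x > 0"
  using smooth_map_points[OF f] by simp

lemma smooth_map_act:
  assumes Q: "smooth_atlas Q" and u: "smooth_map Q R u" and F: "smooth_map Q M F"
  shows "smooth_map Q M (\<lambda>q. m (u q) (F q))"
proof -
  have "smooth_map (prod_mfd R M) M (\<lambda>(a, x). m a x)"
    using action by (simp add: free_smooth_action_def)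
  from smooth_map_compose[OF Q smooth_atlas_prod[OF smooth_atlas_pos_reals atlas] atlas
      smooth_map_Pair[OF Q smooth_atlas_pos_reals atlas u F] this]
  show ?thesis by simp
qed

lemma smooth_map_act_fixed: "a > 0 \<Longrightarrow> smooth_map M M (m a)"
  using smooth_map_act[OF atlas smooth_map_const[OF atlas smooth_atlas_pos_reals, of a] smooth_map_id[OF atlas]] by simp

lemma smooth_map_orbit: "x \<in> points M \<Longrightarrow> smooth_map R M (\<lambda>a. m a x)"
  using smooth_map_act[OF smooth_atlas_pos_reals smooth_map_id[OF smooth_atlas_pos_reals]
      smooth_map_const[OF smooth_atlas_pos_reals atlas]] by simp

lemma act_in: "a > 0 \<Longrightarrow> x \<in> points M \<Longrightarrow> m a x \<in> points M"
  using smooth_map_points[OF smooth_map_act_fixed] by blast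

lemma tangent_act_one:
  assumes x: "x \<in> points M" and X: "X \<in> tangent_space M x"
  shows "tangent_map M M (m 1) x X = X"
  using tangent_map_cong[OF atlas atlas smooth_map_act_fixed[of 1] x X, of "\<lambda>x. x"] act_one
    tangent_map_id[OF atlas x X] by simp

lemma f_act: "a > 0 \<Longrightarrow> x \<in> points M \<Longrightarrow> f (m a x) = a powr \<alpha> * f x"
  using pair by (simp add: homogeneous_pair_def)

lemma g_act:
  "a > 0 \<Longrightarrow> x \<in> points M \<Longrightarrow> X \<in> tangent_space M x \<Longrightarrow> Y \<in> tangent_space M x \<Longrightarrow>
    g (m a x) (tangent_map M M (m a) x X) (tangent_map M M (m a) x Y) = a powr \<alpha> * g x X Y"
  using pair by (simp add: homogeneous_pair_def pullback_def)

definition "E = coord_vec R pos_chart 1 (1::real)"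

lemma pos_chart_maximal: "pos_chart \<in> maximal_atlas R"
  by (simp add: atlas_subset_maximal[OF smooth_atlas_pos_reals] atlas_pos_reals)

lemma E_tangent: "E \<in> tangent_space R 1"
  unfolding E_def by (rule coord_vec_tangent[OF smooth_atlas_pos_reals pos_chart_maximal]) (simp_all add: model_space_pos)

lemma E_pos: "E pos_chart = 1"
  unfolding E_def by (rule coord_vec_chart[OF smooth_atlas_pos_reals]) (simp_all add: model_space_pos charts_at_pos_reals)

text \<open>
  The generator is the velocity of the orbit in the parameter \<open>t\<close> with \<open>a = exp t\<close>, and \<open>exp\<close> has derivative \<open>1\<close> at \<open>0\<close>.
  In this form, facts about the generator are instances of the functoriality of \<open>tangent_map\<close>.
\<close>

lemma generator_eq:
  assumes x: "x \<in> points M"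
  shows "P x = tangent_map R M (\<lambda>a. m a x) 1 E"
proof
  note o = smooth_map_orbit[OF x]
  fix d
  show "P x d = tangent_map R M (\<lambda>a. m a x) 1 E d"
  proof (cases "d \<in> charts_at M x")
    case False
    then show ?thesis using act_one[OF x] by (simp add: generator_def velocity_def tangent_map_def Let_def)
  next
    case d: True
    define h where "h = rep pos_chart d (\<lambda>a. m a x)"
    define S where "S = rep_dom pos_chart d (\<lambda>a. m a x)"
    have d1: "d \<in> charts_at M (m 1 x)" using d act_one[OF x] by simp
    note reps = smooth_repD[OF smooth_map_rep[OF smooth_atlas_pos_reals atlas o pos_chart_maximal charts_at_maximal[OF atlas d]]]
    have "openin (top_of_set UNIV) S" using reps(4) unfolding S_def model_space_pos .
    then have S: "open S" "1 \<in> S"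
      using charts_at_in[OF d1] by (simp_all add: S_def rep_dom_pos)
    have "smooth_on S h" using reps(5) by (simp add: S_def h_def)
    then obtain D where "(h has_derivative D) (at 1 within S)"
      using S(2) by (rule smooth_on_has_derivative)
    then have D: "(h has_derivative D) (at 1)" unfolding at_within_open[OF S(2,1)] .
    have "tangent_map R M (\<lambda>a. m a x) 1 E d = chart_deriv pos_chart d (\<lambda>a. m a x) 1 1"
      using tangent_map_chart[OF smooth_atlas_pos_reals atlas o E_tangent _ d1, of pos_chart]
      by (simp add: charts_at_pos_reals E_pos)
    also have "\<dots> = D 1"
      unfolding chart_deriv_def h_def[symmetric] using D
      by (intro dir_deriv_eq[OF subspace_UNIV, of UNIV]) auto
    also have "\<dots> = vector_derivative (\<lambda>t. snd d (m (exp t) x)) (at 0)"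
    proof (rule vector_derivative_at[symmetric])
      have ex: "(exp has_derivative (\<lambda>t. t)) (at (0::real))"
        by (rule has_derivative_eq_rhs[OF has_field_derivative_imp_has_derivative[OF DERIV_exp]]) auto
      have "(h has_derivative D) (at (exp 0))" using D by simp
      from has_derivative_compose[OF ex this]
      have "((\<lambda>t. h (exp t)) has_derivative D) (at 0)" .
      moreover have "D = (\<lambda>t. t *\<^sub>R D 1)"
      proof
        show "D t = t *\<^sub>R D 1" for t
          using linear_cmul[OF has_derivative_linear[OF D], of t 1] by simp
      qed
      ultimately have "((\<lambda>t. h (exp t)) has_vector_derivative D 1) (at 0)"
        unfolding has_vector_derivative_def by metis
      moreover have "h (exp t) = snd d (m (exp t) x)" for t by (simp add: h_def rep_pos)
      ultimately show "((\<lambda>t. snd d (m (exp t) x)) has_vector_derivative D 1) (at 0)" by simp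
    qed
    also have "\<dots> = P x d"
      using d act_one[OF x] by (simp add: generator_def velocity_def)
    finally show ?thesis by simp
  qed
qed

lemma generator_tangent: "x \<in> points M \<Longrightarrow> P x \<in> tangent_space M x"
  using tangent_map_in[OF smooth_atlas_pos_reals atlas smooth_map_orbit _ E_tangent] act_one generator_eq by simp

abbreviation "df x X \<equiv> tangent_map M R f x X pos_chart"

lemma g_generator: "x \<in> points M \<Longrightarrow> X \<in> tangent_space M x \<Longrightarrow> g x (P x) X = df x X"
  using pair differential_eq_tangent_map[where f = f, OF f_pos] by (simp add: homogeneous_pair_def)

lemma df_compose:
  assumes Q: "smooth_atlas Q" and F: "smooth_map Q M F" and q: "q \<in> points Q" and X: "X \<in> tangent_space Q q"
  shows "df (F q) (tangent_map Q M F q X) = tangent_map Q R (\<lambda>q. f (F q)) q X pos_chart"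
  using tangent_map_compose[OF Q atlas smooth_atlas_pos_reals F f q X] by simp

text \<open>
  Along the orbit of \<open>x\<close>, the function \<open>f\<close> is \<open>a \<mapsto> f x * a powr \<alpha>\<close>.
\<close>

lemma df_generator:
  assumes x: "x \<in> points M"
  shows "df x (P x) = \<alpha> * f x"
proof -
  note o = smooth_map_orbit[OF x] and R = smooth_atlas_pos_reals
  have "df (m 1 x) (tangent_map R M (\<lambda>a. m a x) 1 E) = tangent_map R R (\<lambda>a. f (m a x)) 1 E pos_chart"
    by (rule df_compose[OF R o _ E_tangent]) simp
  also have "\<dots> = tangent_map R R (\<lambda>a. f x * a powr \<alpha>) 1 E pos_chart"
    by (subst tangent_map_cong[OF R R smooth_map_compose[OF R atlas R o f] _ E_tangent]) (use f_act x in auto)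
  also have "\<dots> = \<alpha> * f x"
    by (simp add: tangent_map_powr[OF f_pos[OF x] _ E_tangent] E_pos)
  finally show ?thesis using act_one[OF x] generator_eq[OF x] by simp
qed

text \<open>
  All values of \<open>f\<close> are regular: its derivative along the generator is \<open>\<alpha> * f x \<noteq> 0\<close>.
\<close>

lemma level_submanifold: "submanifold M (level_set M f l)"
proof (rule submanifold_regular_level_set[OF manifold f])
  fix x assume x: "x \<in> points M"
  have "differential M f x (P x) = \<alpha> * f x"
    using differential_eq_tangent_map[where f = f, OF f_pos[OF x]] df_generator[OF x] by metis
  then show "\<exists>X\<in>tangent_space M x. differential M f x X \<noteq> 0"
    using generator_tangent[OF x] \<alpha> f_pos[OF x] by (intro bexI[of _ "P x"]) auto
qed

lemma atlas_L: "smooth_atlas L"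
  by (rule smooth_atlas_sub_mfd[OF atlas level_submanifold])

lemma atlas_N: "smooth_atlas N"
  by (rule smooth_atlas_prod[OF smooth_atlas_pos_reals atlas_L])

lemma points_L: "x \<in> points L \<longleftrightarrow> x \<in> points M \<and> f x = l"
  by (auto simp: level_set_def)

lemma inclusion: "smooth_map L M (\<lambda>x. x)"
  by (rule smooth_map_inclusion[OF atlas])

abbreviation "T\<iota> \<equiv> tangent_map L M (\<lambda>x. x)"

text \<open>
  By homogeneity, \<open>m (\<beta> r)\<close> carries the level \<open>l\<close> to the level \<open>r\<close>, and \<open>m (\<gamma> s)\<close> carries the level \<open>s\<close> back to \<open>l\<close>:
  these are \<open>(r / l) powr (1 / \<alpha>)\<close> and \<open>(l / s) powr (1 / \<alpha>)\<close>, written as multiples of a power of the variable.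
\<close>

definition "\<beta> r = (1 / l) powr (1 / \<alpha>) * r powr (1 / \<alpha>)"
definition "\<gamma> s = l powr (1 / \<alpha>) * s powr (- 1 / \<alpha>)"

lemma \<beta>_pos: "r > 0 \<Longrightarrow> \<beta> r > 0" and \<gamma>_pos: "r > 0 \<Longrightarrow> \<gamma> r > 0"
  using l by (simp_all add: \<beta>_def \<gamma>_def)

lemma \<beta>_powr: "r > 0 \<Longrightarrow> \<beta> r powr \<alpha> = r / l"
  using l \<alpha> by (simp add: \<beta>_def powr_mult powr_powr powr_divide)

lemma \<beta>_\<gamma>: "r > 0 \<Longrightarrow> \<beta> r * \<gamma> r = 1"
  using l \<alpha> by (simp add: \<beta>_def \<gamma>_def powr_divide powr_minus_divide)

lemma \<gamma>_powr: "r > 0 \<Longrightarrow> \<gamma> r powr \<alpha> = l / r"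
proof -
  assume r: "r > 0"
  have "(l powr (1 / \<alpha>) * r powr (- 1 / \<alpha>)) powr \<alpha> = l powr (1 / \<alpha> * \<alpha>) * r powr (- 1 / \<alpha> * \<alpha>)"
    by (simp add: powr_mult powr_powr)
  then show ?thesis using l r \<alpha> by (simp add: \<gamma>_def powr_minus_divide)
qed

lemma smooth_\<beta>: "smooth_map R R \<beta>" and smooth_\<gamma>: "smooth_map R R \<gamma>"
  unfolding \<beta>_def \<gamma>_def using l by (intro smooth_map_powr; simp)+

text \<open>
  The candidate isometry \<open>\<Phi>\<close> and its inverse \<open>\<Psi>\<close>, whose second component \<open>\<pi>\<close> is the projection to the level set
  along the orbits.
\<close>

definition "\<Phi> p = m (\<beta> (fst p)) (snd p)"
definition "\<pi> y = m (\<gamma> (f y)) y"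
definition "\<Psi> y = (f y, \<pi> y)"

lemma smooth_\<Phi>: "smooth_map N M \<Phi>"
proof -
  note R = smooth_atlas_pos_reals
  have "smooth_map N M (\<lambda>p. m (\<beta> (fst p)) (snd p))"
    by (intro smooth_map_act[OF atlas_N] smooth_map_compose[OF atlas_N R R smooth_map_fst[OF R atlas_L] smooth_\<beta>]
        smooth_map_compose[OF atlas_N atlas_L atlas smooth_map_snd[OF R atlas_L] inclusion])
  then show ?thesis by (simp add: \<Phi>_def[abs_def])
qed

lemma \<pi>_level: "y \<in> points M \<Longrightarrow> \<pi> y \<in> points L"
  using act_in[OF \<gamma>_pos[OF f_pos]] f_act[OF \<gamma>_pos[OF f_pos]] f_pos[of y]
  by (simp add: points_L \<pi>_def \<gamma>_powr del: points_sub_mfd)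

lemma smooth_\<pi>: "smooth_map M L \<pi>"
proof (rule smooth_map_into_sub_mfd[OF atlas atlas])
  note R = smooth_atlas_pos_reals
  show "smooth_map M M \<pi>"
    unfolding \<pi>_def[abs_def]
    by (intro smooth_map_act[OF atlas] smooth_map_compose[OF atlas R R f smooth_\<gamma>] smooth_map_id[OF atlas])
  show "\<pi> x \<in> level_set M f l" if "x \<in> points M" for x using \<pi>_level[OF that] by simp
qed

lemma smooth_\<Psi>: "smooth_map M N \<Psi>"
  unfolding \<Psi>_def[abs_def] by (rule smooth_map_Pair[OF atlas smooth_atlas_pos_reals atlas_L f smooth_\<pi>])

lemma f_\<Phi>: "r > 0 \<Longrightarrow> x \<in> points L \<Longrightarrow> f (\<Phi> (r, x)) = r"
  unfolding points_L using f_act[OF \<beta>_pos, of r x] l by (simp add: \<Phi>_def \<beta>_powr)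

lemma \<Psi>_\<Phi>: "p \<in> points N \<Longrightarrow> \<Psi> (\<Phi> p) = p"
proof -
  assume p: "p \<in> points N"
  then obtain r x where rx: "p = (r, x)" "r > 0" "x \<in> points L" by auto
  have "\<pi> (\<Phi> (r, x)) = m (\<gamma> r * \<beta> r) x"
    using act_mult[OF \<gamma>_pos[OF rx(2)] \<beta>_pos[OF rx(2)], of x] rx(3) f_\<Phi>[OF rx(2,3)]
    by (simp add: \<pi>_def \<Phi>_def)
  then show ?thesis
    using rx f_\<Phi>[OF rx(2,3)] act_one[of x] \<beta>_\<gamma>[OF rx(2)] by (simp add: \<Psi>_def mult.commute)
qed

lemma \<Phi>_\<Psi>: "y \<in> points M \<Longrightarrow> \<Phi> (\<Psi> y) = y"
  using act_mult[OF \<beta>_pos[OF f_pos] \<gamma>_pos[OF f_pos], of y y y] \<beta>_\<gamma>[OF f_pos, of y] act_one[of y]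
  by (simp add: \<Phi>_def \<Psi>_def \<pi>_def)

lemma \<pi>_inclusion: "x \<in> points L \<Longrightarrow> \<pi> x = x"
  using \<Psi>_\<Phi>[of "(l, x)"] l act_one[of x] \<beta>_def by (simp add: \<Psi>_def \<Phi>_def points_L powr_divide)

text \<open>
  Split \<open>X\<close> into its components along the two factors. For fixed \<open>x\<close>, the curve \<open>\<Phi> (-, x)\<close> runs through the orbit of
  \<open>x\<close>; for fixed \<open>r\<close>, the map \<open>\<Phi> (r, -)\<close> is the action of \<open>\<beta> r\<close> on the level set.
\<close>

lemma tangent_\<Phi>:
  assumes r: "r > 0" and x: "x \<in> points L" and X: "X \<in> tangent_space N (r, x)"
  defines "\<rho> \<equiv> tangent_map N R fst (r, x) X pos_chart" and "Y \<equiv> tangent_map N L snd (r, x) X"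
  shows "tangent_map N M \<Phi> (r, x) X =
    (\<lambda>d. (\<rho> / (\<alpha> * r)) *\<^sub>R P (\<Phi> (r, x)) d + 1 *\<^sub>R tangent_map M M (m (\<beta> r)) x (T\<iota> x Y) d)"
proof -
  note R = smooth_atlas_pos_reals
  have p: "(r, x) \<in> points N" and r': "r \<in> points R" using r x by auto
  have xM: "x \<in> points M" using x by simp
  have b: "\<beta> r > 0" using \<beta>_pos[OF r] .
  define y where "y = \<Phi> (r, x)"
  have y: "y \<in> points M" "y = m (\<beta> r) x" using smooth_map_points[OF smooth_\<Phi> p] by (simp_all add: y_def \<Phi>_def)
  define A where "A = tangent_map N R fst (r, x) X"
  have A: "A \<in> tangent_space R r" unfolding A_def
    using tangent_map_in[OF atlas_N R smooth_map_fst[OF R atlas_L] p X] by simp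
  have Y: "Y \<in> tangent_space L x" unfolding Y_def
    using tangent_map_in[OF atlas_N atlas_L smooth_map_snd[OF R atlas_L] p X] by simp
  define inl where "inl = (\<lambda>s::real. (s, x))"
  define inr where "inr = (\<lambda>z::'a. (r, z))"
  have inl: "smooth_map R N inl" unfolding inl_def
    by (rule smooth_map_Pair[OF R R atlas_L smooth_map_id[OF R] smooth_map_const[OF R atlas_L x]])
  have inr: "smooth_map L N inr" unfolding inr_def
    by (rule smooth_map_Pair[OF atlas_L R atlas_L smooth_map_const[OF atlas_L R r'] smooth_map_id[OF atlas_L]])
  have TA: "tangent_map R N inl r A \<in> tangent_space N (r, x)"
    using tangent_map_in[OF R atlas_N inl r' A] by (simp add: inl_def)
  have TY: "tangent_map L N inr x Y \<in> tangent_space N (r, x)"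
    using tangent_map_in[OF atlas_L atlas_N inr x Y] by (simp add: inr_def)
  have "X = (\<lambda>e. 1 *\<^sub>R tangent_map R N inl r A e + 1 *\<^sub>R tangent_map L N inr x Y e)"
    using tangent_prod_decompose[OF R atlas_L r' x X] unfolding inl_def inr_def A_def Y_def scaleR_one .
  then have "tangent_map N M \<Phi> (r, x) X =
      (\<lambda>d. 1 *\<^sub>R tangent_map N M \<Phi> (r, x) (tangent_map R N inl r A) d
         + 1 *\<^sub>R tangent_map N M \<Phi> (r, x) (tangent_map L N inr x Y) d)"
    by (simp only: tangent_map_linear[OF atlas_N atlas smooth_\<Phi> p TA TY, of 1 1, symmetric])
  moreover have "tangent_map N M \<Phi> (r, x) (tangent_map R N inl r A) = (\<lambda>d. (\<rho> / (\<alpha> * r)) *\<^sub>R P y d)"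
  proof -
    \<comment> \<open>The curve \<open>s \<mapsto> \<Phi> (s, x)\<close> is the orbit of \<open>y\<close>, reparametrised by \<open>(s / r) powr (1 / \<alpha>)\<close>.\<close>
    define \<tau> where "\<tau> = (\<lambda>s. r powr (- 1 / \<alpha>) * s powr (1 / \<alpha>))"
    have \<tau>: "smooth_map R R \<tau>" unfolding \<tau>_def using r by (intro smooth_map_powr) simp
    have \<tau>r: "\<tau> r = 1" using r by (simp add: \<tau>_def powr_minus_divide)
    have \<tau>\<beta>: "\<tau> s * \<beta> r = \<beta> s" for s
      using r by (simp add: \<tau>_def \<beta>_def powr_minus_divide)
    have orbit: "\<Phi> (inl s) = m (\<tau> s) y" if "s \<in> points R" for s
      using that r act_mult[of "\<tau> s" "\<beta> r" x] b xM \<tau>\<beta> by (simp add: inl_def \<Phi>_def y(2) \<tau>_def)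
    have "tangent_map N M \<Phi> (inl r) (tangent_map R N inl r A) = tangent_map R M (\<lambda>s. \<Phi> (inl s)) r A"
      by (rule tangent_map_compose[OF R atlas_N atlas inl smooth_\<Phi> r' A, symmetric])
    also have "\<dots> = tangent_map R M (\<lambda>s. m (\<tau> s) y) r A"
      by (rule tangent_map_cong[OF R atlas smooth_map_compose[OF R atlas_N atlas inl smooth_\<Phi>] r' A orbit])
    also have "\<dots> = tangent_map R M (\<lambda>a. m a y) (\<tau> r) (tangent_map R R \<tau> r A)"
      by (rule tangent_map_compose[OF R R atlas \<tau> smooth_map_orbit[OF y(1)] r' A])
    also have "tangent_map R R \<tau> r A = (\<lambda>e. (\<rho> / (\<alpha> * r)) *\<^sub>R E e + 0 *\<^sub>R E e)"
    proof (rule tangent_vec_eqI[of _ R 1])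
      show "tangent_map R R \<tau> r A \<in> tangent_space R 1" using tangent_map_in[OF R R \<tau> r' A] \<tau>r by simp
      show "(\<lambda>e. (\<rho> / (\<alpha> * r)) *\<^sub>R E e + 0 *\<^sub>R E e) \<in> tangent_space R 1"
        by (rule tangent_space_lincomb[OF R _ E_tangent E_tangent]) simp
      show "pos_chart \<in> charts_at R 1" by (simp add: charts_at_pos_reals)
      have "tangent_map R R \<tau> r A pos_chart = r powr (- 1 / \<alpha>) * (1 / \<alpha>) * r powr (1 / \<alpha> - 1) * \<rho>"
        unfolding \<tau>_def \<rho>_def A_def[symmetric] using r by (intro tangent_map_powr A) simp_all
      also have "\<dots> = \<rho> / (\<alpha> * r)"
        using r by (simp add: powr_diff powr_minus_divide)
      finally show "tangent_map R R \<tau> r A pos_chart = (\<rho> / (\<alpha> * r)) *\<^sub>R E pos_chart + 0 *\<^sub>R E pos_chart"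
        by (simp add: E_pos)
    qed
    also have "tangent_map R M (\<lambda>a. m a y) (\<tau> r) (\<lambda>e. (\<rho> / (\<alpha> * r)) *\<^sub>R E e + 0 *\<^sub>R E e) =
        (\<lambda>d. (\<rho> / (\<alpha> * r)) *\<^sub>R P y d + 0 *\<^sub>R P y d)"
      unfolding \<tau>r generator_eq[OF y(1)]
      by (rule tangent_map_linear[OF R atlas smooth_map_orbit[OF y(1)] _ E_tangent E_tangent]) simp
    finally show ?thesis by (simp add: inl_def)
  qed
  moreover have "tangent_map N M \<Phi> (r, x) (tangent_map L N inr x Y) = tangent_map M M (m (\<beta> r)) x (T\<iota> x Y)"
  proof -
    have "tangent_map N M \<Phi> (inr x) (tangent_map L N inr x Y) = tangent_map L M (\<lambda>z. \<Phi> (inr z)) x Y"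
      by (rule tangent_map_compose[OF atlas_L atlas_N atlas inr smooth_\<Phi> x Y, symmetric])
    also have "(\<lambda>z. \<Phi> (inr z)) = (\<lambda>z. m (\<beta> r) z)" by (simp add: inr_def \<Phi>_def)
    also have "tangent_map L M (\<lambda>z. m (\<beta> r) z) x Y = tangent_map M M (m (\<beta> r)) x (T\<iota> x Y)"
      by (rule tangent_map_compose[OF atlas_L atlas atlas inclusion smooth_map_act_fixed[OF b] x Y])
    finally show ?thesis by (simp add: inr_def)
  qed
  ultimately show ?thesis by (simp add: y_def)
qed

text \<open>
  The action maps level sets of \<open>f\<close> to level sets, and \<open>g (P, -) = df\<close> vanishes on vectors tangent to these.
\<close>

lemma generator_orthogonal:
  assumes a: "a > 0" and x: "x \<in> points L" and Y: "Y \<in> tangent_space L x"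
  shows "g (m a x) (P (m a x)) (tangent_map M M (m a) x (T\<iota> x Y)) = 0"
proof -
  have xM: "x \<in> points M" using x by simp
  note ma = smooth_map_act_fixed[OF a]
  note TY = tangent_map_in[OF atlas_L atlas inclusion x Y]
  have comp: "tangent_map M M (m a) x (T\<iota> x Y) = tangent_map L M (\<lambda>z. m a z) x Y"
    by (rule tangent_map_compose[OF atlas_L atlas atlas inclusion ma x Y, symmetric])
  note mi = smooth_map_compose[OF atlas_L atlas atlas inclusion ma]
  have "g (m a x) (P (m a x)) (tangent_map M M (m a) x (T\<iota> x Y)) = df (m a x) (tangent_map L M (\<lambda>z. m a z) x Y)"
    unfolding comp by (rule g_generator[OF act_in[OF a xM] tangent_map_in[OF atlas_L atlas mi x Y]])
  also have "\<dots> = tangent_map L R (\<lambda>z. f (m a z)) x Y pos_chart"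
    by (rule df_compose[OF atlas_L mi x Y])
  also have "\<dots> = 0"
    by (rule tangent_map_constant[OF atlas_L smooth_map_compose[OF atlas_L atlas smooth_atlas_pos_reals mi f] x Y,
          where k = "a powr \<alpha> * l"])
      (use f_act[OF a] in \<open>simp add: points_L del: points_sub_mfd\<close>)
  finally show ?thesis .
qed

lemma generator_orthogonal_level:
  assumes x: "x \<in> points L" and Y: "Y \<in> tangent_space L x"
  shows "g x (P x) (T\<iota> x Y) = 0"
proof -
  have xM: "x \<in> points M" using x by simp
  show ?thesis
    using generator_orthogonal[OF _ x Y, of 1] act_one[OF xM]
      tangent_act_one[OF xM tangent_map_in[OF atlas_L atlas inclusion x Y]] by simp
qed

text \<open>
  As \<open>\<Phi>\<close> is a diffeomorphism, \<open>Z\<close> is the image of a tangent vector of the product at \<open>(l, x)\<close>, where \<open>\<beta> l = 1\<close>; the formula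
  for the differential of \<open>\<Phi>\<close> then gives the splitting.
\<close>

lemma tangent_split:
  assumes x: "x \<in> points L" and Z: "Z \<in> tangent_space M x"
  obtains a Y where "Y \<in> tangent_space L x" "Z = (\<lambda>d. a *\<^sub>R P x d + 1 *\<^sub>R T\<iota> x Y d)"
proof -
  note R = smooth_atlas_pos_reals
  have xM: "x \<in> points M" "f x = l" using x by (simp_all add: points_L del: points_sub_mfd)
  have \<Psi>x: "\<Psi> x = (l, x)" using \<pi>_inclusion[OF x] xM(2) by (simp add: \<Psi>_def)
  have \<beta>l: "\<beta> l = 1" using l by (simp add: \<beta>_def powr_divide)
  have \<Phi>x: "\<Phi> (l, x) = x" using \<beta>l act_one[OF xM(1)] by (simp add: \<Phi>_def)
  define W where "W = tangent_map M N \<Psi> x Z"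
  have W: "W \<in> tangent_space N (l, x)" using tangent_map_in[OF atlas atlas_N smooth_\<Psi> xM(1) Z] by (simp add: W_def \<Psi>x)
  have ZW: "tangent_map N M \<Phi> (l, x) W = Z"
    using tangent_map_left_inverse[OF atlas atlas_N smooth_\<Psi> smooth_\<Phi> \<Phi>_\<Psi> xM(1) Z] by (simp add: W_def \<Psi>x)
  define Y where "Y = tangent_map N L snd (l, x) W"
  have Y: "Y \<in> tangent_space L x" unfolding Y_def
    using tangent_map_in[OF atlas_N atlas_L smooth_map_snd[OF R atlas_L] _ W] l x by simp
  have "tangent_map M M (m 1) x (T\<iota> x Y) = T\<iota> x Y"
    by (rule tangent_act_one[OF xM(1) tangent_map_in[OF atlas_L atlas inclusion x Y]])
  then have "Z = (\<lambda>d. (tangent_map N R fst (l, x) W pos_chart / (\<alpha> * l)) *\<^sub>R P x d + 1 *\<^sub>R T\<iota> x Y d)"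
    using tangent_\<Phi>[OF l x W] ZW by (simp add: Y_def \<beta>l \<Phi>x)
  with Y show ?thesis by (rule that)
qed

text \<open>
  The projection \<open>\<pi>\<close> is a smooth retraction onto the level set.
\<close>

lemma inclusion_injective:
  assumes x: "x \<in> points L" and Y: "Y \<in> tangent_space L x"
  shows "tangent_map M L \<pi> x (T\<iota> x Y) = Y"
  using tangent_map_left_inverse[OF atlas_L atlas inclusion smooth_\<pi> \<pi>_inclusion x Y] by simp

lemma level_metric_eq: "level_metric M g f l = pullback L M (\<lambda>x. x) g"
  by (simp add: level_metric_def)

text \<open>
  A vector tangent to the level set is orthogonal to the generator. If it is also orthogonal to the level set, then it is
  orthogonal to all tangent vectors of \<open>M\<close>.
\<close>

lemma level_metric_nondegenerate: "nondegenerate L (level_metric M g f l)"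
  unfolding nondegenerate_def level_metric_eq pullback_def
proof (intro ballI impI)
  fix x X assume x: "x \<in> points L" and X: "X \<in> tangent_space L x"
    and zero: "\<forall>Y\<in>tangent_space L x. g x (T\<iota> x X) (T\<iota> x Y) = 0"
  have xM: "x \<in> points M" using x by simp
  note T = tangent_map_in[OF atlas_L atlas inclusion x]
  have "T\<iota> x X = (\<lambda>_. 0)"
  proof (rule nondegenerateD[OF nondeg xM T[OF X]])
    fix Z assume "Z \<in> tangent_space M x"
    then obtain a Y where Y: "Y \<in> tangent_space L x" "Z = (\<lambda>d. a *\<^sub>R P x d + 1 *\<^sub>R T\<iota> x Y d)"
      by (rule tangent_split[OF x])
    have "g x (T\<iota> x X) Z = a * g x (T\<iota> x X) (P x) + 1 * g x (T\<iota> x X) (T\<iota> x Y)"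
      unfolding Y(2) by (rule symmetric_bilinear_right[OF atlas sym xM generator_tangent[OF xM] T[OF Y(1)] T[OF X]])
    also have "\<dots> = 0"
      using symmetric_bilinearD(1)[OF sym xM T[OF X] generator_tangent[OF xM]]
        generator_orthogonal_level[OF x X] zero Y(1) by simp
    finally show "g x (T\<iota> x X) Z = 0" .
  qed
  then show "X = (\<lambda>_. 0)"
    using inclusion_injective[OF x X] tangent_map_zero[OF atlas atlas_L smooth_\<pi> xM] by simp
qed

text \<open>
  At each point of the level set, the form of \<open>g\<close> is the orthogonal sum of the form of the level metric and of a line on
  which the sign of \<open>g\<close> is that of \<open>\<alpha>\<close>, because \<open>g (P, P) = \<alpha> * l\<close>. So the index of the level metric is that
  of \<open>g\<close>, decreased by \<open>1\<close> if \<open>\<alpha> < 0\<close>, and in particular it is constant.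
\<close>

lemma level_metric_pseudo_riemannian: "pseudo_riemannian_metric L (level_metric M g f l)"
proof -
  obtain \<nu> where \<nu>: "\<And>c x. c \<in> atlas M \<Longrightarrow> x \<in> fst c \<Longrightarrow> index M g c x = \<nu>"
    by (rule pseudo_riemannian_metricE[OF metric]) (rule that)
  have index: "index L (level_metric M g f l) c x = (if \<alpha> > 0 then \<nu> else \<nu> - 1)"
    if c: "c \<in> atlas L" "x \<in> fst c" for c x
  proof -
    have cx: "c \<in> charts_at L x" using c by (simp add: charts_at_def)
    note cm = atlas_subset_maximal[OF atlas_L c(1)]
    have x: "x \<in> points L" by (rule charts_at_points[OF atlas_L cx])
    then have xM: "x \<in> points M" "f x = l" unfolding points_L by blast+
    obtain d where d: "d \<in> atlas M" "x \<in> fst d" "d \<in> charts_at M x" "d \<in> maximal_atlas M"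
      by (rule smooth_atlas_obtain[OF atlas xM(1)])
    define V where "V = model_space d"
    define K where "K = model_space c"
    define B where "B = coord_form M g d x"
    note i = smooth_map_rep[OF atlas_L atlas inclusion cm d(4)]
    obtain D where D: "linear D" "\<And>w. w \<in> K \<Longrightarrow> chart_deriv c d (\<lambda>x. x) x w = D w"
      using chart_deriv_linear[OF i c(2) d(2)] unfolding K_def by blast
    have Tw: "T\<iota> x (coord_vec L c x w) = coord_vec M d x (D w)" if "w \<in> K" for w
      using tangent_map_of_coord_vec[OF atlas_L atlas inclusion cx d(3)] that D(2) by (simp add: K_def)
    have "chart_deriv d c \<pi> x (D w) = w" if "w \<in> K" for w
      using chart_deriv_inverse[OF atlas_L atlas inclusion smooth_\<pi> \<pi>_inclusion cm c(2) d(4,2)] that D(2)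
      by (simp add: K_def)
    then have inj: "inj_on D K" by (rule inj_on_inverseI)
    have K: "subspace K" and V: "subspace V" by (simp_all add: K_def V_def subspace_model_space)
    have DK: "D ` K \<subseteq> V"
      using chart_deriv_in[OF i c(2) d(2)] D(2) by (auto simp: K_def V_def)
    have B: "sym_form V B" unfolding V_def B_def by (rule sym_form_coord_form[OF atlas sym d(4,2)])
    define p where "p = P x d"
    have p: "p \<in> V" unfolding p_def V_def by (rule tangent_space_chart[OF generator_tangent[OF xM(1)] d(3)])
    have Pp: "coord_vec M d x p = P x"
      unfolding p_def by (rule tangent_vec_eq_coord_vec[OF generator_tangent[OF xM(1)] d(3), symmetric])
    have W: "subspace (D ` K)" using D(1) K by (rule linear_subspace_image)
    have cvL: "coord_vec L c x w \<in> tangent_space L x" if "w \<in> K" for w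
      using coord_vec_tangent[OF atlas_L cm c(2)] that by (simp add: K_def)
    have orth: "B p w = 0" if "w \<in> D ` K" for w
      using that generator_orthogonal_level[OF x cvL] Tw by (auto simp: B_def coord_form_def Pp)
    have split: "\<exists>a. \<exists>w\<in>D ` K. v = a *\<^sub>R p + w" if v: "v \<in> V" for v
    proof -
      have "coord_vec M d x v \<in> tangent_space M x" using coord_vec_tangent[OF atlas d(4,2)] v by (simp add: V_def)
      then obtain a Y where Y: "Y \<in> tangent_space L x" "coord_vec M d x v = (\<lambda>e. a *\<^sub>R P x e + 1 *\<^sub>R T\<iota> x Y e)"
        by (rule tangent_split[OF x])
      have Yc: "Y c \<in> K" using tangent_space_chart[OF Y(1) cx] by (simp add: K_def)
      have "v = coord_vec M d x v d" using coord_vec_chart[OF atlas d(3)] v by (simp add: V_def)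
      also have "\<dots> = a *\<^sub>R p + T\<iota> x Y d" using Y(2) by (simp add: p_def)
      also have "T\<iota> x Y d = D (Y c)"
        using tangent_map_chart[OF atlas_L atlas inclusion Y(1) cx d(3)] D(2)[OF Yc] by simp
      finally show ?thesis using Yc by blast
    qed
    have Bpp: "B p p = \<alpha> * l"
      using g_generator[OF xM(1) generator_tangent[OF xM(1)]] df_generator[OF xM(1)] xM(2)
      by (simp add: B_def coord_form_def Pp)
    have iso: "neg_index (D ` K) B = index L (level_metric M g f l) c x"
    proof -
      have "neg_index (D ` K) B = neg_index K (coord_form L (level_metric M g f l) c x)"
        using Tw by (intro neg_index_iso[OF D(1) inj K])
          (simp add: B_def coord_form_def level_metric_eq pullback_def)
      then show ?thesis by (simp add: index_eq_neg_index K_def)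
    qed
    have \<nu>V: "neg_index V B = \<nu>" using \<nu>[OF d(1,2)] by (simp add: index_eq_neg_index V_def B_def)
    show ?thesis
    proof (cases "\<alpha> > 0")
      case True
      then have "B p p > 0" using Bpp l by simp
      from neg_index_split_pos[OF B V W DK p orth split this] show ?thesis using True iso \<nu>V by simp
    next
      case False
      then have "B p p < 0" using Bpp l \<alpha> by (simp add: mult_neg_pos)
      from neg_index_split_neg[OF B V W DK p orth split this] show ?thesis using False iso \<nu>V by simp
    qed
  qed
  show ?thesis
    by (rule pseudo_riemannian_metricI[OF _ _ level_metric_nondegenerate index])
      (unfold level_metric_eq, (rule symmetric_bilinear_pullback[OF atlas_L atlas inclusion sym]
          smooth_tensor_pullback[OF atlas_L atlas inclusion sym tensor])+)
qed

text \<open>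
  By the formula for the differential of \<open>\<Phi>\<close> and the orthogonality of the generator to the images of the level set, no mixed
  terms occur. The radial part is \<open>g (P, P) / (\<alpha> * r)\<^sup>2 = 1 / (\<alpha> * r)\<close>, and on the level set the action of \<open>\<beta> r\<close> scales \<open>g\<close>
  by \<open>\<beta> r powr \<alpha> = r / l\<close>.
\<close>

lemma pullback_\<Phi>:
  assumes p: "p \<in> points N" and X: "X \<in> tangent_space N p" and Y: "Y \<in> tangent_space N p"
  shows "pullback N M \<Phi> (\<lambda>x X Y. v (f x) * g x X Y) p X Y =
    warped_metric L (level_metric M g f l) \<alpha> l v p X Y"
proof -
  note R = smooth_atlas_pos_reals
  obtain r x where rx: "p = (r, x)" "r > 0" "x \<in> points L" using p by auto
  have xM: "x \<in> points M" using rx(3) by simp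
  have XY: "X \<in> tangent_space N (r, x)" "Y \<in> tangent_space N (r, x)" using X Y rx(1) by simp_all
  define y where "y = \<Phi> (r, x)"
  have y: "y \<in> points M" "y = m (\<beta> r) x" "f y = r"
    using smooth_map_points[OF smooth_\<Phi> p] f_\<Phi>[OF rx(2,3)] by (simp_all add: y_def \<Phi>_def rx(1))
  define dr where "dr = (\<lambda>X. tangent_map N R fst (r, x) X pos_chart)"
  define q where "q = (\<lambda>X. tangent_map N L snd (r, x) X)"
  define k where "k = (\<lambda>X. tangent_map M M (m (\<beta> r)) x (T\<iota> x (q X)))"
  have T\<Phi>: "tangent_map N M \<Phi> (r, x) X = (\<lambda>d. (dr X / (\<alpha> * r)) *\<^sub>R P y d + 1 *\<^sub>R k X d)"
    if "X \<in> tangent_space N (r, x)" for X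
    unfolding dr_def k_def q_def y_def by (rule tangent_\<Phi>[OF rx(2,3) that])
  have pN: "(r, x) \<in> points N" using p rx(1) by simp
  have q: "q X \<in> tangent_space L x" if "X \<in> tangent_space N (r, x)" for X
    using tangent_map_in[OF atlas_N atlas_L smooth_map_snd[OF R atlas_L] pN that] by (simp add: q_def)
  have Tq: "T\<iota> x (q X) \<in> tangent_space M x" if "X \<in> tangent_space N (r, x)" for X
    by (rule tangent_map_in[OF atlas_L atlas inclusion rx(3) q[OF that]])
  have k: "k X \<in> tangent_space M y" if "X \<in> tangent_space N (r, x)" for X
    unfolding k_def y(2) by (rule tangent_map_in[OF atlas atlas smooth_map_act_fixed[OF \<beta>_pos[OF rx(2)]] xM Tq[OF that]])
  have Pk: "g y (P y) (k X) = 0" if "X \<in> tangent_space N (r, x)" for X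
    unfolding y(2) k_def by (rule generator_orthogonal[OF \<beta>_pos[OF rx(2)] rx(3) q[OF that]])
  have kk: "g y (k X) (k Y) = r / l * g x (T\<iota> x (q X)) (T\<iota> x (q Y))"
    using g_act[OF \<beta>_pos[OF rx(2)] xM Tq[OF XY(1)] Tq[OF XY(2)]] \<beta>_powr[OF rx(2)] by (simp add: k_def y(2))
  note Py = generator_tangent[OF y(1)]
  have PP: "g y (P y) (P y) = \<alpha> * r" using g_generator[OF y(1) Py] df_generator[OF y(1)] y(3) by simp
  have kP: "g y (k X) (P y) = 0" using symmetric_bilinearD(1)[OF sym y(1) k[OF XY(1)] Py] Pk[OF XY(1)] by simp
  have lin: "g y (\<lambda>d. (dr X / (\<alpha> * r)) *\<^sub>R P y d + 1 *\<^sub>R k X d) Z = dr X / (\<alpha> * r) * g y (P y) Z + 1 * g y (k X) Z"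
    if "Z \<in> tangent_space M y" for Z
    by (rule symmetric_bilinearD(2)[OF sym y(1) Py k[OF XY(1)] that])
  have lin2: "g y Z (\<lambda>d. (dr Y / (\<alpha> * r)) *\<^sub>R P y d + 1 *\<^sub>R k Y d) = dr Y / (\<alpha> * r) * g y Z (P y) + 1 * g y Z (k Y)"
    if "Z \<in> tangent_space M y" for Z
    by (rule symmetric_bilinear_right[OF atlas sym y(1) Py k[OF XY(2)] that])
  have TY: "(\<lambda>d. (dr Y / (\<alpha> * r)) *\<^sub>R P y d + 1 *\<^sub>R k Y d) \<in> tangent_space M y"
    by (rule tangent_space_lincomb[OF atlas y(1) Py k[OF XY(2)]])
  have "g y (tangent_map N M \<Phi> (r, x) X) (tangent_map N M \<Phi> (r, x) Y) =
      dr X / (\<alpha> * r) * (dr Y / (\<alpha> * r) * (\<alpha> * r)) + r / l * g x (T\<iota> x (q X)) (T\<iota> x (q Y))"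
    unfolding T\<Phi>[OF XY(1)] T\<Phi>[OF XY(2)] lin[OF TY] lin2[OF Py] lin2[OF k[OF XY(1)]] PP kP Pk[OF XY(2)] kk by simp
  also have "dr X / (\<alpha> * r) * (dr Y / (\<alpha> * r) * (\<alpha> * r)) = 1 / (\<alpha> * r) * (dr X * dr Y)"
    using rx(2) \<alpha> by simp
  finally have main: "g y (tangent_map N M \<Phi> (r, x) X) (tangent_map N M \<Phi> (r, x) Y) =
      1 / (\<alpha> * r) * (dr X * dr Y) + r / l * g x (T\<iota> x (q X)) (T\<iota> x (q Y))" .
  have diff: "differential N fst (r, x) X = dr X" for X
    unfolding dr_def using rx(2) by (intro differential_eq_tangent_map) simp
  show ?thesis
    unfolding rx(1) pullback_def warped_metric_def level_metric_eq Let_def diff fst_conv snd_conv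
      y_def[symmetric] q_def[symmetric] main y(3) ..
qed

lemma warped_isometry:
  assumes v: "smooth_map R R v"
  shows "isometry N (warped_metric L (level_metric M g f l) \<alpha> l v) M (\<lambda>x X Y. v (f x) * g x X Y) \<Phi>"
proof -
  note R = smooth_atlas_pos_reals
  have conf: "pseudo_riemannian_metric M (\<lambda>x X Y. v (f x) * g x X Y)"
    by (rule pseudo_riemannian_metric_conformal[OF atlas metric smooth_map_compose[OF atlas R R f v]])
  have "pseudo_riemannian_metric N (pullback N M \<Phi> (\<lambda>x X Y. v (f x) * g x X Y))"
    by (rule pseudo_riemannian_metric_pullback_diffeo[OF atlas_N atlas smooth_\<Phi> smooth_\<Psi> \<Psi>_\<Phi> \<Phi>_\<Psi> conf])
  then have "pseudo_riemannian_metric N (warped_metric L (level_metric M g f l) \<alpha> l v)"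
    by (rule pseudo_riemannian_metric_cong[OF atlas_N]) (rule pullback_\<Phi>)
  moreover have "smooth_manifold N"
    by (rule smooth_manifold_prod[OF smooth_manifold_pos_reals smooth_manifold_sub_mfd[OF manifold level_submanifold]])
  moreover have "diffeomorphism N M \<Phi>"
    unfolding diffeomorphism_def using smooth_\<Phi> smooth_\<Psi> \<Psi>_\<Phi> \<Phi>_\<Psi> by blast
  ultimately show ?thesis
    unfolding isometry_def pseudo_riemannian_manifold_def using manifold conf pullback_\<Phi> by blast
qed

end

theorem theorem1p2:
  fixes M :: "('a, 'e::euclidean_space) mfd"
    and g :: "('a, 'e) tensor2"
    and m :: "real \<Rightarrow> 'a \<Rightarrow> 'a"
    and f :: "'a \<Rightarrow> real"
    and \<alpha> :: real
  assumes "pseudo_riemannian_manifold M g"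
    and "free_smooth_action M m"
    and "smooth_map M pos_reals f"
    and "\<alpha> \<noteq> 0"
    and "homogeneous_pair M m \<alpha> g f"
  shows "(\<forall>l>0. submanifold M (level_set M f l) \<and>
                pseudo_riemannian_metric (sub_mfd M (level_set M f l)) (level_metric M g f l)) \<and>
         (\<forall>l>0. \<forall>v. smooth_map pos_reals pos_reals v \<longrightarrow>
            (\<exists>\<Phi>. isometry
                   (prod_mfd pos_reals (sub_mfd M (level_set M f l)))
                   (warped_metric (sub_mfd M (level_set M f l)) (level_metric M g f l) \<alpha> l v)
                   M (\<lambda>x X Y. v (f x) * g x X Y) \<Phi>))"
proof (intro conjI allI impI)
  fix l :: real assume "l > 0"
  then interpret homogeneous_level M g m f \<alpha> l using assms by unfold_locales
  show "submanifold M (level_set M f l)" by (rule level_submanifold)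
  show "pseudo_riemannian_metric (sub_mfd M (level_set M f l)) (level_metric M g f l)"
    by (rule level_metric_pseudo_riemannian)
next
  fix l :: real and v assume "l > 0" and v: "smooth_map pos_reals pos_reals v"
  then interpret homogeneous_level M g m f \<alpha> l using assms by unfold_locales
  show "\<exists>\<Phi>. isometry (prod_mfd pos_reals (sub_mfd M (level_set M f l)))
      (warped_metric (sub_mfd M (level_set M f l)) (level_metric M g f l) \<alpha> l v)
      M (\<lambda>x X Y. v (f x) * g x X Y) \<Phi>"
    using warped_isometry[OF v] by blast
qed

end
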